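(* The set of Lagrange multipliers $\Lambda_L(\bar u,\bar\tau)$ is non-empty.
   Context: **Time crisis problem and standing assumptions.** Fix $T>0$, positive integers $n,m,l$ and $x_0\in\mathbb{R}^n$; $|\cdot|$ is the Euclidean norm. $U\subset\mathbb{R}^m$ is non-empty and closed; $f:\mathbb{R}^n\times\mathbb{R}^m\to\mathbb{R}^n$ is of class $C^2$; there are $c_1,c_2>0$ with $|f(x,u)|\le c_1|x|+c_2$ for all $x\in\mathbb{R}^n$, $u\in U$; for every $x$ the set $\{f(x,u):u\in U\}$ is non-empty, compact and convex; $\phi:\mathbb{R}^n\to\mathbb{R}$ is of class $C^2$; $K\subset\mathbb{R}^n$ is closed with non-empty interior, $K^c$ is its complement and $\mathds{1}_{K^c}$ the indicator function of $K^c$ (value $1$ on $K^c$, $0$ on $K$). Let $\mathcal{U}$ be the set of measurable $u:[0,T]\to U$ and, for $u\in\mathcal{U}$, let $x_u$ be the unique solution on $[0,T]$ of $\dot x=f(x,u)$, $x(0)=x_0$. The time crisis problem is to minimize over $u\in\mathcal{U}$ the cost $J_T(u)=\phi(x_u(T))+\int_0^T\mathds{1}_{K^c}(x_u(t))\,dt$. Fix a global minimizer $\bar u\in\mathcal{U}$ and set $\bar x=x_{\bar u}$. It is assumed that: - There is $c:\mathbb{R}^m\to\mathbb{R}^l$ of class $C^2$ with $U=\{u: c_i(u)\le 0,\ 1\le i\le l\}$, and there are $\varepsilon,\delta>0$ such that, with $I(t)=\{i: c_i(\bar u(t))\ge-\delta\}$, one has $\varepsilon|\xi|\le\big|\sum_{i\in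 I(t)}\xi_i\nabla c_i(\bar u(t))\big|$ for all $\xi\in\mathbb{R}^{I(t)}$, for a.e. $t\in(0,T)$. - There is $g:\mathbb{R}^n\to\mathbb{R}$ of class $C^1$ with $K=\{x: g(x)\le 0\}$. - $\bar x$ has exactly one crossing time $\bar\tau\in(0,T)$; it is a transverse crossing time from $K$ to $K^c$: there is $\eta>0$ with $\bar x(t)\in K$ for $t\in(\bar\tau-\eta,\bar\tau]$ and $\bar x(t)\in K^c$ for $t\in(\bar\tau,\bar\tau+\eta)$; $\bar u$ is left- and right-continuous at $\bar\tau$ (one-sided limits $\bar u(\bar\tau^\pm)$ exist); and $\dot{\bar x}(\bar\tau^\pm)\cdot\nabla g(\bar x(\bar\tau))\ne0$, where $\dot{\bar x}(\bar\tau^\pm)=f(\bar x(\bar\tau),\bar u(\bar\tau^\pm))$. Moreover $g(\bar x(t))\neq0$ for all $t\in[0,T]\setminus\{\bar\tau\}$ (so $x_0\in\mathrm{Int}(K)$). **Hamiltonians.** $H(x,p,u)=p\cdot f(x,u)$ and $H^a(x,p,u,\nu)=p\cdot f(x,u)+\nu\cdot c(u)$, for $x,p\in\mathbb{R}^n$, $u\in\mathbb{R}^m$, $\nu\in\mathbb{R}^l$. Set $\rho_{\bar\tau}(t)=1/\bar\tau$ for $t\in(0,\bar\tau)$ and $\rho_{\bar\tau}(t)=-1/(T-\bar\tau)$ for $t\in(\bar\tau,T)$. **Lagrange multipliers.** $\Lambda_L(\bar u,\bar\tau)$ is the set of non-zero triplets $(\alpha,\gamma,\nu)\in[0,\infty)\times\mathbb{R}\times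 L^\infty(0,T;\mathbb{R}^l)$ such that: (i) $\nu(t)\ge0$ and $\nu(t)\cdot c(\bar u(t))=0$ for a.e. $t$; (ii) there is $p:[0,T]\to\mathbb{R}^n$, absolutely continuous on $[0,\bar\tau)$ and on $(\bar\tau,T]$, with $\dot p(t)=-\nabla_xH(\bar x(t),p(t),\bar u(t))$ for a.e. $t$, $p(T)=\alpha\nabla\phi(\bar x(T))$, and jump condition $p(\bar\tau^+)-p(\bar\tau^-)=\gamma\nabla g(\bar x(\bar\tau))$; (iii) $\nabla_uH^a(\bar x(t),p(t),\bar u(t),\nu(t))=0$ for a.e. $t$; (iv) $\int_0^T\rho_{\bar\tau}(t)H(\bar x(t),p(t),\bar u(t))\,dt=\alpha$.
   Formalization: The global minimizer ū is additionally assumed to be essentially bounded on (0,T); for an essentially unbounded ū the adjoint equation can fail to have an absolutely continuous solution and the set of multipliers can be empty. *)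

theory Defs
  imports "HOL-Analysis.Analysis"
begin

definition C1_function :: "('a::real_normed_vector \<Rightarrow> 'b::real_normed_vector) \<Rightarrow> bool" where
  "C1_function f \<longleftrightarrow>
     (\<exists>f' :: 'a \<Rightarrow> 'a \<Rightarrow>\<^sub>L 'b.
        (\<forall>x. (f has_derivative blinfun_apply (f' x)) (at x)) \<and> continuous_on UNIV f')"

definition C2_function :: "('a::real_normed_vector \<Rightarrow> 'b::real_normed_vector) \<Rightarrow> bool" where
  "C2_function f \<longleftrightarrow>
     (\<exists>f' :: 'a \<Rightarrow> 'a \<Rightarrow>\<^sub>L 'b.
        (\<forall>x. (f has_derivative blinfun_apply (f' x)) (at x)) \<and> C1_function f')"

definition gradient :: "('a::real_inner \<Rightarrow> real) \<Rightarrow> 'a \<Rightarrow> 'a" where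
  "gradient f x = (THE D. GDERIV f x :> D)"

lemma gradient_eqI:
  assumes "GDERIV f x :> D"
  shows "gradient f x = D"
  unfolding gradient_def
proof (rule the_equality, rule assms)
  fix D'
  assume "GDERIV f x :> D'"
  with assms have "(\<lambda>h. h \<bullet> D') = (\<lambda>h. h \<bullet> D)"
    unfolding gderiv_def by (blast intro: has_derivative_unique)
  then have "(D' - D) \<bullet> (D' - D) = 0"
    by (metis inner_diff_right right_minus_eq)
  then show "D' = D"
    by simp
qed

text \<open>The usual \<open>\<epsilon>\<close>-\<open>\<delta>\<close> definition of absolute continuity on an interval \<open>S\<close>: for intervals
  on the line, \<open>D division_of \<Union>D\<close> says that \<open>D\<close> is a finite family of non-overlapping compact
  intervals. On a bounded interval that is not closed, the condition is uniform up to the missing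
  end points, so that the one-sided limits there exist.\<close>

definition absolutely_continuous_on :: "real set \<Rightarrow> (real \<Rightarrow> 'a::real_normed_vector) \<Rightarrow> bool" where
  "absolutely_continuous_on S f \<longleftrightarrow>
     (\<forall>\<epsilon>>0. \<exists>\<delta>>0. \<forall>D. D division_of \<Union>D \<and> \<Union>D \<subseteq> S \<and> (\<Sum>I\<in>D. Sup I - Inf I) < \<delta> \<longrightarrow>
        (\<Sum>I\<in>D. norm (f (Sup I) - f (Inf I))) < \<epsilon>)"

definition admissible_controls :: "(real^'m) set \<Rightarrow> real \<Rightarrow> (real \<Rightarrow> real^'m) set" where
  "admissible_controls U T =
     {u. u \<in> borel_measurable (lebesgue_on {0..T}) \<and> (\<forall>t\<in>{0..T}. u t \<in> U)}"

definition state_of ::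
  "((real^'n) \<times> (real^'m) \<Rightarrow> real^'n) \<Rightarrow> real^'n \<Rightarrow> real \<Rightarrow> (real \<Rightarrow> real^'m) \<Rightarrow> (real \<Rightarrow> real^'n) \<Rightarrow> bool"
  where
  "state_of f x0 T u x \<longleftrightarrow>
     absolutely_continuous_on {0..T} x \<and> x 0 = x0 \<and>
     (AE t in lebesgue_on {0<..<T}. (x has_vector_derivative f (x t, u t)) (at t))"

text \<open>The cost \<open>J\<^sub>T(u)\<close> depends on the control only through the state \<open>x = x\<^sub>u\<close>.\<close>

definition crisis_cost :: "(real^'n \<Rightarrow> real) \<Rightarrow> (real^'n) set \<Rightarrow> real \<Rightarrow> (real \<Rightarrow> real^'n) \<Rightarrow> real" where
  "crisis_cost \<phi> K T x = \<phi> (x T) + (LINT t|lebesgue_on {0..T}. indicator (- K) (x t))"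

text \<open>Minimality is stated over all pairs of an admissible control and a corresponding state; where
  the state of each control is unique, this is minimality of \<open>u \<mapsto> J\<^sub>T(u)\<close>.\<close>

definition global_minimizer ::
  "((real^'n) \<times> (real^'m) \<Rightarrow> real^'n) \<Rightarrow> (real^'m) set \<Rightarrow> (real^'n \<Rightarrow> real) \<Rightarrow> (real^'n) set \<Rightarrow>
   real^'n \<Rightarrow> real \<Rightarrow> (real \<Rightarrow> real^'m) \<Rightarrow> (real \<Rightarrow> real^'n) \<Rightarrow> bool"
  where
  "global_minimizer f U \<phi> K x0 T ubar xbar \<longleftrightarrow>
     ubar \<in> admissible_controls U T \<and> state_of f x0 T ubar xbar \<and>
     (\<forall>u\<in>admissible_controls U T. \<forall>x. state_of f x0 T u x \<longrightarrow>
        crisis_cost \<phi> K T xbar \<le> crisis_cost \<phi> K T x)"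

definition crossing_out :: "'a set \<Rightarrow> real \<Rightarrow> (real \<Rightarrow> 'a) \<Rightarrow> real \<Rightarrow> bool" where
  "crossing_out K T x \<tau> \<longleftrightarrow>
     (\<exists>\<eta>>0. {\<tau> - \<eta><..<\<tau> + \<eta>} \<subseteq> {0..T} \<and>
        (\<forall>t\<in>{\<tau> - \<eta><..\<tau>}. x t \<in> K) \<and> (\<forall>t\<in>{\<tau><..<\<tau> + \<eta>}. x t \<in> - K))"

definition crossing_in :: "'a set \<Rightarrow> real \<Rightarrow> (real \<Rightarrow> 'a) \<Rightarrow> real \<Rightarrow> bool" where
  "crossing_in K T x \<tau> \<longleftrightarrow>
     (\<exists>\<eta>>0. {\<tau> - \<eta><..<\<tau> + \<eta>} \<subseteq> {0..T} \<and>
        (\<forall>t\<in>{\<tau> - \<eta><..<\<tau>}. x t \<in> - K) \<and> (\<forall>t\<in>{\<tau>..<\<tau> + \<eta>}. x t \<in> K))"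

definition crossing_time :: "'a set \<Rightarrow> real \<Rightarrow> (real \<Rightarrow> 'a) \<Rightarrow> real \<Rightarrow> bool" where
  "crossing_time K T x \<tau> \<longleftrightarrow> crossing_out K T x \<tau> \<or> crossing_in K T x \<tau>"

definition hamiltonian ::
  "((real^'n) \<times> (real^'m) \<Rightarrow> real^'n) \<Rightarrow> real^'n \<Rightarrow> real^'n \<Rightarrow> real^'m \<Rightarrow> real"
  where
  "hamiltonian f x p u = p \<bullet> f (x, u)"

definition augmented_hamiltonian ::
  "((real^'n) \<times> (real^'m) \<Rightarrow> real^'n) \<Rightarrow> (real^'m \<Rightarrow> real^'l) \<Rightarrow>
   real^'n \<Rightarrow> real^'n \<Rightarrow> real^'m \<Rightarrow> real^'l \<Rightarrow> real"
  where
  "augmented_hamiltonian f c x p u \<nu> = p \<bullet> f (x, u) + \<nu> \<bullet> c u"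

text \<open>The value at \<open>t = \<tau>\<close> is irrelevant.\<close>

definition rho :: "real \<Rightarrow> real \<Rightarrow> real \<Rightarrow> real" where
  "rho T \<tau> t = (if t < \<tau> then 1 / \<tau> else - 1 / (T - \<tau>))"

definition L_infinity :: "real \<Rightarrow> (real \<Rightarrow> 'a::euclidean_space) set" where
  "L_infinity T =
     {v. v \<in> borel_measurable (lebesgue_on {0<..<T}) \<and>
         (\<exists>B. AE t in lebesgue_on {0<..<T}. norm (v t) \<le> B)}"

definition costate ::
  "((real^'n) \<times> (real^'m) \<Rightarrow> real^'n) \<Rightarrow> (real^'n \<Rightarrow> real) \<Rightarrow> (real^'n \<Rightarrow> real) \<Rightarrow> real \<Rightarrow>
   (real \<Rightarrow> real^'m) \<Rightarrow> (real \<Rightarrow> real^'n) \<Rightarrow> real \<Rightarrow> real \<Rightarrow> real \<Rightarrow> (real \<Rightarrow> real^'n) \<Rightarrow> bool"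
  where
  "costate f \<phi> g T ubar xbar \<tau> \<alpha> \<gamma> p \<longleftrightarrow>
     absolutely_continuous_on {0..<\<tau>} p \<and> absolutely_continuous_on {\<tau><..T} p \<and>
     (AE t in lebesgue_on {0<..<T}.
        (p has_vector_derivative - gradient (\<lambda>x. hamiltonian f x (p t) (ubar t)) (xbar t)) (at t)) \<and>
     p T = \<alpha> *\<^sub>R gradient \<phi> (xbar T) \<and>
     (\<exists>p_minus p_plus. (p \<longlongrightarrow> p_minus) (at_left \<tau>) \<and> (p \<longlongrightarrow> p_plus) (at_right \<tau>) \<and>
        p_plus - p_minus = \<gamma> *\<^sub>R gradient g (xbar \<tau>))"

text \<open>Elements of \<open>L\<^sup>\<infinity>\<close> are represented by functions, so that \<open>\<nu>\<close> being zero means that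
  it vanishes almost everywhere.\<close>

definition lagrange_multipliers ::
  "((real^'n) \<times> (real^'m) \<Rightarrow> real^'n) \<Rightarrow> (real^'n \<Rightarrow> real) \<Rightarrow> (real^'m \<Rightarrow> real^'l) \<Rightarrow> (real^'n \<Rightarrow> real) \<Rightarrow>
   real \<Rightarrow> (real \<Rightarrow> real^'m) \<Rightarrow> (real \<Rightarrow> real^'n) \<Rightarrow> real \<Rightarrow> (real \<times> real \<times> (real \<Rightarrow> real^'l)) set"
  where
  "lagrange_multipliers f \<phi> c g T ubar xbar \<tau> =
     {(\<alpha>, \<gamma>, \<nu>).
        0 \<le> \<alpha> \<and> \<nu> \<in> L_infinity T \<and>
        \<not> (\<alpha> = 0 \<and> \<gamma> = 0 \<and> (AE t in lebesgue_on {0<..<T}. \<nu> t = 0)) \<and>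
        (AE t in lebesgue_on {0<..<T}. (\<forall>i. 0 \<le> \<nu> t $ i) \<and> \<nu> t \<bullet> c (ubar t) = 0) \<and>
        (\<exists>p. costate f \<phi> g T ubar xbar \<tau> \<alpha> \<gamma> p \<and>
           (AE t in lebesgue_on {0<..<T}.
              gradient (\<lambda>u. augmented_hamiltonian f c (xbar t) (p t) u (\<nu> t)) (ubar t) = 0) \<and>
           (LINT t|lebesgue_on {0<..<T}. rho T \<tau> t * hamiltonian f (xbar t) (p t) (ubar t)) = \<alpha>)}"

end

theory Submission
  imports Defs
begin

text \<open>A pair \<open>(v, \<sigma>)\<close> consists of a perturbation \<open>v\<close> of the control and a shift \<open>\<sigma>\<close> of the crossing time; the
  shift acts by rescaling time affinely on both sides of \<open>\<tau>\<close>, whence the factor \<open>\<rho>\<close>. With \<open>y\<close> the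
  linearized state, optimality excludes pairs with \<open>\<phi>' (y T) - \<sigma> < 0\<close> and \<open>g' (x \<tau>) (y \<tau>) < 0\<close>. As the pairs
  with strictly feasible \<open>v\<close> form a convex set, separating its image in the plane from the negative
  quadrant gives \<open>(\<alpha>, \<gamma>) \<noteq> 0\<close>. Adjoint states, started at \<open>T\<close> from the gradient of \<open>\<phi>\<close> and at \<open>\<tau>\<close> from
  that of \<open>g\<close>, turn the separating functional into integrals: the coefficient of \<open>\<sigma>\<close> is the
  Hamiltonian condition, and the part in \<open>v\<close> gives \<open>\<nu>\<close> by solving a Gram system, uniformly invertible by
  the constraint qualification.\<close>

text \<open>The indicator jumps at the boundary of \<open>K\<close>, so the cost has no usable
  derivative along a perturbation of the control alone. Rescaling time turns the switching instant
  into a scalar parameter: a trajectory that stays in \<open>K\<close> up to \<tau> + s \<sigma>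
  costs at most \<phi> at its end point plus T - \<tau> - s \<sigma>, which is smooth in s. This is
  the origin of the term - \<sigma> in the excluded inequality. Strict feasibility makes u + s v
  admissible for all small s without any correction. The separation can therefore take place in the
  plane, between a convex set and an open cone, and the multiplier \<nu> in the function space is
  constructed afterwards, pointwise in t. The price is uniformity: one s has to serve all t. Hence
  the estimates use a bound on the control, and the control is altered on a null set so that the
  hypotheses made for almost every t hold at every t. Since controls are merely measurable, states,
  linearized states and adjoint states are all handled as integral equations, and the gauge integral
  provides the passage between these and derivatives almost everywhere.\<close>

section \<open>Absolutely continuous functions\<close>

text \<open>At a bad point \<open>t\<close>, arbitrarily short intervals tagged by \<open>t\<close> have a Riemann error larger than
  \<open>\<epsilon>\<close> times their length. Henstock's lemma makes the total length of disjoint such intervals small,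
  and Vitali's covering lemma bounds the measure of the set of bad points by five times that length.\<close>

lemma negligible_bad_derivates:
  fixes f :: "real \<Rightarrow> 'a::euclidean_space"
  assumes f: "f integrable_on {a..b}" and "\<epsilon> > 0"
  defines "F \<equiv> \<lambda>t. integral {a..t} f"
  shows "negligible {t \<in> {a<..<b}. \<forall>d>0. \<exists>s\<in>{a..b}. s \<noteq> t \<and> \<bar>s - t\<bar> < d \<and>
           norm (F s - F t - (s - t) *\<^sub>R f t) > \<epsilon> * \<bar>s - t\<bar>}" (is "negligible ?E")
  unfolding negligible_outer_le
proof (intro allI impI)
  fix e :: real assume "e > 0"
  \<comment> \<open>Enlarging an interval of radius r five times gives length 10 r, while its
    Riemann error is at least 2 \<epsilon> r. A total error below e \<epsilon> / 10 thus leaves a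
    total enlarged length of at most e / 2.\<close>
  then have e': "e * \<epsilon> / 10 > 0" using \<open>\<epsilon> > 0\<close> by simp
  have "f integrable_on cbox a b" using f by simp
  from Henstock_lemma[OF this e']
  obtain \<gamma> where "gauge \<gamma>" and \<gamma>: "\<And>p. \<lbrakk>p tagged_partial_division_of {a..b}; \<gamma> fine p\<rbrakk> \<Longrightarrow>
             (\<Sum>(x,k)\<in>p. norm (measure lborel k *\<^sub>R f x - integral k f)) < e * \<epsilon> / 10"
    by (metis (no_types) box_real(2))
  define I where "I = (\<lambda>(t::real,s). {min t s..max t s})"
  define K where "K = {(t,s). t \<in> ?E \<and> s \<in> {a..b} \<and> s \<noteq> t \<and> I (t,s) \<subseteq> \<gamma> t \<and>
           norm (F s - F t - (s - t) *\<^sub>R f t) > \<epsilon> * \<bar>s - t\<bar>}"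
  define ctr where "ctr = (\<lambda>(t::real,s). (t + s) / 2)"
  define rad where "rad = (\<lambda>(t::real,s). \<bar>s - t\<bar> / 2)"
  have I_cball: "cball (ctr i) (rad i) = I i" for i
    by (cases i) (auto simp: ctr_def rad_def I_def cball_eq_atLeastAtMost min_def max_def field_simps)
  have cover: "?E \<subseteq> (\<Union>i\<in>K. cball (ctr i) (rad i))"
  proof
    fix t assume t: "t \<in> ?E"
    obtain d where "d > 0" and d: "ball t d \<subseteq> \<gamma> t"
      using \<open>gauge \<gamma>\<close> unfolding gauge_def by (metis openE)
    obtain s where s: "s \<in> {a..b}" "s \<noteq> t" "\<bar>s - t\<bar> < d"
      "norm (F s - F t - (s - t) *\<^sub>R f t) > \<epsilon> * \<bar>s - t\<bar>"
      using t \<open>d > 0\<close> by blast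
    have "I (t,s) \<subseteq> ball t d"
      using s by (auto simp: I_def dist_real_def)
    then have "(t,s) \<in> K" using s t d by (auto simp: K_def)
    moreover have "t \<in> I (t,s)" by (auto simp: I_def)
    ultimately show "t \<in> (\<Union>i\<in>K. cball (ctr i) (rad i))" unfolding I_cball by blast
  qed
  have "0 < rad i \<and> rad i \<le> (b - a)" if "i \<in> K" for i
    using that by (auto simp: K_def rad_def)
  from Vitali_covering_lemma_cballs[OF cover this]
  obtain C where "countable C" "C \<subseteq> K"
     and disj: "pairwise (\<lambda>i j. disjnt (cball (ctr i) (rad i)) (cball (ctr j) (rad j))) C"
     and C: "?E \<subseteq> (\<Union>i\<in>C. cball (ctr i) (5 * rad i))"
    .
  have sum_rad: "(\<Sum>i\<in>C'. 10 * rad i) \<le> e" if C': "C' \<subseteq> C" "finite C'" for C'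
  proof -
    let ?p = "(\<lambda>i. (fst i, I i)) ` C'"
    have disj': "I i \<inter> I j = {}" if "i \<in> C'" "j \<in> C'" "i \<noteq> j" for i j
      using disj that C' unfolding pairwise_def disjnt_def I_cball by blast
    have I_ne: "fst i \<in> I i" for i by (cases i) (auto simp: I_def)
    have inj: "inj_on (\<lambda>i. (fst i, I i)) C'"
      by (intro inj_onI) (metis I_ne Pair_inject disj' disjoint_iff)
    have part: "?p tagged_partial_division_of {a..b}"
      unfolding tagged_partial_division_of_def
    proof (intro conjI allI impI)
      show "finite ?p" using C' by simp
    next
      fix x k assume "(x, k) \<in> ?p"
      then obtain i where i: "i \<in> C'" "x = fst i" "k = I i" by auto
      have "i \<in> K" using i C' \<open>C \<subseteq> K\<close> by auto
      show "x \<in> k" using i I_ne by auto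
      show "k \<subseteq> {a..b}" using i \<open>i \<in> K\<close> by (cases i) (auto simp: K_def I_def)
      show "\<exists>a b. k = cbox a b" using i by (cases i) (auto simp: I_def box_real)
    next
      fix x1 k1 x2 k2
      assume "(x1, k1) \<in> ?p \<and> (x2, k2) \<in> ?p \<and> (x1, k1) \<noteq> (x2, k2)"
      then obtain i j where ij: "i \<in> C'" "j \<in> C'" "k1 = I i" "k2 = I j" "i \<noteq> j" by blast
      then have "k1 \<inter> k2 = {}" using disj' by blast
      then show "interior k1 \<inter> interior k2 = {}"
        using interior_subset[of k1] interior_subset[of k2] by blast
    qed
    have "\<gamma> fine ?p"
    proof (rule fineI)
      fix x k assume "(x, k) \<in> ?p"
      then obtain i where i: "i \<in> C'" "x = fst i" "k = I i" by auto
      have "i \<in> K" using i C' \<open>C \<subseteq> K\<close> by auto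
      then show "k \<subseteq> \<gamma> x" using i by (cases i) (auto simp: K_def)
    qed
    then have "(\<Sum>(x,k)\<in>?p. norm (measure lborel k *\<^sub>R f x - integral k f)) < e * \<epsilon> / 10"
      using \<gamma> part by blast
    then have *: "(\<Sum>i\<in>C'. norm (measure lborel (I i) *\<^sub>R f (fst i) - integral (I i) f)) < e * \<epsilon> / 10"
      by (subst (asm) sum.reindex[OF inj]) (simp add: o_def)
    have "2 * \<epsilon> * rad i \<le> norm (measure lborel (I i) *\<^sub>R f (fst i) - integral (I i) f)" if "i \<in> C'" for i
    proof -
      obtain t s where i: "i = (t,s)" by (cases i)
      have "i \<in> K" using that C' \<open>C \<subseteq> K\<close> by auto
      then have ts: "t \<in> {a..b}" "s \<in> {a..b}" "\<epsilon> * \<bar>s - t\<bar> < norm (F s - F t - (s - t) *\<^sub>R f t)"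
        by (auto simp: K_def i)
      have comb: "F v - F u = integral {u..v} f" if "u \<in> {a..b}" "v \<in> {a..b}" "u \<le> v" for u v
        unfolding F_def
        using Henstock_Kurzweil_Integration.integral_combine[of a u v f] f that
          integrable_on_subinterval[OF f, of a v]
        by (auto simp: algebra_simps)
      have "norm (measure lborel (I i) *\<^sub>R f t - integral (I i) f) = norm (F s - F t - (s - t) *\<^sub>R f t)"
      proof (cases "t \<le> s")
        case True
        then show ?thesis using comb[of t s] ts
          by (simp add: i I_def norm_minus_commute)
      next
        case False
        then have "measure lborel (I i) *\<^sub>R f t - integral (I i) f = F s - F t - (s - t) *\<^sub>R f t"
          using comb[of s t] ts by (simp add: i I_def algebra_simps)
        then show ?thesis by simp
      qed
      with ts show ?thesis by (simp add: i rad_def)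
    qed
    then have "(\<Sum>i\<in>C'. 2 * \<epsilon> * rad i) \<le> e * \<epsilon> / 10"
      using * by (smt (verit) sum_mono)
    then have "\<epsilon> * (\<Sum>i\<in>C'. 10 * rad i) \<le> \<epsilon> * (e / 2)"
      by (simp add: sum_distrib_left algebra_simps sum_divide_distrib[symmetric])
    then have "(\<Sum>i\<in>C'. 10 * rad i) \<le> e / 2"
      using \<open>\<epsilon> > 0\<close> by simp
    then show ?thesis using \<open>e > 0\<close> by simp
  qed
  have mb: "measure lebesgue (\<Union>i\<in>C'. cball (ctr i) (5 * rad i)) \<le> e" if "C' \<subseteq> C" "finite C'" for C'
  proof -
    have "measure lebesgue (\<Union>i\<in>C'. cball (ctr i) (5 * rad i)) \<le> (\<Sum>i\<in>C'. measure lebesgue (cball (ctr i) (5 * rad i)))"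
      using that by (intro measure_UNION_le) auto
    also have "\<dots> = (\<Sum>i\<in>C'. 10 * rad i)"
      by (intro sum.cong) (auto simp: cball_eq_atLeastAtMost rad_def)
    finally show ?thesis using sum_rad[OF that] by simp
  qed
  show "\<exists>T. ?E \<subseteq> T \<and> T \<in> lmeasurable \<and> measure lebesgue T \<le> e"
    using C fmeasurable_UN_bound[OF \<open>countable C\<close> _ mb] measure_UN_bound[OF \<open>countable C\<close> _ mb]
    by (intro exI[of _ "\<Union>i\<in>C. cball (ctr i) (5 * rad i)"]) auto
qed

text \<open>If the derivative at t fails to be f t, it fails with some accuracy 1 / (n + 1), so the
  exceptional set is a countable union of sets of bad points.\<close>

lemma indefinite_integral_has_vector_derivative_ae:
  fixes f :: "real \<Rightarrow> 'a::euclidean_space"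
  assumes f: "f integrable_on {a..b}"
  shows "\<exists>N. negligible N \<and>
    (\<forall>t\<in>{a<..<b} - N. ((\<lambda>t. integral {a..t} f) has_vector_derivative f t) (at t))"
proof (intro exI conjI ballI)
  define F where "F = (\<lambda>t. integral {a..t} f)"
  define E where "E n = {t \<in> {a<..<b}. \<forall>d>0. \<exists>s\<in>{a..b}. s \<noteq> t \<and> \<bar>s - t\<bar> < d \<and>
           norm (F s - F t - (s - t) *\<^sub>R f t) > inverse (real (Suc n)) * \<bar>s - t\<bar>}" for n
  show "negligible (\<Union>n. E n)"
    unfolding E_def F_def using negligible_bad_derivates[OF f] by (intro negligible_countable_Union) auto
  fix t assume t: "t \<in> {a<..<b} - (\<Union>n. E n)"
  show "((\<lambda>t. integral {a..t} f) has_vector_derivative f t) (at t)"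
    unfolding has_vector_derivative_def has_derivative_at_alt F_def[symmetric]
  proof (intro conjI allI impI)
    show "bounded_linear (\<lambda>x. x *\<^sub>R f t)" by (rule bounded_linear_scaleR_left)
    fix e :: real assume "e > 0"
    then obtain n where n: "inverse (real (Suc n)) < e" using reals_Archimedean by blast
    define bad where "bad s \<longleftrightarrow>
        norm (F s - F t - (s - t) *\<^sub>R f t) > inverse (real (Suc n)) * \<bar>s - t\<bar>" for s
    have "\<not> (\<forall>d>0. \<exists>s\<in>{a..b}. s \<noteq> t \<and> \<bar>s - t\<bar> < d \<and> bad s)"
    proof
      assume "\<forall>d>0. \<exists>s\<in>{a..b}. s \<noteq> t \<and> \<bar>s - t\<bar> < d \<and> bad s"
      then have "t \<in> E n" unfolding E_def bad_def using t by (intro CollectI conjI) auto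
      then show False using t by blast
    qed
    then obtain d where "d > 0" and d: "\<And>s. s \<in> {a..b} \<Longrightarrow> s \<noteq> t \<Longrightarrow> \<bar>s - t\<bar> < d \<Longrightarrow> \<not> bad s"
      by blast
    show "\<exists>d>0. \<forall>y. norm (y - t) < d \<longrightarrow> norm (F y - F t - (y - t) *\<^sub>R f t) \<le> e * norm (y - t)"
    proof (intro exI[of _ "min d (min (t - a) (b - t))"] conjI allI impI)
      show "0 < min d (min (t - a) (b - t))" using t \<open>d > 0\<close> by auto
      fix s assume s: "norm (s - t) < min d (min (t - a) (b - t))"
      show "norm (F s - F t - (s - t) *\<^sub>R f t) \<le> e * norm (s - t)"
      proof (cases "s = t")
        case False
        then have "norm (F s - F t - (s - t) *\<^sub>R f t) \<le> inverse (real (Suc n)) * \<bar>s - t\<bar>"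
        proof -
          have "s \<in> {a..b}" using s t by (auto simp: abs_less_iff)
          then show ?thesis using s False d[of s] by (simp add: bad_def not_less)
        qed
        also have "\<dots> \<le> e * \<bar>s - t\<bar>" using n by (intro mult_right_mono) auto
        finally show ?thesis by simp
      qed simp
    qed
  qed
qed

text \<open>The gauge keeps the tags in the exceptional set inside an open set of small measure, where absolute
  continuity controls the increments of \<open>F\<close>.\<close>

lemma absolutely_continuous_on_has_integral:
  fixes F :: "real \<Rightarrow> 'a::banach"
  assumes ac: "absolutely_continuous_on {a..b} F" and "a \<le> b" and "negligible N"
    and der: "\<And>t. t \<in> {a<..<b} - N \<Longrightarrow> (F has_vector_derivative f t) (at t)"
  shows "(f has_integral (F b - F a)) {a..b}"
proof -
  \<comment> \<open>The end points join the exceptional set because derivatives are given in the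
    open interval only.\<close>
  define N' where "N' = N \<union> {a,b}"
  define f' where "f' t = (if t \<in> N' then 0 else f t)" for t
  have neg: "negligible N'" using \<open>negligible N\<close> by (simp add: N'_def)
  have "(f' has_integral (F b - F a)) (cbox a b)"
    unfolding has_integral
  proof (intro allI impI)
    fix e :: real assume "e > 0"
    \<comment> \<open>Tags outside \<open>N'\<close> contribute at most \<open>e1\<close> times the
      total length b - a, hence at most e / 2; the summand 1 covers a = b.\<close>
    define e1 where "e1 = e / (2 * (b - a + 1))"
    have "e1 > 0" using \<open>e > 0\<close> \<open>a \<le> b\<close> by (simp add: e1_def)
    obtain \<delta> where "\<delta> > 0" and \<delta>: "\<And>D. D division_of \<Union>D \<Longrightarrow> \<Union>D \<subseteq> {a..b} \<Longrightarrow>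
        (\<Sum>I\<in>D. Sup I - Inf I) < \<delta> \<Longrightarrow> (\<Sum>I\<in>D. norm (F (Sup I) - F (Inf I))) < e / 2"
    proof -
      have "e / 2 > 0" using \<open>e > 0\<close> by simp
      from ac[unfolded absolutely_continuous_on_def, rule_format, OF this] show ?thesis
        using that by blast
    qed
    obtain Ov where "open Ov" "N' \<subseteq> Ov" "Ov \<in> lmeasurable" "measure lebesgue Ov < \<delta>"
    proof -
      obtain W where W: "open W" "N' \<subseteq> W" "W - N' \<in> lmeasurable" "emeasure lebesgue (W - N') < ennreal \<delta>"
        using sets_lebesgue_outer_open[OF negligible_imp_sets[OF neg] \<open>\<delta> > 0\<close>] by metis
      have N'm: "N' \<in> null_sets lebesgue" using neg negligible_iff_null_sets by blast
      have eq: "W = (W - N') \<union> N'" using W by auto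
      have "W \<in> lmeasurable"
        by (subst eq) (intro fmeasurable.Un W negligible_imp_measurable neg)
      moreover have "measure lebesgue W = measure lebesgue (W - N')"
        using N'm by (intro measure_Diff_null_set[symmetric]) (auto intro: fmeasurableD[OF \<open>W \<in> lmeasurable\<close>])
      moreover have "measure lebesgue (W - N') < \<delta>"
        using W \<open>\<delta> > 0\<close> by (simp add: emeasure_eq_measure2 ennreal_less_iff)
      ultimately show ?thesis using W that by metis
    qed
    have "\<exists>d>0. \<forall>y. norm (y - x) < d \<longrightarrow> norm (F y - F x - (y - x) *\<^sub>R f x) \<le> e1 * norm (y - x)"
      if "x \<in> {a..b} - N'" for x
      using der[of x] that \<open>e1 > 0\<close> unfolding has_vector_derivative_def has_derivative_at_alt N'_def
      by force
    then obtain d where d: "\<And>x. x \<in> {a..b} - N' \<Longrightarrow> d x > 0"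
      "\<And>x y. x \<in> {a..b} - N' \<Longrightarrow> norm (y - x) < d x \<Longrightarrow> norm (F y - F x - (y - x) *\<^sub>R f x) \<le> e1 * norm (y - x)"
      by metis
    define \<gamma> where "\<gamma> x = (if x \<in> N' then Ov else if x \<in> {a..b} then ball x (d x) else UNIV)" for x
    have "gauge \<gamma>"
      unfolding gauge_def \<gamma>_def using \<open>open Ov\<close> \<open>N' \<subseteq> Ov\<close> d by auto
    have "norm ((\<Sum>(x,k)\<in>p. measure lborel k *\<^sub>R f' x) - (F b - F a)) < e"
      if p: "p tagged_division_of (cbox a b)" "\<gamma> fine p" for p
    proof -
      let ?G = "\<lambda>k. F (Sup k) - F (Inf k)"
      have "finite p" using p by auto
      have box: "\<exists>u v. u \<le> v \<and> u \<in> {a..b} \<and> v \<in> {a..b} \<and> k = {u..v} \<and> x \<in> {u..v}" if "(x,k) \<in> p" for x k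
      proof -
        from tagged_division_ofD(4)[OF p(1) that] obtain u v where k: "k = {u..v}" by auto
        have "x \<in> k" "k \<subseteq> {a..b}" using tagged_division_ofD(2,3)[OF p(1) that] by auto
        then show ?thesis using k by (intro exI[of _ u] exI[of _ v]) auto
      qed
      define p1 where "p1 = {(x,k) \<in> p. x \<in> N'}"
      define p2 where "p2 = {(x,k) \<in> p. x \<notin> N'}"
      have p12: "p = p1 \<union> p2" "p1 \<inter> p2 = {}" "finite p1" "finite p2"
        using \<open>finite p\<close> by (auto simp: p1_def p2_def intro: finite_subset[OF _ \<open>finite p\<close>])
      have tel: "F b - F a = (\<Sum>(x,k)\<in>p. ?G k)"
        using additive_tagged_division_1[OF \<open>a \<le> b\<close>, of p F] p by simp
      have "(\<Sum>(x,k)\<in>p. measure lborel k *\<^sub>R f' x) - (F b - F a) = (\<Sum>(x,k)\<in>p. measure lborel k *\<^sub>R f' x - ?G k)"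
        unfolding tel by (simp add: sum_subtractf split_def)
      also have "norm \<dots> \<le> (\<Sum>(x,k)\<in>p. norm (measure lborel k *\<^sub>R f' x - ?G k))"
        by (rule order_trans[OF norm_sum]) (simp add: split_def)
      also have "\<dots> = (\<Sum>(x,k)\<in>p1. norm (measure lborel k *\<^sub>R f' x - ?G k)) + (\<Sum>(x,k)\<in>p2. norm (measure lborel k *\<^sub>R f' x - ?G k))"
        by (subst p12(1), rule sum.union_disjoint) (use p12(2-4) in auto)
      also have "(\<Sum>(x,k)\<in>p1. norm (measure lborel k *\<^sub>R f' x - ?G k)) = (\<Sum>(x,k)\<in>p1. norm (?G k))"
        by (intro sum.cong) (auto simp: p1_def f'_def norm_minus_commute)
      also have "(\<Sum>(x,k)\<in>p1. norm (?G k)) < e / 2"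
      proof -
        let ?D = "snd ` p1"
        have part: "p1 tagged_partial_division_of (cbox a b)"
          by (rule tagged_partial_division_subset[of p]) (use p in \<open>auto simp: p1_def tagged_division_of_def\<close>)
        have div: "?D division_of \<Union>?D"
          using partial_division_of_tagged_division[OF part] .
        \<comment> \<open>Absolute continuity speaks of sets of intervals, the Riemann sum of tagged
          intervals. Two tags can share an interval only if it is degenerate, and then the increment
          of F is zero, so the two sums agree.\<close>
        have degen: "Sup (snd i) = Inf (snd i)" if ij: "i \<in> p1" "j \<in> p1" "i \<noteq> j" "snd i = snd j" for i j
        proof -
          have "interior (snd i) = {}"
            using tagged_division_ofD(5)[OF p(1), of "fst i" "snd i" "fst j" "snd j"] ij
            by (auto simp: p1_def prod_eq_iff)
          then show ?thesis using box[of "fst i" "snd i"] ij by (force simp: p1_def interior_atLeastAtMost_real)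
        qed
        have re: "(\<Sum>i\<in>p1. h (snd i)) = (\<Sum>k\<in>?D. h k)" if "\<And>k. Sup k = Inf k \<Longrightarrow> h k = 0" for h :: "real set \<Rightarrow> real"
          using degen that p12 by (subst sum.reindex_nontrivial) auto
        have sub: "\<Union>?D \<subseteq> Ov"
        proof
          fix y assume "y \<in> \<Union>?D"
          then obtain x k where xk: "(x,k) \<in> p" "x \<in> N'" "y \<in> k" by (auto simp: p1_def)
          then have "k \<subseteq> \<gamma> x" using p(2) unfolding fine_def by blast
          then show "y \<in> Ov" using xk by (auto simp: \<gamma>_def)
        qed
        have "(\<Sum>I\<in>?D. Sup I - Inf I) = (\<Sum>I\<in>?D. measure lebesgue I)"
        proof (intro sum.cong refl)
          fix I assume "I \<in> ?D"
          then obtain x where "(x,I) \<in> p" by (auto simp: p1_def)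
          then show "Sup I - Inf I = measure lebesgue I" using box by fastforce
        qed
        also have "\<dots> = measure lebesgue (\<Union>?D)"
          using content_division[OF div] by simp
        also have "\<dots> \<le> measure lebesgue Ov"
          using sub \<open>Ov \<in> lmeasurable\<close> div
          by (intro measure_mono_fmeasurable) (auto intro: fmeasurableD lmeasurable_division)
        also have "\<dots> < \<delta>" by fact
        finally have "(\<Sum>I\<in>?D. norm (?G I)) < e / 2"
          using p(1) by (intro \<delta>[OF div]) (auto simp: p1_def dest: box)
        then show ?thesis
          using re[of "\<lambda>k. norm (?G k)"] by (simp add: split_def)
      qed
      also have "(\<Sum>(x,k)\<in>p2. norm (measure lborel k *\<^sub>R f' x - ?G k)) \<le> (\<Sum>(x,k)\<in>p2. e1 * measure lborel k)"
      proof (intro sum_mono, clarify)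
        fix x k assume xk: "(x,k) \<in> p2"
        then have "(x,k) \<in> p" "x \<notin> N'" by (auto simp: p2_def)
        then obtain u v where uv: "u \<le> v" "u \<in> {a..b}" "v \<in> {a..b}" "k = {u..v}" "x \<in> {u..v}"
          using box by blast
        then have xab: "x \<in> {a..b} - N'" using \<open>x \<notin> N'\<close> by auto
        have "k \<subseteq> \<gamma> x" using p(2) \<open>(x,k) \<in> p\<close> unfolding fine_def by blast
        then have "{u..v} \<subseteq> ball x (d x)"
          using xab uv by (simp add: \<gamma>_def)
        then have "u \<in> ball x (d x)" "v \<in> ball x (d x)" using uv(1) by auto
        then have *: "norm (F u - F x - (u - x) *\<^sub>R f x) \<le> e1 * (x - u)"
          "norm (F v - F x - (v - x) *\<^sub>R f x) \<le> e1 * (v - x)"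
          using d(2)[OF xab, of u] d(2)[OF xab, of v] uv by (auto simp: dist_real_def)
        \<comment> \<open>The tag cuts the interval into two pieces that start at x, so the
          derivative at x estimates both, and their lengths add up.\<close>
        have "measure lborel k *\<^sub>R f' x - ?G k = (F u - F x - (u - x) *\<^sub>R f x) - (F v - F x - (v - x) *\<^sub>R f x)"
          using uv \<open>x \<notin> N'\<close> by (simp add: f'_def algebra_simps)
        then have "norm (measure lborel k *\<^sub>R f' x - ?G k) \<le> e1 * (x - u) + e1 * (v - x)"
          using * norm_triangle_ineq4 by (smt (verit))
        also have "\<dots> = e1 * measure lborel k" using uv by (simp add: algebra_simps)
        finally show "norm (measure lborel k *\<^sub>R f' x - ?G k) \<le> e1 * measure lborel k" .
      qed
      also have "\<dots> \<le> (\<Sum>(x,k)\<in>p. e1 * measure lborel k)"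
        using \<open>e1 > 0\<close> p12 by (intro sum_mono2) (auto simp: \<open>finite p\<close>)
      also have "\<dots> = e1 * (b - a)"
        using additive_content_tagged_division[OF p(1)] \<open>a \<le> b\<close>
        by (simp add: sum_distrib_left[symmetric] split_def)
      also have "\<dots> \<le> e / 2"
        using \<open>e > 0\<close> \<open>a \<le> b\<close> by (simp add: e1_def field_simps)
      finally show ?thesis by simp
    qed
    then show "\<exists>\<gamma>. gauge \<gamma> \<and> (\<forall>p. p tagged_division_of (cbox a b) \<and> \<gamma> fine p \<longrightarrow>
        norm ((\<Sum>(x,k)\<in>p. measure lborel k *\<^sub>R f' x) - (F b - F a)) < e)"
      using \<open>gauge \<gamma>\<close> by blast
  qed
  then show ?thesis
    by (intro has_integral_spike[OF neg, of _ f f']) (auto simp: f'_def)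
qed

lemma lipschitz_on_imp_absolutely_continuous_on:
  assumes "L-lipschitz_on S f"
  shows "absolutely_continuous_on S f"
  unfolding absolutely_continuous_on_def
proof (intro allI impI)
  fix e :: real assume "e > 0"
  have "L \<ge> 0" using assms lipschitz_on_nonneg by blast
  show "\<exists>\<delta>>0. \<forall>D. D division_of \<Union>D \<and> \<Union>D \<subseteq> S \<and> (\<Sum>I\<in>D. Sup I - Inf I) < \<delta> \<longrightarrow>
        (\<Sum>I\<in>D. norm (f (Sup I) - f (Inf I))) < e"
  proof (intro exI[of _ "e / (L + 1)"] conjI allI impI)
    show "0 < e / (L + 1)" using \<open>e > 0\<close> \<open>L \<ge> 0\<close> by simp
    fix D assume D: "D division_of \<Union>D \<and> \<Union>D \<subseteq> S \<and> (\<Sum>I\<in>D. Sup I - Inf I) < e / (L + 1)"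
    have box: "Sup I \<in> S \<and> Inf I \<in> S \<and> Inf I \<le> Sup I" if "I \<in> D" for I
    proof -
      obtain u v where "I = cbox u v" "I \<noteq> {}"
        using division_ofD(3,4)[OF conjunct1[OF D] \<open>I \<in> D\<close>] by blast
      then have "u \<le> v" "I = {u..v}" by auto
      moreover have "I \<subseteq> S" using D that by auto
      ultimately show ?thesis by auto
    qed
    then have "(\<Sum>I\<in>D. norm (f (Sup I) - f (Inf I))) \<le> (\<Sum>I\<in>D. L * (Sup I - Inf I))"
    proof (intro sum_mono)
      fix I assume "I \<in> D"
      then show "norm (f (Sup I) - f (Inf I)) \<le> L * (Sup I - Inf I)"
        using lipschitz_onD[OF assms, of "Sup I" "Inf I"] box[of I] by (simp add: dist_norm)
    qed
    also have "\<dots> = L * (\<Sum>I\<in>D. Sup I - Inf I)" by (simp add: sum_distrib_left)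
    also have "\<dots> \<le> (L + 1) * (\<Sum>I\<in>D. Sup I - Inf I)"
      using box by (intro mult_right_mono sum_nonneg) auto
    also have "\<dots> < e" using D \<open>L \<ge> 0\<close> by (simp add: field_simps)
    finally show "(\<Sum>I\<in>D. norm (f (Sup I) - f (Inf I))) < e" .
  qed
qed

lemma absolutely_continuous_on_imp_continuous_on:
  fixes f :: "real \<Rightarrow> 'a::real_normed_vector"
  assumes "absolutely_continuous_on {a..b} f"
  shows "continuous_on {a..b} f"
  unfolding continuous_on_iff
proof (intro ballI allI impI)
  fix x e :: real assume x: "x \<in> {a..b}" and "e > 0"
  obtain \<delta> where "\<delta> > 0" and \<delta>: "\<And>D. D division_of \<Union>D \<Longrightarrow> \<Union>D \<subseteq> {a..b} \<Longrightarrow>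
        (\<Sum>I\<in>D. Sup I - Inf I) < \<delta> \<Longrightarrow> (\<Sum>I\<in>D. norm (f (Sup I) - f (Inf I))) < e"
    using assms[unfolded absolutely_continuous_on_def, rule_format, OF \<open>e > 0\<close>] by blast
  have *: "norm (f v - f u) < e" if "u \<in> {a..b}" "v \<in> {a..b}" "u \<le> v" "v - u < \<delta>" for u v
  proof -
    have "{{u..v}} division_of \<Union>{{u..v}}"
      using that by (auto simp: division_of_def intro!: exI[of _ u] exI[of _ v])
    then show ?thesis using \<delta>[of "{{u..v}}"] that by auto
  qed
  show "\<exists>d>0. \<forall>x'\<in>{a..b}. dist x' x < d \<longrightarrow> dist (f x') (f x) < e"
  proof (intro exI[of _ \<delta>] conjI ballI impI \<open>\<delta> > 0\<close>)
    fix x' assume "x' \<in> {a..b}" "dist x' x < \<delta>"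
    then show "dist (f x') (f x) < e"
      using *[of x x'] *[of x' x] x by (cases "x \<le> x'") (auto simp: dist_norm norm_minus_commute)
  qed
qed

lemma continuous_on_Icc_bounded:
  fixes f :: "real \<Rightarrow> 'a::real_normed_vector"
  assumes "continuous_on {a..b} f"
  shows "\<exists>M. \<forall>t\<in>{a..b}. norm (f t) \<le> M"
  using compact_imp_bounded[OF compact_continuous_image[OF assms compact_Icc]] by (auto simp: bounded_iff)

lemma has_derivative_imp_continuous_on_UNIV:
  assumes "\<And>x. (f has_derivative f' x) (at x)"
  shows "continuous_on UNIV f"
  using assms by (auto simp: continuous_on_eq_continuous_at intro: has_derivative_continuous)

lemma abs_inner_le_mult:
  fixes x y :: "'a::real_inner"
  assumes "norm x \<le> a" "norm y \<le> b"
  shows "\<bar>x \<bullet> y\<bar> \<le> a * b"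
  using order_trans[OF Cauchy_Schwarz_ineq2 mult_mono[OF assms]] order_trans[OF norm_ge_zero assms(1)] by simp

lemma indefinite_integral_increment:
  fixes h :: "real \<Rightarrow> 'a::euclidean_space"
  assumes h: "h integrable_on {a..b}" and z: "\<And>t. t \<in> {a..b} \<Longrightarrow> z t = z0 + integral {a..t} h"
    and cd: "a \<le> c" "c \<le> d" "d \<le> b"
  shows "(h has_integral (z d - z c)) {c..d}"
proof -
  have "integral {a..c} h + integral {c..d} h = integral {a..d} h"
    using cd by (intro Henstock_Kurzweil_Integration.integral_combine integrable_on_subinterval[OF h]) auto
  then have "integral {c..d} h = z d - z c"
    using z[of c] z[of d] cd by (simp add: algebra_simps)
  moreover have "h integrable_on {c..d}" using cd by (intro integrable_on_subinterval[OF h]) auto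
  ultimately show ?thesis by (metis integrable_integral)
qed

section \<open>Gronwall's inequality and Caratheodory equations\<close>

text \<open>Comparing \<open>E\<close> with multiples of \<open>exp (2 * L * (t - a))\<close>, the integral term costs only half of the
  multiple; this is where the factor 2 comes from. The same weight makes the Picard iteration below a
  contraction.\<close>

lemma gronwall_exp:
  fixes E :: "real \<Rightarrow> real"
  assumes cont: "continuous_on {a..b} E" and "L > 0" "K \<ge> 0"
    and le: "\<And>t. t \<in> {a..b} \<Longrightarrow> E t \<le> K + L * integral {a..t} E"
    and t: "t \<in> {a..b}"
  shows "E t \<le> 2 * K * exp (2 * L * (t - a))"
proof -
  define w where "w t = exp (2 * L * (t - a))" for t
  have w_pos: "w t > 0" for t by (simp add: w_def)
  have contw: "continuous_on {a..b} (\<lambda>t. E t / w t)"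
    unfolding w_def by (intro continuous_intros cont) auto
  \<comment> \<open>The least multiple of the weight that dominates E is attained at m; the integral
    inequality is then used at m only.\<close>
  obtain m where m: "m \<in> {a..b}" and max: "\<And>s. s \<in> {a..b} \<Longrightarrow> E s / w s \<le> E m / w m"
    using continuous_attains_sup[OF _ _ contw] t by auto
  define D where "D = E m / w m"
  have ED: "E s \<le> D * w s" if "s \<in> {a..b}" for s
    using max[OF that] w_pos[of s] by (simp add: D_def field_simps)
  have "D \<le> 2 * K"
  proof (cases "D \<ge> 0")
    case True
    have "((\<lambda>s. D * w s) has_integral (D * w m / (2 * L) - D * w a / (2 * L))) {a..m}"
      using m \<open>L > 0\<close> unfolding w_def
      by (intro fundamental_theorem_of_calculus)
        (auto intro!: derivative_eq_intros simp: has_real_derivative_iff_has_vector_derivative[symmetric])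
    then have I: "((\<lambda>s. D * w s) has_integral (D * (w m - 1) / (2 * L))) {a..m}"
      by (simp add: w_def diff_divide_distrib right_diff_distrib)
    have "E integrable_on {a..m}"
      by (rule integrable_continuous_interval, rule continuous_on_subset[OF cont]) (use m in auto)
    then have "integral {a..m} E \<le> D * (w m - 1) / (2 * L)"
      using m ED by (intro has_integral_le[OF integrable_integral I]) auto
    then have "L * integral {a..m} E \<le> D * (w m - 1) / 2"
      using \<open>L > 0\<close> by (simp add: field_simps)
    then have "D * w m \<le> K + D * (w m - 1) / 2"
      using le[OF m] w_pos[of m] by (simp add: D_def)
    then have "D * w m \<le> 2 * K" using True by (simp add: field_simps)
    moreover have "D * 1 \<le> D * w m"
      using True m \<open>L > 0\<close> by (intro mult_left_mono) (auto simp: w_def)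
    ultimately show ?thesis by simp
  next
    case False then show ?thesis using \<open>K \<ge> 0\<close> by simp
  qed
  then have "D * w t \<le> 2 * K * w t" using w_pos[of t] by simp
  then show ?thesis using ED[OF t] unfolding w_def by linarith
qed

text \<open>The form needed for comparing two integral equations: e is the difference of their
  solutions and K the defect. As K enters the bound linearly, a defect of order s or s squared
  yields an error of the same order.\<close>

lemma gronwall_integral:
  fixes e h :: "real \<Rightarrow> 'a::euclidean_space"
  assumes h: "h integrable_on {a..b}" and e: "\<And>t. t \<in> {a..b} \<Longrightarrow> e t = integral {a..t} h"
    and le: "\<And>t. t \<in> {a..b} \<Longrightarrow> norm (h t) \<le> K + L * norm (e t)"
    and "L > 0" "K \<ge> 0" and t: "t \<in> {a..b}"
  shows "norm (e t) \<le> K * (2 * (b - a) * exp (2 * L * (b - a)))"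
proof -
  have cont: "continuous_on {a..b} e"
    by (rule continuous_on_eq[OF indefinite_integral_continuous_1[OF h]]) (use e in auto)
  then have contn: "continuous_on {a..b} (\<lambda>t. norm (e t))" by (intro continuous_intros)
  have "norm (e s) \<le> K * (b - a) + L * integral {a..s} (\<lambda>t. norm (e t))" if s: "s \<in> {a..b}" for s
  proof -
    have i: "(\<lambda>t. norm (e t)) integrable_on {a..s}"
      by (rule integrable_continuous_interval, rule continuous_on_subset[OF contn]) (use s in auto)
    have iL: "(\<lambda>t. L * norm (e t)) integrable_on {a..s}"
      by (rule integrable_on_mult_right[OF i])
    have "norm (e s) \<le> integral {a..s} (\<lambda>t. K + L * norm (e t))"
      unfolding e[OF s]
      by (rule Henstock_Kurzweil_Integration.integral_norm_bound_integral)
        (use s h iL le in \<open>auto intro!: integrable_add integrable_on_subinterval[OF h]\<close>)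
    also have "\<dots> = integral {a..s} (\<lambda>t. K) + integral {a..s} (\<lambda>t. L * norm (e t))"
      using iL by (intro integral_add) auto
    also have "\<dots> = K * (s - a) + L * integral {a..s} (\<lambda>t. norm (e t))"
      using s by simp
    also have "\<dots> \<le> K * (b - a) + L * integral {a..s} (\<lambda>t. norm (e t))"
      using s \<open>K \<ge> 0\<close> by (intro add_right_mono mult_left_mono) auto
    finally show ?thesis .
  qed
  from gronwall_exp[OF contn \<open>L > 0\<close> _ this t]
  have "norm (e t) \<le> 2 * (K * (b - a)) * exp (2 * L * (t - a))" using t \<open>K \<ge> 0\<close> by simp
  also have "\<dots> \<le> 2 * (K * (b - a)) * exp (2 * L * (b - a))"
    using t \<open>K \<ge> 0\<close> \<open>L > 0\<close> by (intro mult_left_mono) auto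
  finally show ?thesis by (simp add: mult_ac)
qed

lemma lipschitz_on_indefinite_integral:
  fixes h :: "real \<Rightarrow> 'a::euclidean_space"
  assumes h: "h integrable_on {a..b}" and B: "\<And>t. t \<in> {a..b} \<Longrightarrow> norm (h t) \<le> B" and "B \<ge> 0"
  shows "B-lipschitz_on {a..b} (\<lambda>t. integral {a..t} h)"
proof (rule lipschitz_onI[OF _ \<open>B \<ge> 0\<close>])
  have *: "norm (integral {a..v} h - integral {a..u} h) \<le> B * \<bar>v - u\<bar>" if "u \<in> {a..b}" "v \<in> {a..b}" "u \<le> v" for u v
  proof -
    have i: "(h has_integral (integral {a..v} h - integral {a..u} h)) {u..v}"
      by (rule indefinite_integral_increment[where z = "\<lambda>t. integral {a..t} h" and ?z0.0 = 0, OF h]) (use that in auto)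
    have "norm (integral {u..v} h) \<le> integral {u..v} (\<lambda>_. B)"
      using that B has_integral_integrable[OF i]
      by (intro Henstock_Kurzweil_Integration.integral_norm_bound_integral) auto
    then show ?thesis using integral_unique[OF i] that by (simp add: mult.commute)
  qed
  fix u v assume "u \<in> {a..b}" "v \<in> {a..b}"
  then show "dist (integral {a..u} h) (integral {a..v} h) \<le> B * dist u v"
    using *[of u v] *[of v u] by (cases "u \<le> v") (auto simp: dist_norm norm_minus_commute)
qed

text \<open>Picard iteration from the constant function. Regularity of F in time enters only as
  integrability along continuous curves, which admits right-hand sides driven by measurable
  controls.\<close>

lemma caratheodory_exists:
  fixes F :: "real \<Rightarrow> 'a::euclidean_space \<Rightarrow> 'a"
  assumes "a \<le> b" "L > 0"
    and int: "\<And>x. continuous_on {a..b} x \<Longrightarrow> (\<lambda>s. F s (x s)) integrable_on {a..b}"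
    and lip: "\<And>s x y. s \<in> {a..b} \<Longrightarrow> norm (F s x - F s y) \<le> L * norm (x - y)"
  shows "\<exists>x. continuous_on {a..b} x \<and>
    (\<forall>t\<in>{a..b}. x t = x0 + integral {a..t} (\<lambda>s. F s (x s)))"
proof -
  define P where "P x t = x0 + integral {a..t} (\<lambda>s. F s (x s))" for x t
  define X where "X n = (P ^^ n) (\<lambda>_. x0)" for n
  have X_Suc: "X (Suc n) = P (X n)" for n by (simp add: X_def)
  have contP: "continuous_on {a..b} (P x)" if "continuous_on {a..b} x" for x
    unfolding P_def by (intro continuous_intros indefinite_integral_continuous_1 int that)
  have contX: "continuous_on {a..b} (X n)" for n
    by (induction n) (auto simp: X_Suc contP, auto simp: X_def)
  have diffP: "norm (P x t - P y t) \<le> integral {a..t} (\<lambda>s. L * norm (x s - y s))"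
    if xy: "continuous_on {a..b} x" "continuous_on {a..b} y" and t: "t \<in> {a..b}" for x y t
  proof -
    have i: "(\<lambda>s. F s (z s)) integrable_on {a..t}" if "continuous_on {a..b} z" for z
      using t by (intro integrable_on_subinterval[OF int[OF that]]) auto
    have "P x t - P y t = integral {a..t} (\<lambda>s. F s (x s) - F s (y s))"
      unfolding P_def by (simp add: Henstock_Kurzweil_Integration.integral_diff i xy)
    also have "norm \<dots> \<le> integral {a..t} (\<lambda>s. L * norm (x s - y s))"
    proof (rule Henstock_Kurzweil_Integration.integral_norm_bound_integral)
      show "(\<lambda>s. F s (x s) - F s (y s)) integrable_on {a..t}"
        by (intro integrable_diff i xy)
      have "continuous_on {a..t} (\<lambda>s. L * norm (x s - y s))"
        by (intro continuous_intros continuous_on_subset[OF xy(1)] continuous_on_subset[OF xy(2)])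
          (use t in auto)
      then show "(\<lambda>s. L * norm (x s - y s)) integrable_on {a..t}"
        by (rule integrable_continuous_interval)
    qed (use t lip in auto)
    finally show ?thesis .
  qed
  define w where "w t = exp (2 * L * (t - a))" for t
  have w_pos: "w t > 0" for t by (simp add: w_def)
  obtain D where D: "\<And>t. t \<in> {a..b} \<Longrightarrow> norm (X 1 t - X 0 t) \<le> D"
    using continuous_on_Icc_bounded[OF continuous_on_diff[OF contX[of 1] contX[of 0]]] by blast
  have "D \<ge> 0" using order_trans[OF norm_ge_zero D[of a]] \<open>a \<le> b\<close> by simp
  \<comment> \<open>Integrating L times the weight exp (2 L (t - a)) returns at most half of the
    weight, whence the factor 1/2 per iteration on an interval of any length.\<close>
  have step: "norm (X (Suc n) t - X n t) \<le> D * (1/2)^n * w t" if "t \<in> {a..b}" for n t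
    using that
  proof (induction n arbitrary: t)
    case 0
    have "D * 1 \<le> D * w t" using \<open>D \<ge> 0\<close> 0 \<open>L > 0\<close> by (intro mult_left_mono) (auto simp: w_def)
    then show ?case using D[OF 0] by simp
  next
    case (Suc n)
    let ?c = "D * (1/2)^n"
    have I: "((\<lambda>s. L * (?c * w s)) has_integral (?c * w t / 2 - ?c * w a / 2)) {a..t}"
      using Suc.prems \<open>L > 0\<close> unfolding w_def
      by (intro fundamental_theorem_of_calculus)
        (auto intro!: derivative_eq_intros simp: has_real_derivative_iff_has_vector_derivative[symmetric])
    have "norm (X (Suc (Suc n)) t - X (Suc n) t) \<le> integral {a..t} (\<lambda>s. L * norm (X (Suc n) s - X n s))"
      using diffP[OF contX contX Suc.prems, of "Suc n" n] by (simp add: X_Suc)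
    also have "\<dots> \<le> integral {a..t} (\<lambda>s. L * (?c * w s))"
    proof (rule integral_le)
      have "continuous_on {a..t} (\<lambda>s. L * norm (X (Suc n) s - X n s))"
        by (intro continuous_intros continuous_on_subset[OF contX]) (use Suc.prems in auto)
      then show "(\<lambda>s. L * norm (X (Suc n) s - X n s)) integrable_on {a..t}"
        by (rule integrable_continuous_interval)
      show "(\<lambda>s. L * (?c * w s)) integrable_on {a..t}" using I by blast
      fix s assume "s \<in> {a..t}"
      then show "L * norm (X (Suc n) s - X n s) \<le> L * (?c * w s)"
        using Suc.IH[of s] Suc.prems \<open>L > 0\<close> by (intro mult_left_mono) auto
    qed
    also have "\<dots> = ?c * w t / 2 - ?c * w a / 2" using I by blast
    also have "\<dots> \<le> D * (1/2)^Suc n * w t"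
      using \<open>D \<ge> 0\<close> w_pos[of a] by simp
    finally show ?case .
  qed
  \<comment> \<open>The iterates are the partial sums of this telescoping series up to the constant
    \<open>x0\<close>, so the M-test gives their uniform convergence.\<close>
  define S where "S t = (\<Sum>n. X (Suc n) t - X n t)" for t
  have "uniform_limit {a..b} (\<lambda>n t. \<Sum>i<n. X (Suc i) t - X i t) S sequentially"
    unfolding S_def
  proof (rule Weierstrass_m_test)
    show "summable (\<lambda>n. D * (1/2)^n * w b)"
      by (intro summable_mult summable_mult2 summable_geometric) auto
    fix n t assume t: "t \<in> {a..b}"
    have "w t \<le> w b" using t \<open>L > 0\<close> by (simp add: w_def)
    then have "D * (1/2)^n * w t \<le> D * (1/2)^n * w b"
      using \<open>D \<ge> 0\<close> by (intro mult_left_mono) auto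
    then show "norm (X (Suc n) t - X n t) \<le> D * (1/2)^n * w b"
      using step[OF t, of n] by linarith
  qed
  moreover have "(\<Sum>i<n. X (Suc i) t - X i t) = X n t - x0" for n t
    by (subst sum_lessThan_telescope) (simp add: X_def)
  ultimately have "uniform_limit {a..b} (\<lambda>n t. X n t - x0) S sequentially" by simp
  then have lim: "uniform_limit {a..b} X (\<lambda>t. x0 + S t) sequentially"
    by (simp add: uniform_limit_iff dist_norm algebra_simps)
  define x where "x t = x0 + S t" for t
  have lim: "uniform_limit {a..b} X x sequentially" using lim unfolding x_def[abs_def] .
  have contx: "continuous_on {a..b} x"
    by (rule uniform_limit_theorem[OF _ lim]) (use contX in auto)
  have "x t = P x t" if t: "t \<in> {a..b}" for t
  proof -
    have "(\<lambda>n. X (Suc n) t) \<longlonglongrightarrow> x t"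
      using tendsto_uniform_limitI[OF lim t] by (rule LIMSEQ_Suc)
    moreover have "(\<lambda>n. X (Suc n) t) \<longlonglongrightarrow> P x t"
    proof (rule tendstoI)
      fix e :: real assume "e > 0"
      define c where "c = b - a + 1"
      have "c > 0" using \<open>a \<le> b\<close> by (simp add: c_def)
      define d where "d = e / (2 * L * c)"
      have "d > 0" using \<open>e > 0\<close> \<open>L > 0\<close> \<open>c > 0\<close> by (simp add: d_def)
      then have "\<forall>\<^sub>F n in sequentially. \<forall>s\<in>{a..b}. dist (X n s) (x s) < d"
        using lim by (auto simp: uniform_limit_iff)
      then show "\<forall>\<^sub>F n in sequentially. dist (X (Suc n) t) (P x t) < e"
      proof eventually_elim
        case (elim n)
        have "dist (X (Suc n) t) (P x t) \<le> integral {a..t} (\<lambda>s. L * norm (X n s - x s))"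
          using diffP[OF contX contx t, of n] by (simp add: X_Suc dist_norm)
        also have "\<dots> \<le> integral {a..t} (\<lambda>s. L * d)"
        proof (rule integral_le)
          have "continuous_on {a..t} (\<lambda>s. L * norm (X n s - x s))"
            by (intro continuous_intros continuous_on_subset[OF contX] continuous_on_subset[OF contx])
              (use t in auto)
          then show "(\<lambda>s. L * norm (X n s - x s)) integrable_on {a..t}"
            by (rule integrable_continuous_interval)
          fix s assume "s \<in> {a..t}"
          then show "L * norm (X n s - x s) \<le> L * d"
            using elim t \<open>L > 0\<close> by (intro mult_left_mono) (auto simp: dist_norm less_imp_le)
        qed auto
        also have "\<dots> = L * d * (t - a)" using t by simp
        also have "\<dots> \<le> L * d * c" using t \<open>L > 0\<close> \<open>d > 0\<close> by (intro mult_left_mono) (auto simp: c_def)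
        also have "\<dots> = e / 2" using \<open>L > 0\<close> \<open>c > 0\<close> by (simp add: d_def)
        finally show ?case using \<open>e > 0\<close> by simp
      qed
    qed
    ultimately show ?thesis by (rule LIMSEQ_unique)
  qed
  then show ?thesis using contx unfolding P_def by blast
qed

text \<open>Reflecting time turns a terminal value into an initial value; the adjoint equation is of
  this kind.\<close>

lemma caratheodory_exists_backward:
  fixes F :: "real \<Rightarrow> 'a::euclidean_space \<Rightarrow> 'a"
  assumes "a \<le> b" "L > 0"
    and int: "\<And>x. continuous_on {a..b} x \<Longrightarrow> (\<lambda>s. F s (x s)) integrable_on {a..b}"
    and lip: "\<And>s x y. s \<in> {a..b} \<Longrightarrow> norm (F s x - F s y) \<le> L * norm (x - y)"
  shows "\<exists>x. continuous_on {a..b} x \<and>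
    (\<forall>t\<in>{a..b}. x t = x1 + integral {t..b} (\<lambda>s. F s (x s)))"
proof -
  have refl: "continuous_on {a..b} (\<lambda>s. x (- s))" if "continuous_on {-b..-a} x" for x :: "real \<Rightarrow> 'a"
    by (rule continuous_on_compose2[OF that]) (auto intro!: continuous_intros)
  have int': "(\<lambda>s. F (- s) (x s)) integrable_on {-b..-a}" if "continuous_on {-b..-a} x" for x
    using int[OF refl[OF that]] Henstock_Kurzweil_Integration.integrable_reflect_real[of "\<lambda>s. F s (x (- s))" b a] by simp
  have lip': "norm (F (- s) x - F (- s) y) \<le> L * norm (x - y)" if "s \<in> {-b..-a}" for s x y
    using that by (intro lip) auto
  have "- b \<le> - a" using \<open>a \<le> b\<close> by simp
  from caratheodory_exists[OF this \<open>L > 0\<close> int' lip', of x1]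
  obtain X where X: "continuous_on {-b..-a} X"
    "\<And>t. t \<in> {-b..-a} \<Longrightarrow> X t = x1 + integral {-b..t} (\<lambda>s. F (- s) (X s))"
    by blast
  show ?thesis
  proof (intro exI conjI ballI)
    show "continuous_on {a..b} (\<lambda>t. X (- t))" by (rule refl[OF X(1)])
    fix t assume "t \<in> {a..b}"
    then show "X (- t) = x1 + integral {t..b} (\<lambda>s. F s (X (- s)))"
      using X(2)[of "- t"] Henstock_Kurzweil_Integration.integral_reflect_real[of b t "\<lambda>s. F s (X (- s))"]
      by simp
  qed
qed

section \<open>Bounded measurable integrands, null sets and integration by parts\<close>

lemma bounded_measurable_integrable_on:
  fixes f :: "real \<Rightarrow> 'a::euclidean_space"
  assumes "f \<in> borel_measurable (lebesgue_on {a..b})" and "\<And>t. t \<in> {a..b} \<Longrightarrow> norm (f t) \<le> B"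
  shows "f integrable_on {a..b}"
  using assms by (intro measurable_bounded_by_integrable_imp_integrable[of f "{a..b}" "\<lambda>_. B"]) auto

lemma AE_lebesgue_on_iff_negligible:
  assumes "S \<in> sets lebesgue"
  shows "(AE t in lebesgue_on S. P t) \<longleftrightarrow> (\<exists>N. negligible N \<and> (\<forall>t\<in>S - N. P t))"
proof -
  have "(AE t in lebesgue_on S. P t) \<longleftrightarrow> (AE t in lebesgue. t \<in> S \<longrightarrow> P t)"
    using assms by (subst AE_restrict_space_iff) auto
  also have "\<dots> \<longleftrightarrow> (\<exists>N\<in>null_sets lebesgue. {t. \<not> (t \<in> S \<longrightarrow> P t)} \<subseteq> N)"
    unfolding eventually_ae_filter by simp
  also have "\<dots> \<longleftrightarrow> (\<exists>N. negligible N \<and> (\<forall>t\<in>S - N. P t))"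
    unfolding negligible_iff_null_sets by blast
  finally show ?thesis .
qed

text \<open>Both factors are Lipschitz, hence so is their inner product, which is therefore
  absolutely continuous; the product rule outside a null set and the fundamental theorem give the
  claim. It supplies the duality between linearized and adjoint states.\<close>

lemma has_integral_inner_parts:
  fixes P Y p y :: "real \<Rightarrow> 'a::euclidean_space"
  assumes "a \<le> b"
    and p: "p integrable_on {a..b}" "\<And>t. t \<in> {a..b} \<Longrightarrow> norm (p t) \<le> B"
    and y: "y integrable_on {a..b}" "\<And>t. t \<in> {a..b} \<Longrightarrow> norm (y t) \<le> B"
    and P: "\<And>t. t \<in> {a..b} \<Longrightarrow> P t = P a + integral {a..t} p"
    and Y: "\<And>t. t \<in> {a..b} \<Longrightarrow> Y t = Y a + integral {a..t} y"
  shows "((\<lambda>t. p t \<bullet> Y t + P t \<bullet> y t) has_integral (P b \<bullet> Y b - P a \<bullet> Y a)) {a..b}"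
proof -
  have "B \<ge> 0" using order_trans[OF norm_ge_zero p(2)[of a]] \<open>a \<le> b\<close> by simp
  \<comment> \<open>These copies agree with P and Y on the interval but are indefinite integrals
    everywhere, so that the almost everywhere derivatives apply to them as they stand.\<close>
  define P' where "P' t = P a + integral {a..t} p" for t
  define Y' where "Y' t = Y a + integral {a..t} y" for t
  have lip: "B-lipschitz_on {a..b} P'" "B-lipschitz_on {a..b} Y'"
    using lipschitz_on_indefinite_integral[OF p \<open>B \<ge> 0\<close>] lipschitz_on_indefinite_integral[OF y \<open>B \<ge> 0\<close>]
    by (auto simp: P'_def Y'_def lipschitz_on_def)
  obtain M1 M2 where M1: "\<And>t. t \<in> {a..b} \<Longrightarrow> norm (P' t) \<le> M1" and M2: "\<And>t. t \<in> {a..b} \<Longrightarrow> norm (Y' t) \<le> M2"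
    using continuous_on_Icc_bounded[OF lipschitz_on_continuous_on[OF lip(1)]]
      continuous_on_Icc_bounded[OF lipschitz_on_continuous_on[OF lip(2)]] by blast
  have M0: "M1 \<ge> 0" "M2 \<ge> 0"
    using order_trans[OF norm_ge_zero M1[of a]] order_trans[OF norm_ge_zero M2[of a]] \<open>a \<le> b\<close> by auto
  have "(M1 * B + M2 * B)-lipschitz_on {a..b} (\<lambda>t. P' t \<bullet> Y' t)"
  proof (rule lipschitz_onI)
    fix u v assume uv: "u \<in> {a..b}" "v \<in> {a..b}"
    have "P' u \<bullet> Y' u - P' v \<bullet> Y' v = P' u \<bullet> (Y' u - Y' v) + (P' u - P' v) \<bullet> Y' v"
      by (simp add: inner_diff_left inner_diff_right)
    also have "\<bar>\<dots>\<bar> \<le> norm (P' u) * norm (Y' u - Y' v) + norm (P' u - P' v) * norm (Y' v)"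
      by (intro order_trans[OF abs_triangle_ineq] add_mono Cauchy_Schwarz_ineq2)
    also have "\<dots> \<le> M1 * (B * dist u v) + (B * dist u v) * M2"
      using lipschitz_onD[OF lip(1) uv] lipschitz_onD[OF lip(2) uv] M1[OF uv(1)] M2[OF uv(2)] M0 \<open>B \<ge> 0\<close>
      by (intro add_mono mult_mono) (auto simp: dist_norm)
    finally show "dist (P' u \<bullet> Y' u) (P' v \<bullet> Y' v) \<le> (M1 * B + M2 * B) * dist u v"
      by (simp add: dist_real_def algebra_simps)
  qed (use M0 \<open>B \<ge> 0\<close> in auto)
  then have ac: "absolutely_continuous_on {a..b} (\<lambda>t. P' t \<bullet> Y' t)"
    by (rule lipschitz_on_imp_absolutely_continuous_on)
  obtain N1 where N1: "negligible N1"
    "\<And>t. t \<in> {a<..<b} - N1 \<Longrightarrow> ((\<lambda>t. integral {a..t} p) has_vector_derivative p t) (at t)"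
    using indefinite_integral_has_vector_derivative_ae[OF p(1)] by blast
  obtain N2 where N2: "negligible N2"
    "\<And>t. t \<in> {a<..<b} - N2 \<Longrightarrow> ((\<lambda>t. integral {a..t} y) has_vector_derivative y t) (at t)"
    using indefinite_integral_has_vector_derivative_ae[OF y(1)] by blast
  have "((\<lambda>t. P' t \<bullet> Y' t) has_vector_derivative (P' t \<bullet> y t + p t \<bullet> Y' t)) (at t)"
    if "t \<in> {a<..<b} - (N1 \<union> N2)" for t
  proof -
    have "(P' has_vector_derivative p t) (at t)" "(Y' has_vector_derivative y t) (at t)"
      unfolding P'_def Y'_def using that N1(2)[of t] N2(2)[of t]
      by (auto intro!: derivative_eq_intros)
    then show ?thesis
      using bounded_bilinear.has_vector_derivative[OF bounded_bilinear_inner] by blast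
  qed
  from absolutely_continuous_on_has_integral[OF ac \<open>a \<le> b\<close> _ this]
  have "((\<lambda>t. P' t \<bullet> y t + p t \<bullet> Y' t) has_integral P' b \<bullet> Y' b - P' a \<bullet> Y' a) {a..b}"
    using N1 N2 by (auto intro: negligible_Un)
  moreover have PY: "P' t = P t" "Y' t = Y t" if "t \<in> {a..b}" for t
    using P[OF that] Y[OF that] by (auto simp: P'_def Y'_def)
  ultimately have *: "((\<lambda>t. P' t \<bullet> y t + p t \<bullet> Y' t) has_integral P b \<bullet> Y b - P a \<bullet> Y a) {a..b}"
    using \<open>a \<le> b\<close> by simp
  show ?thesis
    by (rule has_integral_eq[OF _ *]) (simp add: PY)
qed

section \<open>Perturbed trajectories\<close>

lemma C1_function_lipschitz_on_cball:
  fixes F :: "'a::euclidean_space \<Rightarrow> 'b::real_normed_vector"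
  assumes "C1_function F"
  shows "\<exists>L>0. (\<forall>x\<in>cball 0 R. norm (F x) \<le> L) \<and>
    (\<forall>x\<in>cball 0 R. \<forall>y\<in>cball 0 R. norm (F y - F x) \<le> L * norm (y - x))"
proof -
  obtain F' :: "'a \<Rightarrow> 'a \<Rightarrow>\<^sub>L 'b" where F': "\<And>x. (F has_derivative blinfun_apply (F' x)) (at x)"
    and cont: "continuous_on UNIV F'"
    using assms unfolding C1_function_def by blast
  have "bounded (F' ` cball 0 R)"
    by (intro compact_imp_bounded compact_continuous_image continuous_on_subset[OF cont]) auto
  then obtain L1 where L1: "\<And>x. x \<in> cball 0 R \<Longrightarrow> norm (F' x) \<le> L1"
    unfolding bounded_iff by blast
  have "continuous_on UNIV F"
    by (rule has_derivative_imp_continuous_on_UNIV[OF F'])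
  then have "bounded (F ` cball 0 R)"
    by (intro compact_imp_bounded compact_continuous_image) (auto intro: continuous_on_subset)
  then obtain L2 where L2: "\<And>x. x \<in> cball 0 R \<Longrightarrow> norm (F x) \<le> L2"
    unfolding bounded_iff by blast
  define L where "L = max (max L1 L2) 1"
  show ?thesis
  proof (intro exI[of _ L] conjI ballI)
    show "L > 0" by (simp add: L_def)
    show "norm (F x) \<le> L" if "x \<in> cball 0 R" for x
      using L2[OF that] by (simp add: L_def)
    show "norm (F y - F x) \<le> L * norm (y - x)" if "x \<in> cball 0 R" "y \<in> cball 0 R" for x y
    proof (rule differentiable_bound[of "cball 0 R" F "\<lambda>x. blinfun_apply (F' x)"])
      show "onorm (blinfun_apply (F' x)) \<le> L" if "x \<in> cball 0 R" for x
        using L1[OF that] by (simp add: L_def norm_blinfun.rep_eq)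
    qed (use that F' in \<open>auto intro: has_derivative_at_withinI\<close>)
  qed
qed

text \<open>The quantitative form in which class C2 is used: a first-order Taylor formula whose
  constant is uniform over a ball. One constant serves all four estimates, so each application needs
  a single ball containing all points that occur.\<close>

definition locally_quadratic_remainder ::
  "('a::real_normed_vector \<Rightarrow> 'b::real_normed_vector) \<Rightarrow> ('a \<Rightarrow> 'a \<Rightarrow>\<^sub>L 'b) \<Rightarrow> bool" where
  "locally_quadratic_remainder F F' \<longleftrightarrow> (\<forall>R. \<exists>L>0. \<forall>x\<in>cball 0 R. \<forall>y\<in>cball 0 R.
     norm (F x) \<le> L \<and> norm (F' x) \<le> L \<and> norm (F y - F x) \<le> L * norm (y - x) \<and>
     norm (F y - F x - F' x (y - x)) \<le> L * (norm (y - x))\<^sup>2)"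

text \<open>The derivative is C1, hence Lipschitz on balls, so along the segment from x to y it
  deviates from its value at x by at most a constant times the length of the segment. The mean value
  inequality for the linearization supplies the second factor.\<close>

lemma C2_functionE:
  fixes F :: "'a::euclidean_space \<Rightarrow> 'b::real_normed_vector"
  assumes "C2_function F"
  obtains F' :: "'a \<Rightarrow> 'a \<Rightarrow>\<^sub>L 'b"
  where "\<And>x. (F has_derivative blinfun_apply (F' x)) (at x)" "continuous_on UNIV F'"
    "locally_quadratic_remainder F F'"
proof -
  obtain F' :: "'a \<Rightarrow> 'a \<Rightarrow>\<^sub>L 'b" where F': "\<And>x. (F has_derivative blinfun_apply (F' x)) (at x)"
    and C1: "C1_function F'"
    using assms unfolding C2_function_def by blast
  have cont: "continuous_on UNIV F'"
    using C1 unfolding C1_function_def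
    by (auto simp: continuous_on_eq_continuous_at intro: has_derivative_continuous)
  have "C1_function F" unfolding C1_function_def using F' cont by blast
  show ?thesis
  proof (rule that[OF F' cont], unfold locally_quadratic_remainder_def, rule allI)
    fix R :: real
    obtain L1 where L1: "L1 > 0" "\<And>x. x \<in> cball 0 R \<Longrightarrow> norm (F x) \<le> L1"
      "\<And>x y. x \<in> cball 0 R \<Longrightarrow> y \<in> cball 0 R \<Longrightarrow> norm (F y - F x) \<le> L1 * norm (y - x)"
      using C1_function_lipschitz_on_cball[OF \<open>C1_function F\<close>, of R] by blast
    obtain L2 where L2: "L2 > 0" "\<And>x. x \<in> cball 0 R \<Longrightarrow> norm (F' x) \<le> L2"
      "\<And>x y. x \<in> cball 0 R \<Longrightarrow> y \<in> cball 0 R \<Longrightarrow> norm (F' y - F' x) \<le> L2 * norm (y - x)"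
      using C1_function_lipschitz_on_cball[OF C1, of R] by blast
    have quad: "norm (F y - F x - F' x (y - x)) \<le> L2 * (norm (y - x))\<^sup>2"
      if xy: "x \<in> cball 0 R" "y \<in> cball 0 R" for x y
    proof -
      have seg: "closed_segment x y \<subseteq> cball 0 R"
        using xy by (intro closed_segment_subset convex_cball)
      have "norm (F y - F x - F' x (y - x)) \<le> norm (y - x) * (L2 * norm (y - x))"
      proof (rule differentiable_bound_linearization[where S = "closed_segment x y"])
        show "x + t *\<^sub>R (y - x) \<in> closed_segment x y" if "t \<in> {0..1}" for t
          using that by (auto simp: closed_segment_def algebra_simps intro!: exI[of _ t])
        show "(F has_derivative blinfun_apply (F' w)) (at w within closed_segment x y)" for w
          using F' has_derivative_at_withinI by blast
        show "onorm (blinfun_apply (F' w) - blinfun_apply (F' x)) \<le> L2 * norm (y - x)"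
          if w: "w \<in> closed_segment x y" for w
        proof -
          have "onorm (blinfun_apply (F' w) - blinfun_apply (F' x)) = norm (F' w - F' x)"
            by (simp add: norm_blinfun.rep_eq minus_blinfun.rep_eq fun_diff_def)
          also have "\<dots> \<le> L2 * norm (w - x)" using L2(3) xy seg w by blast
          also have "\<dots> \<le> L2 * norm (y - x)"
            using segment_bound(1)[OF w] L2(1) by (intro mult_left_mono) (auto simp: norm_minus_commute)
          finally show ?thesis .
        qed
      qed auto
      then show ?thesis by (simp add: power2_eq_square mult_ac)
    qed
    have mono: "z \<le> max L1 L2 * w" if "z \<le> L1 * w \<or> z \<le> L2 * w" "w \<ge> 0" for z w :: real
    proof -
      have "L1 * w \<le> max L1 L2 * w" "L2 * w \<le> max L1 L2 * w"
        using that by (auto intro!: mult_right_mono)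
      then show ?thesis using that by linarith
    qed
    show "\<exists>L>0. \<forall>x\<in>cball 0 R. \<forall>y\<in>cball 0 R. norm (F x) \<le> L \<and> norm (F' x) \<le> L \<and>
        norm (F y - F x) \<le> L * norm (y - x) \<and> norm (F y - F x - F' x (y - x)) \<le> L * (norm (y - x))\<^sup>2"
    proof (intro exI[of _ "max L1 L2"] conjI ballI)
      fix x y :: 'a assume xy: "x \<in> cball 0 R" "y \<in> cball 0 R"
      show "norm (F x) \<le> max L1 L2" using L1(2)[OF xy(1)] by simp
      show "norm (F' x) \<le> max L1 L2" using L2(2)[OF xy(1)] by simp
      show "norm (F y - F x) \<le> max L1 L2 * norm (y - x)" using L1(3)[OF xy] by (intro mono) auto
      show "norm (F y - F x - F' x (y - x)) \<le> max L1 L2 * (norm (y - x))\<^sup>2"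
        using quad[OF xy] by (intro mono) auto
    qed (use L1 in auto)
  qed
qed

lemma borel_measurable_compose_Pair:
  fixes h :: "'b::{second_countable_topology,metric_space} \<times> 'c::{second_countable_topology,metric_space} \<Rightarrow> 'd::metric_space"
  assumes "continuous_on UNIV h" "x \<in> borel_measurable M" "u \<in> borel_measurable M"
  shows "(\<lambda>t. h (x t, u t)) \<in> borel_measurable M"
  using borel_measurable_continuous_on[OF assms(1) borel_measurable_Pair[OF assms(2,3)]] by simp

lemma continuous_on_Icc_borel_measurable_lebesgue:
  fixes x :: "real \<Rightarrow> 'a::euclidean_space"
  assumes "continuous_on {a..b} x"
  shows "x \<in> borel_measurable (lebesgue_on {a..b})"
  using assms by (intro continuous_imp_measurable_on_sets_lebesgue) auto

lemma norm_Pair_le_add: "norm (x, y) \<le> norm x + norm y"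
  by (metis norm_Pair2 norm_Pair1 norm_triangle_ineq add.right_neutral add_Pair add.left_neutral)

section \<open>Linearized and perturbed state equations\<close>

lemma bounded_along_trajectory:
  fixes f' :: "'a::euclidean_space \<times> 'b::euclidean_space \<Rightarrow> 'c::real_normed_vector"
    and T B :: real
  assumes f': "continuous_on UNIV f'" and x: "continuous_on {0..T} x"
    and u: "\<And>t. t \<in> {0..T} \<Longrightarrow> norm (u t) \<le> B"
  shows "\<exists>L>0. \<forall>t\<in>{0..T}. norm (f' (x t, u t)) \<le> L"
proof -
  obtain R where R: "\<And>t. t \<in> {0..T} \<Longrightarrow> norm (x t) \<le> R"
    using continuous_on_Icc_bounded[OF x] by blast
  have "bounded (f' ` cball 0 (R + B))"
    by (intro compact_imp_bounded compact_continuous_image continuous_on_subset[OF f']) auto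
  then obtain L0 where L0: "\<And>z. z \<in> cball 0 (R + B) \<Longrightarrow> norm (f' z) \<le> L0" unfolding bounded_iff by blast
  have "norm (f' (x t, u t)) \<le> max L0 1" if "t \<in> {0..T}" for t
    using L0[of "(x t, u t)"] R[OF that] u[OF that] norm_Pair_le_add[of "x t" "u t"] by auto
  then show ?thesis by (intro exI[of _ "max L0 1"]) auto
qed

text \<open>The initial value 0 reflects that \<open>x0\<close> is never perturbed. The source h
  gathers every perturbation, of the control as well as of time, and A is the full derivative, whose
  state part is its action on pairs with second entry 0. The bound on the integrand is recorded for
  the later integration by parts.\<close>

definition linearized_solution ::
  "(real \<Rightarrow> ('a::euclidean_space \<times> 'b::euclidean_space) \<Rightarrow>\<^sub>L 'a) \<Rightarrow> real \<Rightarrow> (real \<Rightarrow> 'a) \<Rightarrow> (real \<Rightarrow> 'a) \<Rightarrow> bool" where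
  "linearized_solution A T h y \<longleftrightarrow> continuous_on {0..T} y \<and>
     (\<lambda>t. A t (y t, 0) + h t) integrable_on {0..T} \<and> (\<exists>C. \<forall>t\<in>{0..T}. norm (A t (y t, 0) + h t) \<le> C) \<and>
     (\<forall>t\<in>{0..T}. y t = integral {0..t} (\<lambda>t. A t (y t, 0) + h t))"

text \<open>The equation is affine in y with coefficients bounded along the trajectory, hence
  globally Lipschitz, and the existence theorem applies to it directly.\<close>

lemma linearized_state:
  fixes f' :: "'a::euclidean_space \<times> 'b::euclidean_space \<Rightarrow> ('a \<times> 'b) \<Rightarrow>\<^sub>L 'a"
    and T B :: real
  assumes f': "continuous_on UNIV f'"
    and x: "continuous_on {0..T} x"
    and u: "u \<in> borel_measurable (lebesgue_on {0..T})" "\<And>t. t \<in> {0..T} \<Longrightarrow> norm (u t) \<le> B"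
    and h: "h \<in> borel_measurable (lebesgue_on {0..T})" "\<And>t. t \<in> {0..T} \<Longrightarrow> norm (h t) \<le> B"
    and "0 \<le> T"
  shows "\<exists>y. linearized_solution (\<lambda>t. f' (x t, u t)) T h y"
proof -
  obtain L where "L > 0" and L: "\<And>t. t \<in> {0..T} \<Longrightarrow> norm (f' (x t, u t)) \<le> L"
    using bounded_along_trajectory[where u = u, OF f' x u(2)] by blast
  define F where "F t z = f' (x t, u t) (z, 0) + h t" for t z
  have bd: "norm (f' (x t, u t) (z, 0)) \<le> L * norm z" if "t \<in> {0..T}" for t z
  proof -
    have "norm (f' (x t, u t) (z, 0)) \<le> norm (f' (x t, u t)) * norm z"
      using norm_blinfun[of "f' (x t, u t)" "(z, 0)"] by simp
    also have "\<dots> \<le> L * norm z" using L[OF that] by (intro mult_right_mono) auto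
    finally show ?thesis .
  qed
  have meas: "(\<lambda>t. F t (y t)) \<in> borel_measurable (lebesgue_on {0..T})" if "continuous_on {0..T} y" for y
  proof -
    have "(\<lambda>t. f' (x t, u t) (y t, 0)) \<in> borel_measurable (lebesgue_on {0..T})"
    proof -
      have c: "continuous_on UNIV (\<lambda>w. f' (fst w) (fst (snd w), 0))"
        by (intro continuous_intros continuous_on_compose2[OF f']) auto
      have "continuous_on {0..T} (\<lambda>t. (y t, 0::'b))" by (intro continuous_intros that)
      from borel_measurable_compose_Pair[OF c borel_measurable_Pair[OF continuous_on_Icc_borel_measurable_lebesgue[OF x] u(1)]
        continuous_on_Icc_borel_measurable_lebesgue[OF this]]
      show ?thesis by simp
    qed
    then show ?thesis unfolding F_def by (intro borel_measurable_add h)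
  qed
  have bdF: "\<exists>C. \<forall>t\<in>{0..T}. norm (F t (y t)) \<le> C" if y: "continuous_on {0..T} y" for y
  proof -
    obtain M where M: "\<And>t. t \<in> {0..T} \<Longrightarrow> norm (y t) \<le> M"
      using continuous_on_Icc_bounded[OF y] by blast
    have "norm (F t (y t)) \<le> L * M + B" if "t \<in> {0..T}" for t
    proof -
      have "norm (F t (y t)) \<le> L * norm (y t) + B"
        unfolding F_def using bd[OF that, of "y t"] h(2)[OF that]
          norm_triangle_ineq[of "f' (x t, u t) (y t, 0)" "h t"] by linarith
      also have "\<dots> \<le> L * M + B" using M[OF that] \<open>L > 0\<close> by simp
      finally show ?thesis .
    qed
    then show ?thesis by blast
  qed
  have intF: "(\<lambda>t. F t (y t)) integrable_on {0..T}" if "continuous_on {0..T} y" for y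
    using bdF[OF that] bounded_measurable_integrable_on[OF meas[OF that]] by blast
  have lipF: "norm (F t z - F t w) \<le> L * norm (z - w)" if "t \<in> {0..T}" for t z w
    using bd[OF that, of "z - w"] by (simp add: F_def blinfun.diff_right[symmetric])
  obtain y where y: "continuous_on {0..T} y" "\<And>t. t \<in> {0..T} \<Longrightarrow> y t = 0 + integral {0..t} (\<lambda>s. F s (y s))"
    using caratheodory_exists[OF \<open>0 \<le> T\<close> \<open>L > 0\<close> intF lipF, of 0] by blast
  have "y t = integral {0..t} (\<lambda>s. F s (y s))" if "t \<in> {0..T}" for t
    using y(2)[OF that] by (rule trans) simp
  then show ?thesis
    using y(1) intF[OF y(1)] bdF[OF y(1)] unfolding linearized_solution_def F_def by blast
qed

text \<open>The vector field is made globally Lipschitz by projecting the state onto a ball; Gronwall's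
  inequality then shows that, for small \<open>s\<close>, the perturbed state does not leave that ball.\<close>

lemma perturbed_state:
  fixes f :: "'a::euclidean_space \<times> 'b::euclidean_space \<Rightarrow> 'a"
    and f' :: "'a \<times> 'b \<Rightarrow> ('a \<times> 'b) \<Rightarrow>\<^sub>L 'a"
    and T B :: real
  assumes contf: "continuous_on UNIV f"
    and f: "locally_quadratic_remainder f f'"
    and x: "continuous_on {0..T} x" "\<And>t. t \<in> {0..T} \<Longrightarrow> x t = x0 + integral {0..t} (\<lambda>t. f (x t, u t))"
    and u: "u \<in> borel_measurable (lebesgue_on {0..T})" "\<And>t. t \<in> {0..T} \<Longrightarrow> norm (u t) \<le> B"
    and v: "v \<in> borel_measurable (lebesgue_on {0..T})" "\<And>t. t \<in> {0..T} \<Longrightarrow> norm (v t) \<le> B"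
    and r: "r \<in> borel_measurable (lebesgue_on {0..T})" "\<And>t. t \<in> {0..T} \<Longrightarrow> \<bar>r t\<bar> \<le> B"
    and y: "linearized_solution (\<lambda>t. f' (x t, u t)) T (\<lambda>t. f' (x t, u t) (0, v t) + r t *\<^sub>R f (x t, u t)) y"
    and "0 < T"
  obtains C s0 where "0 < s0" "0 < C" "\<And>s. s \<in> {0<..s0} \<Longrightarrow> \<exists>z. continuous_on {0..T} z \<and>
    (\<lambda>t. (1 + s * r t) *\<^sub>R f (z t, u t + s *\<^sub>R v t)) integrable_on {0..T} \<and>
    (\<forall>t\<in>{0..T}. z t = x0 + integral {0..t} (\<lambda>t. (1 + s * r t) *\<^sub>R f (z t, u t + s *\<^sub>R v t))) \<and>
    (\<forall>t\<in>{0..T}. norm (z t - x t) \<le> C * s \<and> norm (z t - x t - s *\<^sub>R y t) \<le> C * s\<^sup>2)"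
proof -
  obtain R0 where R0: "\<And>t. t \<in> {0..T} \<Longrightarrow> norm (x t) \<le> R0"
    using continuous_on_Icc_bounded[OF x(1)] by blast
  have R00: "R0 \<ge> 0" using order_trans[OF norm_ge_zero R0[of 0]] \<open>0 < T\<close> by simp
  have B0: "B \<ge> 0" using order_trans[OF norm_ge_zero u(2)[of 0]] \<open>0 < T\<close> by simp
  \<comment> \<open>The margin 1 over the bound of x is what the perturbed state may use up;
    \<open>s * C1 \<le> 1\<close> keeps it within that margin.\<close>
  define S where "S = cball (0 :: 'a) (R0 + 1)"
  define \<pi> where "\<pi> = closest_point S"
  have S: "convex S" "closed S" "S \<noteq> {}" using R00 by (auto simp: S_def)
  have \<pi>_in: "\<pi> z \<in> S" for z using closest_point_in_set[OF S(2,3)] by (simp add: \<pi>_def)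
  have \<pi>_id: "\<pi> z = z" if "z \<in> S" for z using that by (simp add: \<pi>_def closest_point_self)
  have \<pi>_lip: "norm (\<pi> z - \<pi> w) \<le> norm (z - w)" for z w
    using closest_point_lipschitz[OF S, of z w] by (simp add: \<pi>_def dist_norm)
  have xS: "x t \<in> S" if "t \<in> {0..T}" for t using R0[OF that] by (simp add: S_def)
  define R where "R = R0 + 1 + 2 * B"
  obtain L where "L > 0" and L: "\<And>z w. z \<in> cball 0 R \<Longrightarrow> w \<in> cball 0 R \<Longrightarrow> norm (f z) \<le> L \<and> norm (f' z) \<le> L \<and>
        norm (f w - f z) \<le> L * norm (w - z) \<and> norm (f w - f z - f' z (w - z)) \<le> L * (norm (w - z))\<^sup>2"
    using f unfolding locally_quadratic_remainder_def by blast
  have inR: "(z, w) \<in> cball 0 R" if "z \<in> S" "norm w \<le> 2 * B" for z w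
    using that norm_Pair_le_add[of z w] by (simp add: S_def R_def)
  define s1 where "s1 = 1 / (B + 1)"
  have s1: "0 < s1" "s1 \<le> 1" using B0 by (auto simp: s1_def)
  \<comment> \<open>The defect of x in the perturbed equation: changing the control costs 2 (L s B),
    as the time factor is at most 2, and the time factor itself costs s B L. The rest is the
    Gronwall factor for the Lipschitz constant 2 L.\<close>
  define C1 where "C1 = (2 * L * B + L * B) * (2 * T * exp (2 * (2 * L) * T))"
  have C10: "C1 \<ge> 0" using \<open>L > 0\<close> B0 \<open>0 < T\<close> by (simp add: C1_def)
  \<comment> \<open>With s (C1 + B) bounding the displacement of the pair of state and control, the
    summands are the Taylor remainder and the product of the time perturbation with the increment of
    f, both divided by s squared; the Gronwall factor belongs to the constant L.\<close>
  define C2 where "C2 = (L * (C1 + B)\<^sup>2 + L * B * (C1 + B)) * (2 * T * exp (2 * L * T))"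
  have C20: "C2 \<ge> 0" using \<open>L > 0\<close> B0 C10 \<open>0 < T\<close> by (simp add: C2_def)
  \<comment> \<open>The bound \<open>s1\<close> ensures s \<le> 1, hence a perturbed control of norm
    at most 2 B, and s B \<le> 1, hence a time factor of modulus at most 2; the other bound keeps
    the state in the ball, where the projection is the identity.\<close>
  define s0 where "s0 = min s1 (1 / (C1 + 1))"
  have s0: "0 < s0" using s1 C10 by (simp add: s0_def)
  define C where "C = max (max C1 C2) 1"
  have "0 < C" by (simp add: C_def)
  have main: "\<exists>z. continuous_on {0..T} z \<and>
    (\<lambda>t. (1 + s * r t) *\<^sub>R f (z t, u t + s *\<^sub>R v t)) integrable_on {0..T} \<and>
    (\<forall>t\<in>{0..T}. z t = x0 + integral {0..t} (\<lambda>t. (1 + s * r t) *\<^sub>R f (z t, u t + s *\<^sub>R v t))) \<and>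
    (\<forall>t\<in>{0..T}. norm (z t - x t) \<le> C * s \<and> norm (z t - x t - s *\<^sub>R y t) \<le> C * s\<^sup>2)"
    if s: "s \<in> {0<..s0}" for s
  proof -
    have s': "0 < s" "s \<le> 1" "s * B \<le> 1" "s * C1 \<le> 1"
    proof -
      show "0 < s" using s by simp
      show "s \<le> 1" using s s1 by (simp add: s0_def)
      have "s \<le> 1 / (B + 1)" using s by (simp add: s0_def s1_def)
      then show "s * B \<le> 1" using B0 \<open>0 < s\<close> by (simp add: field_simps)
      have "s \<le> 1 / (C1 + 1)" using s by (simp add: s0_def)
      then show "s * C1 \<le> 1" using C10 \<open>0 < s\<close> by (simp add: field_simps)
    qed
    define F where "F t z = (1 + s * r t) *\<^sub>R f (\<pi> z, u t + s *\<^sub>R v t)" for t z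
    have us: "norm (u t + s *\<^sub>R v t) \<le> 2 * B" if "t \<in> {0..T}" for t
    proof -
      have "norm (u t + s *\<^sub>R v t) \<le> norm (u t) + s * norm (v t)"
        using norm_triangle_ineq[of "u t" "s *\<^sub>R v t"] s'(1) by simp
      also have "\<dots> \<le> B + 1 * B" using u(2)[OF that] v(2)[OF that] s' by (intro add_mono mult_mono) auto
      finally show ?thesis by simp
    qed
    have uB: "norm (u t) \<le> 2 * B" if "t \<in> {0..T}" for t using u(2)[OF that] B0 by simp
    have sr: "\<bar>s * r t\<bar> \<le> s * B" if "t \<in> {0..T}" for t
      using r(2)[OF that] s'(1) by (simp add: abs_mult)
    have sr2: "\<bar>1 + s * r t\<bar> \<le> 2" if "t \<in> {0..T}" for t
      using sr[OF that] s'(3) by linarith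
    have bdF: "norm (F t z) \<le> 2 * L" if "t \<in> {0..T}" for t z
      unfolding F_def norm_scaleR using sr2[OF that] L[OF inR[OF \<pi>_in us[OF that]] inR[OF \<pi>_in us[OF that]]]
      by (intro mult_mono) auto
    have measF: "(\<lambda>t. F t (z t)) \<in> borel_measurable (lebesgue_on {0..T})" if z: "continuous_on {0..T} z" for z
    proof -
      have "continuous_on UNIV \<pi>" unfolding \<pi>_def by (intro continuous_on_closest_point S)
      then have "continuous_on {0..T} (\<lambda>t. \<pi> (z t))" by (rule continuous_on_compose2[OF _ z]) auto
      then have "(\<lambda>t. f (\<pi> (z t), u t + s *\<^sub>R v t)) \<in> borel_measurable (lebesgue_on {0..T})"
        by (intro borel_measurable_compose_Pair contf continuous_on_Icc_borel_measurable_lebesgue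
            borel_measurable_add u borel_measurable_scaleR borel_measurable_const v)
      then show ?thesis unfolding F_def
        by (intro borel_measurable_scaleR borel_measurable_add borel_measurable_times borel_measurable_const r)
    qed
    have intF: "(\<lambda>t. F t (z t)) integrable_on {0..T}" if z: "continuous_on {0..T} z" for z
      by (rule bounded_measurable_integrable_on[OF measF[OF z] bdF])
    have lipF: "norm (F t z - F t w) \<le> 2 * L * norm (z - w)" if t: "t \<in> {0..T}" for t z w
    proof -
      have "norm (F t z - F t w) = \<bar>1 + s * r t\<bar> * norm (f (\<pi> z, u t + s *\<^sub>R v t) - f (\<pi> w, u t + s *\<^sub>R v t))"
        by (simp add: F_def scaleR_diff_right[symmetric])
      also have "\<dots> \<le> 2 * (L * norm (\<pi> z - \<pi> w))"
        using sr2[OF t] L[OF inR[OF \<pi>_in us[OF t]] inR[OF \<pi>_in us[OF t]], of w z] by (intro mult_mono) auto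
      also have "\<dots> \<le> 2 * (L * norm (z - w))" using \<open>L > 0\<close> \<pi>_lip by (intro mult_left_mono) auto
      finally show ?thesis by simp
    qed
    have "2 * L > 0" using \<open>L > 0\<close> by simp
    from caratheodory_exists[OF less_imp_le[OF \<open>0 < T\<close>] this intF lipF, of x0]
    obtain z where z: "continuous_on {0..T} z" "\<And>t. t \<in> {0..T} \<Longrightarrow> z t = x0 + integral {0..t} (\<lambda>s. F s (z s))"
      by blast
    have intfx: "(\<lambda>t. f (x t, u t)) integrable_on {0..T}"
    proof (rule bounded_measurable_integrable_on)
      show "(\<lambda>t. f (x t, u t)) \<in> borel_measurable (lebesgue_on {0..T})"
        by (intro borel_measurable_compose_Pair contf continuous_on_Icc_borel_measurable_lebesgue x u)
      show "norm (f (x t, u t)) \<le> L" if "t \<in> {0..T}" for t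
        using L inR[OF xS[OF that] uB[OF that]] by blast
    qed
    have sub: "g integrable_on {0..T} \<Longrightarrow> t \<in> {0..T} \<Longrightarrow> g integrable_on {0..t}" for g :: "real \<Rightarrow> 'a" and t
      by (rule integrable_on_subinterval) auto
    have close: "norm (z t - x t) \<le> C1 * s" if t: "t \<in> {0..T}" for t
    proof -
      have "norm (z t - x t) \<le> (s * (2 * L * B + L * B)) * (2 * (T - 0) * exp (2 * (2 * L) * (T - 0)))"
      proof (rule gronwall_integral[where e = "\<lambda>t. z t - x t" and h = "\<lambda>t. F t (z t) - f (x t, u t)"])
        show "(\<lambda>t. F t (z t) - f (x t, u t)) integrable_on {0..T}"
          by (intro integrable_diff intF z intfx)
        show "z t - x t = integral {0..t} (\<lambda>t. F t (z t) - f (x t, u t))" if "t \<in> {0..T}" for t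
          using z(2)[OF that] x(2)[OF that]
          by (simp add: Henstock_Kurzweil_Integration.integral_diff[OF sub[OF intF[OF z(1)] that] sub[OF intfx that]])
        show "norm (F t (z t) - f (x t, u t)) \<le> s * (2 * L * B + L * B) + 2 * L * norm (z t - x t)"
          if t: "t \<in> {0..T}" for t
        proof -
          have "F t (z t) - f (x t, u t) = (F t (z t) - F t (x t)) + (F t (x t) - f (x t, u t))" by simp
          also have "norm \<dots> \<le> 2 * L * norm (z t - x t) + norm (F t (x t) - f (x t, u t))"
            using lipF[OF t, of "z t" "x t"]
              norm_triangle_ineq[of "F t (z t) - F t (x t)" "F t (x t) - f (x t, u t)"] by linarith
          also have "F t (x t) - f (x t, u t) = (1 + s * r t) *\<^sub>R (f (x t, u t + s *\<^sub>R v t) - f (x t, u t)) + (s * r t) *\<^sub>R f (x t, u t)"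
            by (simp add: F_def \<pi>_id[OF xS[OF t]] algebra_simps)
          also have "norm \<dots> \<le> \<bar>1 + s * r t\<bar> * norm (f (x t, u t + s *\<^sub>R v t) - f (x t, u t)) + \<bar>s * r t\<bar> * norm (f (x t, u t))"
            by (rule order_trans[OF norm_triangle_ineq]) simp
          also have "\<dots> \<le> 2 * (L * (s * B)) + (s * B) * L"
          proof (intro add_mono mult_mono)
            have "norm (f (x t, u t + s *\<^sub>R v t) - f (x t, u t)) \<le> L * norm ((x t, u t + s *\<^sub>R v t) - (x t, u t))"
              using L[OF inR[OF xS[OF t] uB[OF t]] inR[OF xS[OF t] us[OF t]]] by blast
            also have "\<dots> \<le> L * (s * B)"
              using v(2)[OF t] s' \<open>L > 0\<close> by (intro mult_left_mono) auto
            finally show "norm (f (x t, u t + s *\<^sub>R v t) - f (x t, u t)) \<le> L * (s * B)" .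
            show "norm (f (x t, u t)) \<le> L" using L[OF inR[OF xS[OF t] uB[OF t]] inR[OF xS[OF t] us[OF t]]] by blast
          qed (use sr2[OF t] sr[OF t] s' B0 in auto)
          finally show ?thesis by (simp add: algebra_simps)
        qed
      qed (use \<open>L > 0\<close> B0 s' t in auto)
      then show ?thesis by (simp add: C1_def mult_ac)
    qed
    have zS: "z t \<in> S" if "t \<in> {0..T}" for t
    proof -
      have "norm (z t) \<le> norm (x t) + norm (z t - x t)" by (rule norm_triangle_sub)
      then show ?thesis using close[OF that] R0[OF that] s'(4) by (simp add: S_def mult.commute)
    qed
    have Fz: "F t (z t) = (1 + s * r t) *\<^sub>R f (z t, u t + s *\<^sub>R v t)" if "t \<in> {0..T}" for t
      by (simp add: F_def \<pi>_id[OF zS[OF that]])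
    define h where "h t = f' (x t, u t) (y t, 0) + (f' (x t, u t) (0, v t) + r t *\<^sub>R f (x t, u t))" for t
    have h: "h integrable_on {0..T}" "\<And>t. t \<in> {0..T} \<Longrightarrow> y t = integral {0..t} h"
      using y unfolding h_def[abs_def] linearized_solution_def by blast+
    have second: "norm (z t - x t - s *\<^sub>R y t) \<le> C2 * s\<^sup>2" if t: "t \<in> {0..T}" for t
    proof -
      let ?K = "s\<^sup>2 * (L * (C1 + B)\<^sup>2 + L * B * (C1 + B))"
      have "norm (z t - x t - s *\<^sub>R y t) \<le> ?K * (2 * (T - 0) * exp (2 * L * (T - 0)))"
      proof (rule gronwall_integral[where e = "\<lambda>t. z t - x t - s *\<^sub>R y t" and h = "\<lambda>t. F t (z t) - f (x t, u t) - s *\<^sub>R h t"])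
        show "(\<lambda>t. F t (z t) - f (x t, u t) - s *\<^sub>R h t) integrable_on {0..T}"
          by (intro integrable_diff intF z intfx integrable_cmul h)
        show "z t - x t - s *\<^sub>R y t = integral {0..t} (\<lambda>t. F t (z t) - f (x t, u t) - s *\<^sub>R h t)" if "t \<in> {0..T}" for t
        proof -
          note i = sub[OF intF[OF z(1)] that] sub[OF intfx that] sub[OF h(1) that]
          show ?thesis using z(2)[OF that] x(2)[OF that] h(2)[OF that] i
            by (simp add: Henstock_Kurzweil_Integration.integral_diff integrable_diff integrable_cmul)
        qed
        show "norm (F t (z t) - f (x t, u t) - s *\<^sub>R h t) \<le> ?K + L * norm (z t - x t - s *\<^sub>R y t)"
          if t: "t \<in> {0..T}" for t
        proof -
          define dz where "dz = (z t, u t + s *\<^sub>R v t) - (x t, u t)"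
          have dz: "dz = (z t - x t, s *\<^sub>R v t)" by (simp add: dz_def)
          have ndz: "norm dz \<le> s * (C1 + B)"
          proof -
            have "norm dz \<le> norm (z t - x t) + norm (s *\<^sub>R v t)" unfolding dz by (rule norm_Pair_le_add)
            also have "\<dots> \<le> C1 * s + s * B" using close[OF t] v(2)[OF t] s' by (intro add_mono) auto
            finally show ?thesis by (simp add: algebra_simps)
          qed
          note LL = L[OF inR[OF xS[OF t] uB[OF t]] inR[OF zS[OF t] us[OF t]], folded dz_def]
          define D where "D = f (z t, u t + s *\<^sub>R v t) - f (x t, u t)"
          have e: "dz = (z t - x t - s *\<^sub>R y t, 0) + s *\<^sub>R (y t, 0) + s *\<^sub>R (0, v t)"
            by (simp add: dz)
          have fd: "f' (x t, u t) dz = f' (x t, u t) (z t - x t - s *\<^sub>R y t, 0) + s *\<^sub>R f' (x t, u t) (y t, 0) + s *\<^sub>R f' (x t, u t) (0, v t)"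
            unfolding e blinfun.add_right blinfun.scaleR_right ..
          \<comment> \<open>The first-order parts in y and v and the part s r f (x, u) cancel. What
            remains is a Taylor remainder, a term linear in the error itself, which Gronwall's
            inequality absorbs, and a product of two perturbations.\<close>
          have "F t (z t) - f (x t, u t) - s *\<^sub>R h t
            = (D - f' (x t, u t) dz) + f' (x t, u t) (z t - x t - s *\<^sub>R y t, 0) + (s * r t) *\<^sub>R D"
            unfolding fd by (simp add: Fz[OF t] h_def D_def algebra_simps)
          also have "norm \<dots> \<le> norm (D - f' (x t, u t) dz) + norm (f' (x t, u t) (z t - x t - s *\<^sub>R y t, 0)) + \<bar>s * r t\<bar> * norm D"
            by (rule order_trans[OF norm_triangle_ineq]) (auto intro!: add_mono norm_triangle_ineq)
          also have "\<dots> \<le> L * (s * (C1 + B))\<^sup>2 + L * norm (z t - x t - s *\<^sub>R y t) + (s * B) * (L * (s * (C1 + B)))"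
          proof (intro add_mono mult_mono)
            have "norm (D - f' (x t, u t) dz) \<le> L * (norm dz)\<^sup>2" using LL by (simp add: D_def)
            also have "\<dots> \<le> L * (s * (C1 + B))\<^sup>2" using ndz \<open>L > 0\<close> by (intro mult_left_mono power_mono) auto
            finally show "norm (D - f' (x t, u t) dz) \<le> L * (s * (C1 + B))\<^sup>2" .
            have "norm (f' (x t, u t) (z t - x t - s *\<^sub>R y t, 0)) \<le> norm (f' (x t, u t)) * norm (z t - x t - s *\<^sub>R y t)"
              using norm_blinfun[of "f' (x t, u t)" "(z t - x t - s *\<^sub>R y t, 0)"] by simp
            also have "\<dots> \<le> L * norm (z t - x t - s *\<^sub>R y t)" using LL by (intro mult_right_mono) auto
            finally show "norm (f' (x t, u t) (z t - x t - s *\<^sub>R y t, 0)) \<le> L * norm (z t - x t - s *\<^sub>R y t)" .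
            have "norm D \<le> L * norm dz" using LL by (simp add: D_def)
            also have "\<dots> \<le> L * (s * (C1 + B))" using ndz \<open>L > 0\<close> by (intro mult_left_mono) auto
            finally show "norm D \<le> L * (s * (C1 + B))" .
          qed (use sr[OF t] s' B0 in auto)
          finally show ?thesis by (simp add: algebra_simps power2_eq_square)
        qed
      qed (use \<open>L > 0\<close> B0 C10 s' t in auto)
      then show ?thesis by (simp add: C2_def mult_ac)
    qed
    have "(\<lambda>t. (1 + s * r t) *\<^sub>R f (z t, u t + s *\<^sub>R v t)) integrable_on {0..T}"
      by (rule integrable_eq[OF intF[OF z(1)] Fz])
    moreover have "z t = x0 + integral {0..t} (\<lambda>t. (1 + s * r t) *\<^sub>R f (z t, u t + s *\<^sub>R v t))" if t: "t \<in> {0..T}" for t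
    proof -
      have "integral {0..t} (\<lambda>s. F s (z s)) = integral {0..t} (\<lambda>t. (1 + s * r t) *\<^sub>R f (z t, u t + s *\<^sub>R v t))"
        using t by (intro Henstock_Kurzweil_Integration.integral_cong Fz) auto
      then show ?thesis using z(2)[OF t] by simp
    qed
    moreover have "C1 * s \<le> C * s" "C2 * s\<^sup>2 \<le> C * s\<^sup>2"
      using s by (auto simp: C_def intro!: mult_right_mono)
    then have "norm (z t - x t) \<le> C * s" "norm (z t - x t - s *\<^sub>R y t) \<le> C * s\<^sup>2" if "t \<in> {0..T}" for t
      using close[OF that] second[OF that] by linarith+
    ultimately show ?thesis using z(1) by blast
  qed
  show ?thesis by (rule that[OF s0 \<open>0 < C\<close> main])
qed

section \<open>Measurable multipliers\<close>

lemma borel_measurable_cart: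
  fixes f :: "'a \<Rightarrow> real^'n"
  assumes "\<And>i. (\<lambda>x. f x $ i) \<in> borel_measurable M"
  shows "f \<in> borel_measurable M"
  using assms by (subst borel_measurable_euclidean_space) (auto simp: Basis_vec_def inner_axis)

lemma borel_measurable_cart_nth:
  fixes f :: "'a \<Rightarrow> real^'n"
  assumes "f \<in> borel_measurable M"
  shows "(\<lambda>x. f x $ i) \<in> borel_measurable M"
  using measurable_compose[OF assms borel_measurable_nth] .

lemma borel_measurable_det:
  fixes A :: "'a \<Rightarrow> real^'n^'n"
  assumes "\<And>i j. (\<lambda>x. A x $ i $ j) \<in> borel_measurable M"
  shows "(\<lambda>x. det (A x)) \<in> borel_measurable M"
  unfolding det_def
  by (intro borel_measurable_sum borel_measurable_times borel_measurable_const borel_measurable_prod assms)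

lemma bounded_measurable_integrable:
  fixes f :: "real \<Rightarrow> 'a::euclidean_space"
  assumes "f \<in> borel_measurable (lebesgue_on {a..b})" and "\<And>t. t \<in> {a..b} \<Longrightarrow> norm (f t) \<le> B"
  shows "integrable (lebesgue_on {a..b}) f"
  using assms by (intro measurable_bounded_by_integrable_imp_lebesgue_integrable[of f "{a..b}" "\<lambda>_. B"]) auto

text \<open>For bounded measurable functions the gauge integral is the Lebesgue integral, for which
  a non-negative function with integral zero vanishes almost everywhere.\<close>

lemma nonneg_integral_le_0_imp_ae_0:
  fixes h :: "real \<Rightarrow> real"
  assumes h: "h \<in> borel_measurable (lebesgue_on {a..b})" "\<And>t. t \<in> {a..b} \<Longrightarrow> \<bar>h t\<bar> \<le> B"
    and nonneg: "\<And>t. t \<in> {a..b} \<Longrightarrow> 0 \<le> h t" and "integral {a..b} h \<le> 0"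
  shows "\<exists>N. negligible N \<and> (\<forall>t\<in>{a..b} - N. h t = 0)"
proof -
  have i: "integrable (lebesgue_on {a..b}) h"
    using h by (intro bounded_measurable_integrable) auto
  have "integral\<^sup>L (lebesgue_on {a..b}) h = integral {a..b} h"
    by (intro lebesgue_integral_eq_integral i) auto
  moreover have "integral\<^sup>L (lebesgue_on {a..b}) h \<ge> 0"
    using nonneg by (intro integral_nonneg_AE) auto
  ultimately have "integral\<^sup>L (lebesgue_on {a..b}) h = 0" using assms(4) by simp
  then have "AE t in lebesgue_on {a..b}. h t = 0"
    using nonneg by (subst (asm) integral_nonneg_eq_0_iff_AE[OF i]) auto
  then show ?thesis by (subst (asm) AE_lebesgue_on_iff_negligible) auto
qed

text \<open>Outside \<open>I t\<close> the Gram matrix is completed by the identity, so that it is invertible and Cramer's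
  rule expresses its solution measurably in \<open>t\<close>.\<close>

lemma gram_system_solution:
  fixes D :: "'a \<Rightarrow> 'l::finite \<Rightarrow> 'b::euclidean_space" and b :: "'a \<Rightarrow> real^'l" and I :: "'a \<Rightarrow> 'l set"
  assumes D: "\<And>i. (\<lambda>t. D t i) \<in> borel_measurable M"
    and I: "\<And>i. (\<lambda>t. if i \<in> I t then 1 else 0 :: real) \<in> borel_measurable M"
    and b: "b \<in> borel_measurable M" "\<And>t. t \<in> space M \<Longrightarrow> norm (b t) \<le> B"
    and "\<epsilon> > 0"
    and indep: "\<And>t \<xi>. t \<in> space M \<Longrightarrow> \<epsilon> * L2_set \<xi> (I t) \<le> norm (\<Sum>i\<in>I t. \<xi> i *\<^sub>R D t i)"
  shows "\<exists>l \<in> borel_measurable M. \<forall>t\<in>space M. norm (l t) \<le> B / \<epsilon>\<^sup>2 \<and> (\<forall>i. i \<notin> I t \<longrightarrow> l t $ i = 0) \<and>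
    (\<forall>i\<in>I t. D t i \<bullet> (\<Sum>j\<in>UNIV. l t $ j *\<^sub>R D t j) = b t $ i)"
proof -
  define m :: "'a \<Rightarrow> 'l \<Rightarrow> real" where "m t i = (if i \<in> I t then 1 else 0)" for t i
  define G :: "'a \<Rightarrow> real^'l^'l" where
    "G t = (\<chi> i j. m t i * m t j * (D t i \<bullet> D t j) + (if i = j then 1 - m t i else 0))" for t
  define b' :: "'a \<Rightarrow> real^'l" where "b' t = (\<chi> i. m t i * b t $ i)" for t
  define l :: "'a \<Rightarrow> real^'l" where
    "l t = (\<chi> k. det (\<chi> i j. if j = k then b' t $ i else G t $ i $ j) / det (G t))" for t
  have m: "(\<lambda>t. m t i) \<in> borel_measurable M" for i unfolding m_def by (rule I)
  have Gm: "(\<lambda>t. G t $ i $ j) \<in> borel_measurable M" for i j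
    unfolding G_def by (cases "i = j") (simp_all, (intro borel_measurable_add borel_measurable_times
      borel_measurable_diff borel_measurable_const m borel_measurable_inner D)+)
  have b'm: "(\<lambda>t. b' t $ i) \<in> borel_measurable M" for i
    unfolding b'_def by (simp, intro borel_measurable_times m borel_measurable_cart_nth b)
  have lm: "l \<in> borel_measurable M"
  proof (rule borel_measurable_cart)
    fix k
    have "(\<lambda>t. det (\<chi> i j. if j = k then b' t $ i else G t $ i $ j)) \<in> borel_measurable M"
    proof (rule borel_measurable_det)
      fix i j show "(\<lambda>t. (\<chi> i j. if j = k then b' t $ i else G t $ i $ j) $ i $ j) \<in> borel_measurable M"
        using b'm Gm by (cases "j = k") auto
    qed
    then show "(\<lambda>t. l t $ k) \<in> borel_measurable M"
      unfolding l_def using borel_measurable_det[OF Gm] by (simp add: borel_measurable_divide)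
  qed
  \<comment> \<open>The completed Gram matrix is a sum of two positive semidefinite forms: the
    squared norm of the combination of the vectors indexed by \<open>I t\<close>, and the squares of
    the coordinates outside. This yields both invertibility and the bound on the solution.\<close>
  have quad: "\<xi> \<bullet> (G t *v \<xi>) = (norm (\<Sum>i\<in>UNIV. (m t i * \<xi> $ i) *\<^sub>R D t i))\<^sup>2 + (\<Sum>i\<in>UNIV. (1 - m t i) * (\<xi> $ i)\<^sup>2)" for t \<xi>
  proof -
    have "(norm (\<Sum>i\<in>UNIV. (m t i * \<xi> $ i) *\<^sub>R D t i))\<^sup>2 = (\<Sum>i\<in>UNIV. \<Sum>j\<in>UNIV. \<xi> $ i * (m t i * m t j * (D t i \<bullet> D t j) * \<xi> $ j))"
      unfolding power2_norm_eq_inner inner_sum_left inner_sum_right by (simp add: mult_ac inner_commute)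
    moreover have "(\<Sum>i\<in>UNIV. (1 - m t i) * (\<xi> $ i)\<^sup>2) = (\<Sum>i\<in>UNIV. \<Sum>j\<in>UNIV. \<xi> $ i * ((if i = j then 1 - m t i else 0) * \<xi> $ j))"
      by (intro sum.cong refl) (simp add: if_distrib[of "\<lambda>x. x * _"] if_distrib[of "\<lambda>x. _ * x"] power2_eq_square mult_ac cong: if_cong)
    moreover have "\<xi> \<bullet> (G t *v \<xi>) = (\<Sum>i\<in>UNIV. \<Sum>j\<in>UNIV. \<xi> $ i * (G t $ i $ j * \<xi> $ j))"
      by (simp add: inner_vec_def matrix_vector_mult_def sum_distrib_left)
    moreover have "\<xi> $ i * (G t $ i $ j * \<xi> $ j) = \<xi> $ i * (m t i * m t j * (D t i \<bullet> D t j) * \<xi> $ j)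
      + \<xi> $ i * ((if i = j then 1 - m t i else 0) * \<xi> $ j)" for i j
      by (simp add: G_def distrib_left distrib_right)
    ultimately show ?thesis by (simp add: sum.distrib)
  qed
  have mask: "(\<Sum>i\<in>UNIV. (m t i * \<xi> $ i) *\<^sub>R D t i) = (\<Sum>i\<in>I t. \<xi> $ i *\<^sub>R D t i)" for t \<xi>
    by (rule sum.mono_neutral_cong_right) (auto simp: m_def)
  show ?thesis
  proof (intro bexI[OF _ lm] ballI)
    fix t assume t: "t \<in> space M"
    have "\<xi> = 0" if "G t *v \<xi> = 0" for \<xi>
    proof -
      have nn: "(\<Sum>i\<in>UNIV. (1 - m t i) * (\<xi> $ i)\<^sup>2) \<ge> 0" by (intro sum_nonneg) (auto simp: m_def)
      have "(norm (\<Sum>i\<in>UNIV. (m t i * \<xi> $ i) *\<^sub>R D t i))\<^sup>2 + (\<Sum>i\<in>UNIV. (1 - m t i) * (\<xi> $ i)\<^sup>2) = 0"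
        using quad[of \<xi> t] that by simp
      then have z: "norm (\<Sum>i\<in>I t. \<xi> $ i *\<^sub>R D t i) = 0" "(\<Sum>i\<in>UNIV. (1 - m t i) * (\<xi> $ i)\<^sup>2) = 0"
        using nn unfolding mask by (simp_all add: add_nonneg_eq_0_iff)
      have "\<epsilon> * L2_set (\<lambda>i. \<xi> $ i) (I t) \<le> 0" using indep[OF t, of "\<lambda>i. \<xi> $ i"] z(1) by simp
      then have "L2_set (\<lambda>i. \<xi> $ i) (I t) \<le> 0" using \<open>\<epsilon> > 0\<close> by (simp add: mult_le_0_iff)
      then have "L2_set (\<lambda>i. \<xi> $ i) (I t) = 0"
        using L2_set_nonneg[of "\<lambda>i. \<xi> $ i" "I t"] by linarith
      then have 1: "\<xi> $ i = 0" if "i \<in> I t" for i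
        using that by (subst (asm) L2_set_eq_0_iff) auto
      have off: "(1 - m t i) * (\<xi> $ i)\<^sup>2 = 0" for i
        using z(2) by (subst (asm) sum_nonneg_eq_0_iff) (auto simp: m_def)
      have "\<xi> $ i = 0" if "i \<notin> I t" for i using that off[of i] by (simp add: m_def)
      then show ?thesis using 1 by (metis vec_eq_iff zero_index)
    qed
    then have det: "det (G t) \<noteq> 0"
      using matrix_left_invertible_ker[of "G t"] invertible_det_nz[of "G t"] invertible_left_inverse by blast
    then have eq: "G t *v l t = b' t" using cramer[OF det] unfolding l_def by blast
    have row: "(\<Sum>j\<in>UNIV. m t i * m t j * (D t i \<bullet> D t j) * l t $ j) + (1 - m t i) * l t $ i = m t i * b t $ i" for i
    proof -
      have "(G t *v l t) $ i = (\<Sum>j\<in>UNIV. m t i * m t j * (D t i \<bullet> D t j) * l t $ j) + (\<Sum>j\<in>UNIV. (if i = j then 1 - m t i else 0) * l t $ j)"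
        by (simp add: matrix_vector_mult_def G_def distrib_right sum.distrib)
      then show ?thesis unfolding eq by (simp add: b'_def if_distrib[of "\<lambda>x. x * _"] cong: if_cong)
    qed
    have off: "l t $ i = 0" if "i \<notin> I t" for i using row[of i] that by (simp add: m_def)
    have on: "D t i \<bullet> (\<Sum>j\<in>UNIV. l t $ j *\<^sub>R D t j) = b t $ i" if "i \<in> I t" for i
    proof -
      have "D t i \<bullet> (\<Sum>j\<in>UNIV. l t $ j *\<^sub>R D t j) = (\<Sum>j\<in>UNIV. m t i * m t j * (D t i \<bullet> D t j) * l t $ j)"
        unfolding inner_sum_right using that off by (intro sum.cong) (auto simp: m_def)
      then show ?thesis using row[of i] that by (simp add: m_def)
    qed
    have "norm (l t) = L2_set (\<lambda>i. l t $ i) (I t)"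
      unfolding norm_vec_def L2_set_def using off
      by (intro arg_cong[where f = sqrt] sum.mono_neutral_cong_right) auto
    \<comment> \<open>Testing the system with its own solution: the square of \<epsilon> |l| is at
      most l \<bullet> b, hence at most |l| B, which is where the bound with the square of
      \<epsilon> comes from.\<close>
    then have "(\<epsilon> * norm (l t))\<^sup>2 \<le> (norm (\<Sum>i\<in>I t. l t $ i *\<^sub>R D t i))\<^sup>2"
      using indep[OF t, of "\<lambda>i. l t $ i"] \<open>\<epsilon> > 0\<close> by (intro power_mono) auto
    also have "\<dots> \<le> l t \<bullet> b' t"
    proof -
      have "(\<Sum>i\<in>UNIV. (1 - m t i) * (l t $ i)\<^sup>2) \<ge> 0" by (intro sum_nonneg) (auto simp: m_def)
      then show ?thesis using quad[of "l t" t] by (simp add: mask eq)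
    qed
    also have "\<dots> = l t \<bullet> b t"
      unfolding inner_vec_def using off by (intro sum.cong) (auto simp: b'_def m_def)
    also have "\<dots> \<le> norm (l t) * B"
      using norm_cauchy_schwarz[of "l t" "b t"] b(2)[OF t] by (meson mult_left_mono norm_ge_zero order_trans)
    finally have "norm (l t) * (\<epsilon>\<^sup>2 * norm (l t)) \<le> norm (l t) * B" by (simp add: power2_eq_square mult_ac)
    then have "\<epsilon>\<^sup>2 * norm (l t) \<le> B"
      using order_trans[OF norm_ge_zero b(2)[OF t]] by (cases "l t = 0") auto
    then have "norm (l t) \<le> B / \<epsilon>\<^sup>2" using \<open>\<epsilon> > 0\<close> by (simp add: field_simps)
    then show "norm (l t) \<le> B / \<epsilon>\<^sup>2 \<and> (\<forall>i. i \<notin> I t \<longrightarrow> l t $ i = 0) \<and>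
      (\<forall>i\<in>I t. D t i \<bullet> (\<Sum>j\<in>UNIV. l t $ j *\<^sub>R D t j) = b t $ i)"
      using on off by blast
  qed
qed

text \<open>The linearized constraints keep the value \<open>cc t\<close> (with \<open>cc t = c (u t)\<close>), so these directions form
  a convex set that is not a cone. It is the presence of this value that yields complementarity.\<close>

definition strictly_feasible_direction ::
  "(real \<Rightarrow> 'l \<Rightarrow> 'b::euclidean_space) \<Rightarrow> (real \<Rightarrow> real^'l) \<Rightarrow> real \<Rightarrow> real \<Rightarrow> (real \<Rightarrow> 'b) \<Rightarrow> bool"
  where
  "strictly_feasible_direction D cc T \<delta> v \<longleftrightarrow>
     v \<in> borel_measurable (lebesgue_on {0..T}) \<and> (\<exists>C. \<forall>t\<in>{0..T}. norm (v t) \<le> C) \<and>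
     (\<exists>\<kappa>>0. \<forall>t\<in>{0..T}. \<forall>i. - \<delta> \<le> cc t $ i \<longrightarrow> cc t $ i + D t i \<bullet> v t \<le> - \<kappa>)"

section \<open>Feasible directions and multipliers for the control constraints\<close>

context
  fixes D :: "real \<Rightarrow> 'l::finite \<Rightarrow> 'b::euclidean_space" and cc :: "real \<Rightarrow> real^'l" and T \<delta> \<epsilon> B :: real
  assumes D: "\<And>i. (\<lambda>t. D t i) \<in> borel_measurable (lebesgue_on {0..T})" "\<And>t i. t \<in> {0..T} \<Longrightarrow> norm (D t i) \<le> B"
    and cc: "cc \<in> borel_measurable (lebesgue_on {0..T})" "\<And>t. t \<in> {0..T} \<Longrightarrow> norm (cc t) \<le> B"
      "\<And>t i. t \<in> {0..T} \<Longrightarrow> cc t $ i \<le> 0"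
    and T: "0 < T" and \<epsilon>: "\<epsilon> > 0"
    and indep: "\<And>t \<xi>. t \<in> {0..T} \<Longrightarrow>
      \<epsilon> * L2_set \<xi> {i. - \<delta> \<le> cc t $ i} \<le> norm (\<Sum>i\<in>{i. - \<delta> \<le> cc t $ i}. \<xi> i *\<^sub>R D t i)"
begin

lemma constraint_bound_nonneg: "B \<ge> 0"
  using order_trans[OF norm_ge_zero cc(2)[of 0]] T by simp

lemma constraint_nth_bound: "t \<in> {0..T} \<Longrightarrow> \<bar>cc t $ i\<bar> \<le> B"
  using cc(2)[of t] component_le_norm_cart[of "cc t" i] by simp

text \<open>A supply of bounded measurable directions whose products with the gradients of the
  \<delta>-active constraints are prescribed. It is used to construct a strictly feasible direction,
  to project q onto the span of these gradients, and to test sign and complementarity.\<close>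

lemma gradient_system_solution:
  assumes b: "b \<in> borel_measurable (lebesgue_on {0..T})" "\<And>t. t \<in> {0..T} \<Longrightarrow> norm (b t :: real^'l) \<le> C"
  obtains l where "l \<in> borel_measurable (lebesgue_on {0..T})" "\<And>t. t \<in> {0..T} \<Longrightarrow> norm (l t) \<le> C / \<epsilon>\<^sup>2"
    "\<And>t i. t \<in> {0..T} \<Longrightarrow> \<not> - \<delta> \<le> cc t $ i \<Longrightarrow> l t $ i = 0"
    "\<And>t i. t \<in> {0..T} \<Longrightarrow> - \<delta> \<le> cc t $ i \<Longrightarrow> D t i \<bullet> (\<Sum>j\<in>UNIV. l t $ j *\<^sub>R D t j) = b t $ i"
    "(\<lambda>t. \<Sum>j\<in>UNIV. l t $ j *\<^sub>R D t j) \<in> borel_measurable (lebesgue_on {0..T})"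
    "\<exists>C. \<forall>t\<in>{0..T}. norm (\<Sum>j\<in>UNIV. l t $ j *\<^sub>R D t j) \<le> C"
proof -
  have I: "(\<lambda>t. if i \<in> {i. - \<delta> \<le> cc t $ i} then 1 else 0 :: real) \<in> borel_measurable (lebesgue_on {0..T})" for i
    using borel_measurable_cart_nth[OF cc(1), of i] by simp measurable
  have "\<exists>l \<in> borel_measurable (lebesgue_on {0..T}). \<forall>t\<in>space (lebesgue_on {0..T}).
      norm (l t) \<le> C / \<epsilon>\<^sup>2 \<and> (\<forall>i. i \<notin> {i. - \<delta> \<le> cc t $ i} \<longrightarrow> l t $ i = 0) \<and>
      (\<forall>i\<in>{i. - \<delta> \<le> cc t $ i}. D t i \<bullet> (\<Sum>j\<in>UNIV. l t $ j *\<^sub>R D t j) = b t $ i)"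
    by (rule gram_system_solution[where I = "\<lambda>t. {i. - \<delta> \<le> cc t $ i}", OF D(1) I b(1) _ \<epsilon>])
      (use b(2) indep in simp_all)
  then have ex: "\<exists>l \<in> borel_measurable (lebesgue_on {0..T}). \<forall>t\<in>{0..T}.
      norm (l t) \<le> C / \<epsilon>\<^sup>2 \<and> (\<forall>i. \<not> - \<delta> \<le> cc t $ i \<longrightarrow> l t $ i = 0) \<and>
      (\<forall>i. - \<delta> \<le> cc t $ i \<longrightarrow> D t i \<bullet> (\<Sum>j\<in>UNIV. l t $ j *\<^sub>R D t j) = b t $ i)"
    by simp
  obtain l where l: "l \<in> borel_measurable (lebesgue_on {0..T})"
    and lb: "\<And>t. t \<in> {0..T} \<Longrightarrow> norm (l t) \<le> C / \<epsilon>\<^sup>2"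
    and rest: "\<And>t i. t \<in> {0..T} \<Longrightarrow> \<not> - \<delta> \<le> cc t $ i \<Longrightarrow> l t $ i = 0"
    "\<And>t i. t \<in> {0..T} \<Longrightarrow> - \<delta> \<le> cc t $ i \<Longrightarrow> D t i \<bullet> (\<Sum>j\<in>UNIV. l t $ j *\<^sub>R D t j) = b t $ i"
    using ex by blast
  have "norm (\<Sum>j\<in>UNIV. l t $ j *\<^sub>R D t j) \<le> of_nat CARD('l) * (C / \<epsilon>\<^sup>2 * B)" if t: "t \<in> {0..T}" for t
  proof (rule sum_norm_bound)
    fix j
    have "\<bar>l t $ j\<bar> \<le> C / \<epsilon>\<^sup>2" using component_le_norm_cart[of "l t" j] lb[OF t] by simp
    then show "norm (l t $ j *\<^sub>R D t j) \<le> C / \<epsilon>\<^sup>2 * B"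
      unfolding norm_scaleR using D(2)[OF t] by (intro mult_mono) auto
  qed
  then have "\<exists>C. \<forall>t\<in>{0..T}. norm (\<Sum>j\<in>UNIV. l t $ j *\<^sub>R D t j) \<le> C" by blast
  moreover have "(\<lambda>t. \<Sum>j\<in>UNIV. l t $ j *\<^sub>R D t j) \<in> borel_measurable (lebesgue_on {0..T})"
    by (intro borel_measurable_sum borel_measurable_scaleR borel_measurable_cart_nth l D)
  ultimately show ?thesis using that l lb rest by blast
qed

text \<open>The products \<open>- cc t $ i - 1\<close> are prescribed, so that every \<delta>-active
  linearized constraint takes the value -1 and \<kappa> = 1 works: an interior point in the sense of
  Mangasarian and Fromovitz, uniform in t.\<close>

lemma strictly_feasible_direction_exists: "\<exists>v. strictly_feasible_direction D cc T \<delta> v"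
proof -
  define b :: "real \<Rightarrow> real^'l" where "b t = (\<chi> i. - cc t $ i - 1)" for t
  have "b t = - cc t - (\<chi> i. 1)" for t by (simp add: b_def vec_eq_iff)
  then have "norm (b t) \<le> B + norm ((\<chi> i. 1) :: real^'l)" if "t \<in> {0..T}" for t
    using norm_triangle_ineq4[of "- cc t" "\<chi> i. 1"] cc(2)[OF that] by simp
  note bb = this
  have bm: "b \<in> borel_measurable (lebesgue_on {0..T})"
    by (rule borel_measurable_cart)
      (simp add: b_def, intro borel_measurable_diff borel_measurable_uminus borel_measurable_cart_nth cc borel_measurable_const)
  obtain l where l: "\<And>t i. t \<in> {0..T} \<Longrightarrow> - \<delta> \<le> cc t $ i \<Longrightarrow> D t i \<bullet> (\<Sum>j\<in>UNIV. l t $ j *\<^sub>R D t j) = b t $ i"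
    "(\<lambda>t. \<Sum>j\<in>UNIV. l t $ j *\<^sub>R D t j) \<in> borel_measurable (lebesgue_on {0..T})"
    "\<exists>C. \<forall>t\<in>{0..T}. norm (\<Sum>j\<in>UNIV. l t $ j *\<^sub>R D t j) \<le> C"
    by (rule gradient_system_solution[OF bm bb]) (assumption, (rule that; assumption))
  then have "strictly_feasible_direction D cc T \<delta> (\<lambda>t. \<Sum>j\<in>UNIV. l t $ j *\<^sub>R D t j)"
    unfolding strictly_feasible_direction_def
    by (intro conjI exI[of "\<lambda>\<kappa>. \<kappa> > 0 \<and> _ \<kappa>" 1]) (simp_all add: b_def)
  then show ?thesis by blast
qed

lemma strictly_feasible_direction_convex:
  assumes v: "strictly_feasible_direction D cc T \<delta> v" "strictly_feasible_direction D cc T \<delta> w" and \<theta>: "0 \<le> \<theta>" "\<theta> \<le> 1"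
  shows "strictly_feasible_direction D cc T \<delta> (\<lambda>t. (1 - \<theta>) *\<^sub>R v t + \<theta> *\<^sub>R w t)"
proof -
  obtain C1 C2 where C: "\<And>t. t \<in> {0..T} \<Longrightarrow> norm (v t) \<le> C1" "\<And>t. t \<in> {0..T} \<Longrightarrow> norm (w t) \<le> C2"
    using v unfolding strictly_feasible_direction_def by blast
  obtain k1 k2 where k: "k1 > 0" "k2 > 0"
    "\<And>t i. t \<in> {0..T} \<Longrightarrow> - \<delta> \<le> cc t $ i \<Longrightarrow> cc t $ i + D t i \<bullet> v t \<le> - k1"
    "\<And>t i. t \<in> {0..T} \<Longrightarrow> - \<delta> \<le> cc t $ i \<Longrightarrow> cc t $ i + D t i \<bullet> w t \<le> - k2"
    using v unfolding strictly_feasible_direction_def by blast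
  have "norm ((1 - \<theta>) *\<^sub>R v t + \<theta> *\<^sub>R w t) \<le> (1 - \<theta>) * C1 + \<theta> * C2" if "t \<in> {0..T}" for t
    using C[OF that] \<theta> by (intro order_trans[OF norm_triangle_ineq] add_mono) (auto intro!: mult_left_mono)
  moreover have "cc t $ i + D t i \<bullet> ((1 - \<theta>) *\<^sub>R v t + \<theta> *\<^sub>R w t) \<le> - min k1 k2"
    if "t \<in> {0..T}" "- \<delta> \<le> cc t $ i" for t i
  proof -
    have "cc t $ i + D t i \<bullet> ((1 - \<theta>) *\<^sub>R v t + \<theta> *\<^sub>R w t)
      = (1 - \<theta>) * (cc t $ i + D t i \<bullet> v t) + \<theta> * (cc t $ i + D t i \<bullet> w t)"
      by (simp add: inner_add_right algebra_simps)
    also have "\<dots> \<le> (1 - \<theta>) * (- min k1 k2) + \<theta> * (- min k1 k2)"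
      using k(3,4)[OF that] \<theta> by (intro add_mono mult_left_mono) auto
    finally show ?thesis by (simp add: algebra_simps)
  qed
  moreover have "(\<lambda>t. (1 - \<theta>) *\<^sub>R v t + \<theta> *\<^sub>R w t) \<in> borel_measurable (lebesgue_on {0..T})"
    using v unfolding strictly_feasible_direction_def
    by (intro borel_measurable_add borel_measurable_scaleR borel_measurable_const) auto
  ultimately show ?thesis
    unfolding strictly_feasible_direction_def using k by (metis min_less_iff_conj)
qed

text \<open>The stationarity equation comes from testing with the residual of the projection of \<open>q\<close> onto the
  span of the gradients. Testing with the direction \<open>v\<close> such that \<open>D t i \<bullet> v t\<close> is \<open>-1\<close> where \<open>\<nu> t $ i < 0\<close>
  and \<open>- cc t $ i\<close> elsewhere gives sign and complementarity at once.\<close>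

lemma multiplier_exists:
  assumes q: "q \<in> borel_measurable (lebesgue_on {0..T})" "\<And>t. t \<in> {0..T} \<Longrightarrow> norm (q t) \<le> Q"
    and opt: "\<And>v. strictly_feasible_direction D cc T \<delta> v \<Longrightarrow> 0 \<le> integral {0..T} (\<lambda>t. q t \<bullet> v t)"
  obtains \<nu> N C where "\<nu> \<in> borel_measurable (lebesgue_on {0..T})" "\<And>t. t \<in> {0..T} \<Longrightarrow> norm (\<nu> t) \<le> C"
    "negligible N" "\<And>t i. t \<in> {0..T} - N \<Longrightarrow> 0 \<le> \<nu> t $ i" "\<And>t i. t \<in> {0..T} - N \<Longrightarrow> \<nu> t $ i * cc t $ i = 0"
    "\<And>t. t \<in> {0..T} - N \<Longrightarrow> q t + (\<Sum>i\<in>UNIV. \<nu> t $ i *\<^sub>R D t i) = 0"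
proof -
  have int: "(\<lambda>t. q t \<bullet> v t) \<in> borel_measurable (lebesgue_on {0..T})" "\<exists>C. \<forall>t\<in>{0..T}. \<bar>q t \<bullet> v t\<bar> \<le> C"
    "(\<lambda>t. q t \<bullet> v t) integrable_on {0..T}"
    if v: "v \<in> borel_measurable (lebesgue_on {0..T})" "\<exists>C. \<forall>t\<in>{0..T}. norm (v t) \<le> C" for v
  proof -
    show m: "(\<lambda>t. q t \<bullet> v t) \<in> borel_measurable (lebesgue_on {0..T})" by (intro borel_measurable_inner q v)
    obtain C where C: "\<And>t. t \<in> {0..T} \<Longrightarrow> norm (v t) \<le> C" using v by blast
    have bd: "\<bar>q t \<bullet> v t\<bar> \<le> Q * C" if "t \<in> {0..T}" for t
      by (rule abs_inner_le_mult[OF q(2)[OF that] C[OF that]])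
    then show "\<exists>C. \<forall>t\<in>{0..T}. \<bar>q t \<bullet> v t\<bar> \<le> C" by blast
    show "(\<lambda>t. q t \<bullet> v t) integrable_on {0..T}"
      using bd by (intro bounded_measurable_integrable_on[OF m]) auto
  qed
  obtain v0 where v0: "strictly_feasible_direction D cc T \<delta> v0" using strictly_feasible_direction_exists by blast
  \<comment> \<open>Optimality extends to directions without slack: mixing in \<open>v0\<close> with
    weight \<theta> creates the slack \<theta> \<kappa>, and \<theta> may be arbitrarily
    small.\<close>
  have opt': "0 \<le> integral {0..T} (\<lambda>t. q t \<bullet> v t)"
    if v: "v \<in> borel_measurable (lebesgue_on {0..T})" "\<exists>C. \<forall>t\<in>{0..T}. norm (v t) \<le> C"
      "\<And>t i. t \<in> {0..T} \<Longrightarrow> - \<delta> \<le> cc t $ i \<Longrightarrow> cc t $ i + D t i \<bullet> v t \<le> 0" for v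
  proof -
    obtain \<kappa> where \<kappa>: "\<kappa> > 0" "\<And>t i. t \<in> {0..T} \<Longrightarrow> - \<delta> \<le> cc t $ i \<Longrightarrow> cc t $ i + D t i \<bullet> v0 t \<le> - \<kappa>"
      using v0 unfolding strictly_feasible_direction_def by blast
    obtain C0 where C0: "\<And>t. t \<in> {0..T} \<Longrightarrow> norm (v0 t) \<le> C0"
      using v0 unfolding strictly_feasible_direction_def by blast
    obtain C where C: "\<And>t. t \<in> {0..T} \<Longrightarrow> norm (v t) \<le> C" using v by blast
    have v0m: "v0 \<in> borel_measurable (lebesgue_on {0..T})" using v0 unfolding strictly_feasible_direction_def by blast
    have v0b: "\<exists>C. \<forall>t\<in>{0..T}. norm (v0 t) \<le> C" using C0 by blast
    define A0 where "A0 = integral {0..T} (\<lambda>t. q t \<bullet> v0 t)"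
    define A where "A = integral {0..T} (\<lambda>t. q t \<bullet> v t)"
    have "A0 \<ge> 0" using opt[OF v0] by (simp add: A0_def)
    have mix: "(1 - \<theta>) * A + \<theta> * A0 \<ge> 0" if \<theta>: "0 < \<theta>" "\<theta> \<le> 1" for \<theta>
    proof -
      let ?w = "\<lambda>t. (1 - \<theta>) *\<^sub>R v t + \<theta> *\<^sub>R v0 t"
      have "strictly_feasible_direction D cc T \<delta> ?w"
        unfolding strictly_feasible_direction_def
      proof (intro conjI exI ballI allI impI)
        show "?w \<in> borel_measurable (lebesgue_on {0..T})"
          by (intro borel_measurable_add borel_measurable_scaleR borel_measurable_const v v0m)
        show "0 < \<theta> * \<kappa>" using \<theta> \<kappa> by simp
        fix t assume t: "t \<in> {0..T}"
        show "norm (?w t) \<le> (1 - \<theta>) * C + \<theta> * C0"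
          using C[OF t] C0[OF t] \<theta> by (intro order_trans[OF norm_triangle_ineq] add_mono) (auto intro!: mult_left_mono)
        fix i assume i: "- \<delta> \<le> cc t $ i"
        have "cc t $ i + D t i \<bullet> ?w t = (1 - \<theta>) * (cc t $ i + D t i \<bullet> v t) + \<theta> * (cc t $ i + D t i \<bullet> v0 t)"
          by (simp add: inner_add_right algebra_simps)
        also have "\<dots> \<le> (1 - \<theta>) * 0 + \<theta> * (- \<kappa>)"
          using v(3)[OF t i] \<kappa>(2)[OF t i] \<theta> by (intro add_mono mult_left_mono) auto
        finally show "cc t $ i + D t i \<bullet> ?w t \<le> - (\<theta> * \<kappa>)" by simp
      qed
      then have "0 \<le> integral {0..T} (\<lambda>t. q t \<bullet> ?w t)" by (rule opt)
      also have "(\<lambda>t. q t \<bullet> ?w t) = (\<lambda>t. (1 - \<theta>) * (q t \<bullet> v t) + \<theta> * (q t \<bullet> v0 t))"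
        by (simp add: inner_add_right)
      also have "integral {0..T} \<dots> = (1 - \<theta>) * A + \<theta> * A0"
        unfolding A_def A0_def
        using Henstock_Kurzweil_Integration.integral_add[OF integrable_on_mult_right[OF int(3)[OF v(1,2)], of "1 - \<theta>"]
          integrable_on_mult_right[OF int(3)[OF v0m v0b], of \<theta>]] by simp
      finally show ?thesis .
    qed
    have "A \<ge> 0"
    proof (rule ccontr)
      assume "\<not> A \<ge> 0"
      then have "A < 0" by simp
      define d where "d = A0 - A"
      have d: "d > 0" "- A \<le> d" using \<open>A < 0\<close> \<open>A0 \<ge> 0\<close> by (auto simp: d_def)
      \<comment> \<open>Chosen so that the mixture has the value A / 2, which is still
        negative.\<close>
      define \<theta> where "\<theta> = - A / (2 * d)"
      have "0 < \<theta>" "\<theta> \<le> 1" using \<open>A < 0\<close> d by (auto simp: \<theta>_def field_simps)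
      from mix[OF this] have "A + \<theta> * (A0 - A) \<ge> 0" by (simp add: algebra_simps)
      moreover have "\<theta> * (A0 - A) = - A / 2" using d by (simp add: \<theta>_def flip: d_def)
      ultimately show False using \<open>A < 0\<close> by simp
    qed
    then show ?thesis by (simp add: A_def)
  qed
  \<comment> \<open>With this right-hand side the Gram system becomes the normal equations: q +
    (\<Sum>j. \<nu> j D j) is orthogonal to all \<delta>-active gradients.\<close>
  define b1 :: "real \<Rightarrow> real^'l" where "b1 t = (\<chi> i. - (D t i \<bullet> q t))" for t
  have b1m: "b1 \<in> borel_measurable (lebesgue_on {0..T})"
    by (rule borel_measurable_cart) (simp add: b1_def, intro borel_measurable_inner borel_measurable_uminus D q)
  have Q0: "Q \<ge> 0" using order_trans[OF norm_ge_zero q(2)[of 0]] T by simp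
  have b1b: "norm (b1 t) \<le> of_nat CARD('l) * (B * Q)" if t: "t \<in> {0..T}" for t
  proof -
    have "norm (b1 t) \<le> (\<Sum>i\<in>UNIV. \<bar>b1 t $ i\<bar>)" by (rule norm_le_l1_cart)
    also have "\<dots> \<le> of_nat CARD('l) * (B * Q)"
    proof (rule sum_bounded_above)
      fix i
      show "\<bar>b1 t $ i\<bar> \<le> B * Q" using abs_inner_le_mult[OF D(2)[OF t] q(2)[OF t]] by (simp add: b1_def)
    qed
    finally show ?thesis .
  qed
  obtain \<nu> where \<nu>: "\<nu> \<in> borel_measurable (lebesgue_on {0..T})"
    "\<And>t. t \<in> {0..T} \<Longrightarrow> norm (\<nu> t) \<le> of_nat CARD('l) * (B * Q) / \<epsilon>\<^sup>2"
    and \<nu>0: "\<And>t i. t \<in> {0..T} \<Longrightarrow> \<not> - \<delta> \<le> cc t $ i \<Longrightarrow> \<nu> t $ i = 0"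
    and \<nu>1: "\<And>t i. t \<in> {0..T} \<Longrightarrow> - \<delta> \<le> cc t $ i \<Longrightarrow> D t i \<bullet> (\<Sum>j\<in>UNIV. \<nu> t $ j *\<^sub>R D t j) = b1 t $ i"
    and \<nu>2: "(\<lambda>t. \<Sum>j\<in>UNIV. \<nu> t $ j *\<^sub>R D t j) \<in> borel_measurable (lebesgue_on {0..T})"
    "\<exists>C. \<forall>t\<in>{0..T}. norm (\<Sum>j\<in>UNIV. \<nu> t $ j *\<^sub>R D t j) \<le> C"
    by (rule gradient_system_solution[OF b1m b1b]) (assumption, (rule that; assumption))
  define r where "r t = q t + (\<Sum>j\<in>UNIV. \<nu> t $ j *\<^sub>R D t j)" for t
  have rm: "r \<in> borel_measurable (lebesgue_on {0..T})" unfolding r_def[abs_def] by (intro borel_measurable_add q \<nu>2)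
  have rb: "\<exists>C. \<forall>t\<in>{0..T}. norm (r t) \<le> C"
  proof -
    obtain C where "\<And>t. t \<in> {0..T} \<Longrightarrow> norm (\<Sum>j\<in>UNIV. \<nu> t $ j *\<^sub>R D t j) \<le> C" using \<nu>2 by blast
    then have "norm (r t) \<le> Q + C" if "t \<in> {0..T}" for t
      unfolding r_def using q(2)[OF that] that by (intro order_trans[OF norm_triangle_ineq] add_mono) auto
    then show ?thesis by blast
  qed
  have Dr: "D t i \<bullet> r t = 0" if "t \<in> {0..T}" "- \<delta> \<le> cc t $ i" for t i
    using \<nu>1[OF that] by (simp add: r_def inner_add_right b1_def)
  have qr: "q t \<bullet> r t = r t \<bullet> r t" if t: "t \<in> {0..T}" for t
  proof -
    have "\<nu> t $ j * (D t j \<bullet> r t) = 0" for j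
      using Dr[OF t, of j] \<nu>0[OF t, of j] by (cases "- \<delta> \<le> cc t $ j") auto
    then have "(\<Sum>j\<in>UNIV. \<nu> t $ j *\<^sub>R D t j) \<bullet> r t = 0"
      unfolding inner_sum_left inner_scaleR_left by (intro sum.neutral) blast
    then show ?thesis by (simp add: r_def inner_add_left)
  qed
  obtain N1 where N1: "negligible N1" "\<And>t. t \<in> {0..T} - N1 \<Longrightarrow> r t = 0"
  proof -
    obtain C where C: "\<And>t. t \<in> {0..T} \<Longrightarrow> norm (r t) \<le> C" using rb by blast
    \<comment> \<open>Orthogonality makes -r admissible, since each linearized constraint then
      equals the value of \<open>cc\<close>; it also gives q \<bullet> r = r \<bullet> r.\<close>
    have "0 \<le> integral {0..T} (\<lambda>t. q t \<bullet> (- r t))"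
      using rm rb Dr cc(3) by (intro opt') auto
    also have "integral {0..T} (\<lambda>t. q t \<bullet> (- r t)) = integral {0..T} (\<lambda>t. - (r t \<bullet> r t))"
      by (rule Henstock_Kurzweil_Integration.integral_cong) (simp add: qr)
    finally have "integral {0..T} (\<lambda>t. r t \<bullet> r t) \<le> 0" by simp
    moreover have "\<bar>r t \<bullet> r t\<bar> \<le> C * C" if "t \<in> {0..T}" for t
      by (rule abs_inner_le_mult[OF C[OF that] C[OF that]])
    ultimately have "\<exists>N. negligible N \<and> (\<forall>t\<in>{0..T} - N. r t \<bullet> r t = 0)"
      by (intro nonneg_integral_le_0_imp_ae_0 borel_measurable_inner rm) auto
    then show ?thesis using that by auto
  qed
  define b2 :: "real \<Rightarrow> real^'l" where "b2 t = (\<chi> i. if \<nu> t $ i < 0 then - 1 else - cc t $ i)" for t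
  have b2m: "b2 \<in> borel_measurable (lebesgue_on {0..T})"
  proof (rule borel_measurable_cart)
    fix i
    note [measurable] = borel_measurable_cart_nth[OF \<nu>(1), of i] borel_measurable_cart_nth[OF cc(1), of i]
    show "(\<lambda>t. b2 t $ i) \<in> borel_measurable (lebesgue_on {0..T})"
      unfolding b2_def by simp measurable
  qed
  have b2c: "\<bar>b2 t $ i\<bar> \<le> B + 1" if "t \<in> {0..T}" for t i
    using constraint_nth_bound[OF that, of i] constraint_bound_nonneg by (auto simp: b2_def)
  have b2b: "norm (b2 t) \<le> of_nat CARD('l) * (B + 1)" if t: "t \<in> {0..T}" for t
    using order_trans[OF norm_le_l1_cart sum_bounded_above[OF b2c[OF t]]] by simp
  obtain \<mu> where \<mu>0: "\<And>t i. t \<in> {0..T} \<Longrightarrow> \<not> - \<delta> \<le> cc t $ i \<Longrightarrow> \<mu> t $ i = 0"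
    and \<mu>1: "\<And>t i. t \<in> {0..T} \<Longrightarrow> - \<delta> \<le> cc t $ i \<Longrightarrow> D t i \<bullet> (\<Sum>j\<in>UNIV. \<mu> t $ j *\<^sub>R D t j) = b2 t $ i"
    and \<mu>2: "(\<lambda>t. \<Sum>j\<in>UNIV. \<mu> t $ j *\<^sub>R D t j) \<in> borel_measurable (lebesgue_on {0..T})"
    "\<exists>C. \<forall>t\<in>{0..T}. norm (\<Sum>j\<in>UNIV. \<mu> t $ j *\<^sub>R D t j) \<le> C"
    by (rule gradient_system_solution[OF b2m b2b]) (assumption, (rule that; assumption))
  define v where "v t = (\<Sum>j\<in>UNIV. \<mu> t $ j *\<^sub>R D t j)" for t
  define h where "h t = (\<Sum>j\<in>UNIV. \<nu> t $ j * b2 t $ j)" for t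
  have vm: "v \<in> borel_measurable (lebesgue_on {0..T})" "\<exists>C. \<forall>t\<in>{0..T}. norm (v t) \<le> C"
    using \<mu>2 by (auto simp: v_def[abs_def])
  have qv: "q t \<bullet> v t = - h t" if t: "t \<in> {0..T} - N1" for t
  proof -
    have "q t = - (\<Sum>j\<in>UNIV. \<nu> t $ j *\<^sub>R D t j)"
      using N1(2)[OF t] by (simp add: r_def eq_neg_iff_add_eq_0)
    then have "q t \<bullet> v t = - (\<Sum>j\<in>UNIV. \<nu> t $ j * (D t j \<bullet> v t))"
      by (simp add: inner_sum_left)
    also have "(\<Sum>j\<in>UNIV. \<nu> t $ j * (D t j \<bullet> v t)) = h t"
      unfolding h_def
    proof (intro sum.cong refl)
      fix j show "\<nu> t $ j * (D t j \<bullet> v t) = \<nu> t $ j * b2 t $ j"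
        using \<nu>0[of t j] \<mu>1[of t j] t by (cases "- \<delta> \<le> cc t $ j") (auto simp: v_def)
    qed
    finally show ?thesis .
  qed
  \<comment> \<open>The product is - \<nu> j where \<nu> j is negative and - \<nu> j * cc j
    elsewhere. Both are non-negative, so a vanishing sum kills each of them: the former gives the
    sign, the latter complementarity.\<close>
  have hj: "\<nu> t $ j * b2 t $ j \<ge> 0" if "t \<in> {0..T}" for t j
    using cc(3)[OF that, of j] by (auto simp: b2_def mult_nonneg_nonpos)
  obtain N2 where N2: "negligible N2" "\<And>t. t \<in> {0..T} - N2 \<Longrightarrow> h t = 0"
  proof -
    have "0 \<le> integral {0..T} (\<lambda>t. q t \<bullet> v t)"
      using vm
    proof (rule opt')
      fix t i assume t: "t \<in> {0..T}" "- \<delta> \<le> cc t $ i"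
      show "cc t $ i + D t i \<bullet> v t \<le> 0"
        using \<mu>1[OF t] cc(3)[OF t(1), of i] by (simp add: v_def b2_def)
    qed
    also have "integral {0..T} (\<lambda>t. q t \<bullet> v t) = integral {0..T} (\<lambda>t. - h t)"
      by (rule integral_spike[OF N1(1)]) (simp add: qv)
    finally have "integral {0..T} h \<le> 0" by simp
    moreover have "\<bar>h t\<bar> \<le> of_nat CARD('l) * (of_nat CARD('l) * (B * Q) / \<epsilon>\<^sup>2 * (B + 1))" if t: "t \<in> {0..T}" for t
    proof -
      have "\<bar>h t\<bar> \<le> (\<Sum>j\<in>UNIV. \<bar>\<nu> t $ j * b2 t $ j\<bar>)" unfolding h_def by (rule sum_abs)
      also have "\<dots> \<le> of_nat CARD('l) * (of_nat CARD('l) * (B * Q) / \<epsilon>\<^sup>2 * (B + 1))"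
      proof (rule sum_bounded_above)
        fix j show "\<bar>\<nu> t $ j * b2 t $ j\<bar> \<le> of_nat CARD('l) * (B * Q) / \<epsilon>\<^sup>2 * (B + 1)"
          unfolding abs_mult using order_trans[OF component_le_norm_cart \<nu>(2)[OF t]] b2c[OF t] constraint_bound_nonneg
          by (intro mult_mono) (auto intro: order_trans[OF norm_ge_zero \<nu>(2)[OF t]])
      qed
      finally show ?thesis .
    qed
    moreover have "h \<in> borel_measurable (lebesgue_on {0..T})"
      unfolding h_def[abs_def] by (intro borel_measurable_sum borel_measurable_times borel_measurable_cart_nth \<nu> b2m)
    moreover have h_nn: "h t \<ge> 0" if "t \<in> {0..T}" for t
      using hj[OF that] by (simp add: h_def sum_nonneg)
    ultimately have "\<exists>N. negligible N \<and> (\<forall>t\<in>{0..T} - N. h t = 0)"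
      by (intro nonneg_integral_le_0_imp_ae_0) auto
    then show ?thesis using that by auto
  qed
  have hz: "\<nu> t $ j * b2 t $ j = 0" if t: "t \<in> {0..T} - (N1 \<union> N2)" for t j
  proof -
    have "(\<Sum>j\<in>UNIV. \<nu> t $ j * b2 t $ j) = 0" using N2(2)[of t] t by (auto simp: h_def)
    then show ?thesis using hj[of t] t by (subst (asm) sum_nonneg_eq_0_iff) auto
  qed
  show ?thesis
  proof (rule that[OF \<nu>])
    show "negligible (N1 \<union> N2)" using N1 N2 by simp
    fix t i assume t: "t \<in> {0..T} - (N1 \<union> N2)"
    show nn: "0 \<le> \<nu> t $ i" using hz[OF t, of i] by (auto simp: b2_def split: if_splits)
    show "\<nu> t $ i * cc t $ i = 0" using hz[OF t, of i] nn by (auto simp: b2_def split: if_splits)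
  next
    fix t assume t: "t \<in> {0..T} - (N1 \<union> N2)"
    then show "q t + (\<Sum>i\<in>UNIV. \<nu> t $ i *\<^sub>R D t i) = 0" using N1(2)[of t] by (simp add: r_def)
  qed
qed

end

section \<open>Change of time and crisis cost\<close>

lemma absolutely_continuous_on_subset:
  assumes "absolutely_continuous_on S f" "R \<subseteq> S"
  shows "absolutely_continuous_on R f"
  unfolding absolutely_continuous_on_def
proof (intro allI impI)
  fix e :: real assume "e > 0"
  with assms(1) obtain \<delta> where "\<delta> > 0" and \<delta>: "\<forall>D. D division_of \<Union>D \<and> \<Union>D \<subseteq> S \<and> (\<Sum>I\<in>D. Sup I - Inf I) < \<delta> \<longrightarrow>
        (\<Sum>I\<in>D. norm (f (Sup I) - f (Inf I))) < e"
    unfolding absolutely_continuous_on_def by blast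
  then show "\<exists>\<delta>>0. \<forall>D. D division_of \<Union>D \<and> \<Union>D \<subseteq> R \<and> (\<Sum>I\<in>D. Sup I - Inf I) < \<delta> \<longrightarrow>
        (\<Sum>I\<in>D. norm (f (Sup I) - f (Inf I))) < e"
    using assms(2) by (intro exI[of _ \<delta>]) (meson order_trans)
qed

text \<open>Perturbations are carried out on the integral equation, competitors have to be states in
  the sense of derivatives almost everywhere; this lemma and \<open>state_ofI\<close> are the two
  passages.\<close>

lemma state_ofD:
  assumes st: "state_of f x0 T u x"
  shows "continuous_on {0..T} x"
    and "t \<in> {0..T} \<Longrightarrow> ((\<lambda>t. f (x t, u t)) has_integral (x t - x0)) {0..t}"
proof -
  have ac: "absolutely_continuous_on {0..T} x" and x0: "x 0 = x0"
    and ae: "AE t in lebesgue_on {0<..<T}. (x has_vector_derivative f (x t, u t)) (at t)"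
    using st by (auto simp: state_of_def)
  show "continuous_on {0..T} x" by (rule absolutely_continuous_on_imp_continuous_on[OF ac])
  obtain N where N: "negligible N" "\<And>t. t \<in> {0<..<T} - N \<Longrightarrow> (x has_vector_derivative f (x t, u t)) (at t)"
    using ae by (subst (asm) AE_lebesgue_on_iff_negligible) auto
  assume t: "t \<in> {0..T}"
  have "((\<lambda>t. f (x t, u t)) has_integral (x t - x 0)) {0..t}"
    by (rule absolutely_continuous_on_has_integral[OF absolutely_continuous_on_subset[OF ac] _ N(1)])
      (use t N(2) in auto)
  then show "((\<lambda>t. f (x t, u t)) has_integral (x t - x0)) {0..t}" by (simp add: x0)
qed

lemma indefinite_integral_absolutely_continuous:
  fixes h :: "real \<Rightarrow> 'a::euclidean_space"
  assumes h: "h integrable_on {a..b}" "\<And>t. t \<in> {a..b} \<Longrightarrow> norm (h t) \<le> M" and "M \<ge> 0"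
    and x: "\<And>t. t \<in> {a..b} \<Longrightarrow> x t = x0 + integral {a..t} h"
  shows "absolutely_continuous_on {a..b} x"
    "\<exists>N. negligible N \<and> (\<forall>t\<in>{a<..<b} - N. (x has_vector_derivative h t) (at t))"
proof -
  have "M-lipschitz_on {a..b} x"
    using lipschitz_on_indefinite_integral[OF h \<open>M \<ge> 0\<close>] by (simp add: lipschitz_on_def x)
  then show "absolutely_continuous_on {a..b} x" by (rule lipschitz_on_imp_absolutely_continuous_on)
  obtain N where N: "negligible N"
    "\<And>t. t \<in> {a<..<b} - N \<Longrightarrow> ((\<lambda>t. integral {a..t} h) has_vector_derivative h t) (at t)"
    using indefinite_integral_has_vector_derivative_ae[OF h(1)] by blast
  have "(x has_vector_derivative h t) (at t)" if t: "t \<in> {a<..<b} - N" for t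
  proof (rule has_vector_derivative_transform_within_open)
    have "((\<lambda>t. x0 + integral {a..t} h) has_vector_derivative 0 + h t) (at t)"
      by (intro has_vector_derivative_add has_vector_derivative_const N(2) t)
    then show "((\<lambda>t. x0 + integral {a..t} h) has_vector_derivative h t) (at t)" by simp
    show "open {a<..<b}" "t \<in> {a<..<b}" using t by auto
    fix s assume "s \<in> {a<..<b}"
    then show "x0 + integral {a..s} h = x s" using x[of s] by simp
  qed
  with N(1) show "\<exists>N. negligible N \<and> (\<forall>t\<in>{a<..<b} - N. (x has_vector_derivative h t) (at t))" by blast
qed

lemma state_ofI:
  assumes "0 \<le> T" and h: "(\<lambda>t. f (x t, u t)) integrable_on {0..T}" "\<And>t. t \<in> {0..T} \<Longrightarrow> norm (f (x t, u t)) \<le> M"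
    and x: "\<And>t. t \<in> {0..T} \<Longrightarrow> x t = x0 + integral {0..t} (\<lambda>t. f (x t, u t))"
  shows "state_of f x0 T u x"
proof -
  have "M \<ge> 0" using order_trans[OF norm_ge_zero h(2)[of 0]] \<open>0 \<le> T\<close> by simp
  note ac = indefinite_integral_absolutely_continuous[OF h \<open>M \<ge> 0\<close> x]
  have "x 0 = x0" using x[of 0] \<open>0 \<le> T\<close> by simp
  moreover have "AE t in lebesgue_on {0<..<T}. (x has_vector_derivative f (x t, u t)) (at t)"
    using ac(2) by (subst AE_lebesgue_on_iff_negligible) auto
  ultimately show ?thesis using ac(1) unfolding state_of_def by blast
qed

text \<open>Running with speed k over an interval equals running with speed one over an interval k
  times as long. The factor stands inside the hypothesis because the perturbed dynamics has that
  form.\<close>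

lemma has_integral_affine_rescale:
  fixes h :: "real \<Rightarrow> 'a::real_normed_vector"
  assumes h: "((\<lambda>r. k *\<^sub>R h r) has_integral I) {a..b}" and "k > 0"
  shows "((\<lambda>r. h (a + (r - a') / k)) has_integral I) {a'..a' + k * (b - a)}"
proof -
  have "((\<lambda>r. (1 / k) *\<^sub>R (k *\<^sub>R h r)) has_integral (1 / k) *\<^sub>R I) {a..b}"
    by (rule has_integral_cmul[OF h])
  then have "(h has_integral (1 / k) *\<^sub>R I) (cbox a b)" using \<open>k > 0\<close> by simp
  from has_integral_affinity'[OF this, of "1 / k" "a - a' / k"] \<open>k > 0\<close>
  have "((\<lambda>r. h ((1 / k) *\<^sub>R r + (a - a' / k))) has_integral I)
    (cbox ((a - (a - a' / k)) /\<^sub>R (1 / k)) ((b - (a - a' / k)) /\<^sub>R (1 / k)))"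
    by simp
  moreover have "(1 / k) *\<^sub>R r + (a - a' / k) = a + (r - a') / k" for r
    by (simp add: diff_divide_distrib)
  moreover have "(a - (a - a' / k)) /\<^sub>R (1 / k) = a'" "(b - (a - a' / k)) /\<^sub>R (1 / k) = a' + k * (b - a)"
    using \<open>k > 0\<close> by (auto simp: field_simps)
  ultimately show ?thesis by (simp only: box_real)
qed

lemma borel_measurable_affine_rescale:
  fixes w :: "real \<Rightarrow> 'a::euclidean_space"
  assumes "w \<in> borel_measurable lebesgue" "k \<noteq> 0"
  shows "(\<lambda>t. w (a + k * t)) \<in> borel_measurable lebesgue"
proof -
  have "(\<lambda>t. a + k * t) \<in> lebesgue \<rightarrow>\<^sub>M lebesgue"
    using lebesgue_affine_measurable[where c = "\<lambda>x::real. k"] \<open>k \<noteq> 0\<close> by simp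
  from measurable_compose[OF this assms(1)] show ?thesis .
qed

text \<open>Slowing the process down by the factor \<open>\<tau>' / \<tau>\<close> before \<open>\<tau>\<close> and by \<open>(T - \<tau>') / (T - \<tau>)\<close>
  after it moves the time \<open>\<tau>\<close> to \<open>\<tau>'\<close> and keeps the end points.\<close>

lemma time_change:
  fixes f :: "(real^'n) \<times> (real^'m) \<Rightarrow> real^'n"
  assumes \<tau>: "0 < \<tau>" "\<tau> < T" "0 < \<tau>'" "\<tau>' < T"
    and w: "w \<in> admissible_controls U T"
    and growth: "\<And>x u. u \<in> U \<Longrightarrow> norm (f (x, u)) \<le> c1 * norm x + c2" and "0 < c1"
    and z: "continuous_on {0..T} z"
    and int: "(\<lambda>t. (if t < \<tau> then \<tau>' / \<tau> else (T - \<tau>') / (T - \<tau>)) *\<^sub>R f (z t, w t)) integrable_on {0..T}"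
    and zint: "\<And>t. t \<in> {0..T} \<Longrightarrow> z t = x0 + integral {0..t} (\<lambda>t. (if t < \<tau> then \<tau>' / \<tau> else (T - \<tau>') / (T - \<tau>)) *\<^sub>R f (z t, w t))"
  obtains u x where "u \<in> admissible_controls U T" "state_of f x0 T u x" "x T = z T" "continuous_on {0..T} x"
    "\<And>t. t \<in> {0..\<tau>'} \<Longrightarrow> \<exists>r\<in>{0..\<tau>}. x t = z r"
proof -
  define k1 where "k1 = \<tau>' / \<tau>"
  define k2 where "k2 = (T - \<tau>') / (T - \<tau>)"
  have k: "k1 > 0" "k2 > 0" using \<tau> by (auto simp: k1_def k2_def)
  have k1\<tau>: "k1 * \<tau> = \<tau>'" and k2\<tau>: "k2 * (T - \<tau>) = T - \<tau>'" using \<tau> by (auto simp: k1_def k2_def)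
  \<comment> \<open>The inverse of the time change: it maps the new time, with switch at \<tau>',
    back to the old one, with switch at \<tau>. The redundant zeros match the substitution rule for
    an interval starting at 0.\<close>
  define \<theta> where "\<theta> t = (if t < \<tau>' then 0 + (t - 0) / k1 else \<tau> + (t - \<tau>') / k2)" for t
  have \<theta>1: "\<theta> t = 0 + (t - 0) / k1" if "t \<le> \<tau>'" for t
    using that \<tau> by (auto simp: \<theta>_def k1_def)
  have \<theta>1_in: "\<theta> t \<in> {0..\<tau>}" if "t \<in> {0..\<tau>'}" for t
    using that k \<theta>1[of t] unfolding k1\<tau>[symmetric] by (simp add: pos_divide_le_eq mult.commute)
  have \<theta>2_in: "\<theta> t \<in> {\<tau>..T}" if "t \<in> {\<tau>'..T}" for t
    using that k k2\<tau> by (auto simp: \<theta>_def field_simps)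
  have \<theta>_in: "\<theta> t \<in> {0..T}" if "t \<in> {0..T}" for t
    using \<theta>1_in[of t] \<theta>2_in[of t] that \<tau> by (cases "t \<le> \<tau>'") auto
  define u where "u t = w (\<theta> t)" for t
  define x where "x t = z (\<theta> t)" for t
  define h where "h t = f (z t, w t)" for t
  define H where "H t = (if t < \<tau> then k1 else k2) *\<^sub>R h t" for t
  have H: "H integrable_on {0..T}" using int unfolding H_def[abs_def] h_def k1_def k2_def .
  have zH: "z t = x0 + integral {0..t} H" if "t \<in> {0..T}" for t
    using zint[OF that] unfolding H_def[abs_def] h_def k1_def k2_def .
  note seg = indefinite_integral_increment[OF H zH]
  have seg1: "((\<lambda>r. f (x r, u r)) has_integral (x t - x0)) {0..t}" if t: "t \<in> {0..\<tau>'}" for t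
  proof -
    have b: "\<theta> t \<in> {0..\<tau>}" by (rule \<theta>1_in[OF t])
    have "((\<lambda>r. k1 *\<^sub>R h r) has_integral (z (\<theta> t) - z 0)) {0..\<theta> t}"
      by (rule has_integral_spike[of "{\<tau>}", OF _ _ seg]) (use b \<tau> in \<open>auto simp: H_def\<close>)
    from has_integral_affine_rescale[OF this k(1), of 0]
    have "((\<lambda>r. h (0 + (r - 0) / k1)) has_integral (z (\<theta> t) - z 0)) {0..t}"
      using \<theta>1[of t] t k by simp
    moreover have "z 0 = x0" using zH[of 0] \<tau> by simp
    moreover have "h (0 + (r - 0) / k1) = f (x r, u r)" if "r \<in> {0..t}" for r
      using that t \<theta>1[of r] by (simp add: h_def x_def u_def)
    ultimately show ?thesis unfolding x_def[of t] by (metis (no_types, lifting) has_integral_eq)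
  qed
  have seg2: "((\<lambda>r. f (x r, u r)) has_integral (x t - x \<tau>')) {\<tau>'..t}" if t: "t \<in> {\<tau>'..T}" for t
  proof -
    have b: "\<theta> t \<in> {\<tau>..T}" by (rule \<theta>2_in[OF t])
    have e: "\<theta> \<tau>' = \<tau>" by (simp add: \<theta>_def)
    have "(H has_integral (z (\<theta> t) - z \<tau>)) {\<tau>..\<theta> t}"
      by (rule seg) (use b \<tau> in auto)
    moreover have "H r = k2 *\<^sub>R h r" if "r \<in> {\<tau>..\<theta> t}" for r using that by (simp add: H_def)
    ultimately have "((\<lambda>r. k2 *\<^sub>R h r) has_integral (z (\<theta> t) - z \<tau>)) {\<tau>..\<theta> t}"
      by (rule has_integral_eq[rotated])
    from has_integral_affine_rescale[OF this k(2), of \<tau>']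
    have "((\<lambda>r. h (\<tau> + (r - \<tau>') / k2)) has_integral (z (\<theta> t) - z \<tau>)) {\<tau>'..t}"
      using t k by (simp add: \<theta>_def)
    moreover have "h (\<tau> + (r - \<tau>') / k2) = f (x r, u r)" if "r \<in> {\<tau>'..t}" for r
      using that by (simp add: h_def x_def u_def \<theta>_def)
    ultimately show ?thesis unfolding x_def[of t] x_def[of \<tau>'] e by (metis (no_types, lifting) has_integral_eq)
  qed
  have xint: "((\<lambda>r. f (x r, u r)) has_integral (x t - x0)) {0..t}" if t: "t \<in> {0..T}" for t
  proof (cases "t \<le> \<tau>'")
    case False
    have "((\<lambda>r. f (x r, u r)) has_integral ((x \<tau>' - x0) + (x t - x \<tau>'))) {0..t}"
      using False t \<tau> by (intro has_integral_combine[of 0 \<tau>' t] seg1 seg2) auto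
    then show ?thesis by simp
  qed (use t seg1 in auto)
  have wU: "w t \<in> U" if "t \<in> {0..T}" for t using w that by (auto simp: admissible_controls_def)
  have uU: "u t \<in> U" if "t \<in> {0..T}" for t unfolding u_def by (intro wU \<theta>_in that)
  have adm: "u \<in> admissible_controls U T"
  proof -
    \<comment> \<open>Extended by zero, the control is measurable on the whole line, where it can be
      composed with an affine map.\<close>
    define W where "W t = (if t \<in> {0..T} then w t else 0)" for t
    have "W \<in> borel_measurable lebesgue"
      using w borel_measurable_if[of "{0..T}" w] by (simp add: admissible_controls_def W_def[abs_def])
    then have "(\<lambda>t. W (0 + (1 / k1) * t)) \<in> borel_measurable lebesgue" "(\<lambda>t. W ((\<tau> - \<tau>' / k2) + (1 / k2) * t)) \<in> borel_measurable lebesgue"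
      using k by (intro borel_measurable_affine_rescale; simp)+
    then have "(\<lambda>t. if t < \<tau>' then W (0 + (1 / k1) * t) else W ((\<tau> - \<tau>' / k2) + (1 / k2) * t)) \<in> borel_measurable lebesgue"
      by (intro measurable_If) auto
    then have "(\<lambda>t. if t < \<tau>' then W (0 + (1 / k1) * t) else W ((\<tau> - \<tau>' / k2) + (1 / k2) * t)) \<in> borel_measurable (lebesgue_on {0..T})"
      by (rule measurable_restrict_space1)
    also have "?this \<longleftrightarrow> u \<in> borel_measurable (lebesgue_on {0..T})"
    proof (rule measurable_cong)
      fix t assume "t \<in> space (lebesgue_on {0..T})"
      then have "t \<in> {0..T}" by simp
      have "(if t < \<tau>' then W (0 + (1 / k1) * t) else W ((\<tau> - \<tau>' / k2) + (1 / k2) * t)) = W (\<theta> t)"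
        by (simp add: \<theta>_def diff_divide_distrib algebra_simps)
      also have "\<dots> = u t" using \<theta>_in[OF \<open>t \<in> {0..T}\<close>] by (simp add: W_def u_def)
      finally show "(if t < \<tau>' then W (0 + (1 / k1) * t) else W ((\<tau> - \<tau>' / k2) + (1 / k2) * t)) = u t" .
    qed
    finally show ?thesis using uU by (simp add: admissible_controls_def)
  qed
  obtain Z where Z: "\<And>t. t \<in> {0..T} \<Longrightarrow> norm (z t) \<le> Z"
    using continuous_on_Icc_bounded[OF z] by blast
  have bd: "norm (f (x t, u t)) \<le> c1 * Z + c2" if "t \<in> {0..T}" for t
  proof -
    have "norm (f (x t, u t)) \<le> c1 * norm (x t) + c2" by (intro growth uU that)
    also have "\<dots> \<le> c1 * Z + c2" using Z[OF \<theta>_in[OF that]] \<open>0 < c1\<close> by (simp add: x_def)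
    finally show ?thesis .
  qed
  have st: "state_of f x0 T u x"
  proof (rule state_ofI[where M = "c1 * Z + c2"])
    show "(\<lambda>t. f (x t, u t)) integrable_on {0..T}" using xint[of T] \<tau> by auto
    show "x t = x0 + integral {0..t} (\<lambda>t. f (x t, u t))" if "t \<in> {0..T}" for t
      using integral_unique[OF xint[OF that]] by simp
  qed (use \<tau> bd in auto)
  show ?thesis
  proof (rule that[OF adm st])
    have "(T - \<tau>') / k2 = T - \<tau>" using k unfolding k2\<tau>[symmetric] by simp
    then show "x T = z T" using \<tau> by (simp add: x_def \<theta>_def)
    show "continuous_on {0..T} x" by (rule state_ofD(1)[OF st])
    show "\<exists>r\<in>{0..\<tau>}. x t = z r" if "t \<in> {0..\<tau>'}" for t
      using \<theta>1_in[OF that] by (auto simp: x_def)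
  qed
qed

section \<open>Crisis time of trajectories\<close>

lemma integral_indicator_Ioc:
  assumes "0 \<le> \<tau>" "\<tau> \<le> T"
  shows "(LINT t|lebesgue_on {0..T}. indicator {\<tau><..T} t) = T - \<tau>"
    "integrable (lebesgue_on {0..T}) (indicator {\<tau><..T} :: real \<Rightarrow> real)"
proof -
  have s: "{\<tau><..T} \<in> sets (lebesgue_on {0..T})"
    using assms by (subst sets_restrict_space_iff) auto
  have "{\<tau><..T} \<inter> space (lebesgue_on {0..T}) = {\<tau><..T}" using assms by auto
  moreover have "measure (lebesgue_on {0..T}) {\<tau><..T} = T - \<tau>"
    using assms by (subst measure_restrict_space) auto
  ultimately show "(LINT t|lebesgue_on {0..T}. indicator {\<tau><..T} t) = T - \<tau>"
    using s by simp
  have "emeasure (lebesgue_on {0..T}) {\<tau><..T} = emeasure lebesgue {\<tau><..T}"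
    using assms by (intro emeasure_restrict_space) auto
  then show "integrable (lebesgue_on {0..T}) (indicator {\<tau><..T} :: real \<Rightarrow> real)"
    using s assms by (intro integrable_real_indicator) auto
qed

text \<open>The estimate for competitors: after \<tau> nothing has to be known about them, since a
  return to \<open>K\<close> only lowers the cost.\<close>

lemma crisis_cost_le:
  assumes "closed K" and x: "continuous_on {0..T} x" and \<tau>: "0 \<le> \<tau>" "\<tau> \<le> T"
    and K: "\<And>t. t \<in> {0..\<tau>} \<Longrightarrow> x t \<in> K"
  shows "crisis_cost \<phi> K T x \<le> \<phi> (x T) + (T - \<tau>)"
proof -
  have xm: "x \<in> borel_measurable (lebesgue_on {0..T})"
    using x by (intro continuous_imp_measurable_on_sets_lebesgue) auto
  have "- K \<in> sets borel" using \<open>closed K\<close> by auto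
  then have m: "(\<lambda>t. indicator (- K) (x t) :: real) \<in> borel_measurable (lebesgue_on {0..T})"
    by (intro measurable_compose[OF xm] borel_measurable_indicator)
  have le: "indicator (- K) (x t) \<le> (indicator {\<tau><..T} t :: real)" if "t \<in> {0..T}" for t
    using K[of t] that by (cases "t \<le> \<tau>") (auto simp: indicator_def)
  have "integrable (lebesgue_on {0..T}) (\<lambda>t. indicator (- K) (x t) :: real)"
    by (rule Bochner_Integration.integrable_bound[OF integral_indicator_Ioc(2)[OF \<tau>] m])
      (use le in \<open>auto intro!: AE_I2\<close>)
  then have "(LINT t|lebesgue_on {0..T}. indicator (- K) (x t)) \<le> (LINT t|lebesgue_on {0..T}. (indicator {\<tau><..T} t :: real))"
    by (rule integral_mono[OF _ integral_indicator_Ioc(2)[OF \<tau>]]) (use le in auto)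
  then show ?thesis unfolding crisis_cost_def integral_indicator_Ioc(1)[OF \<tau>] by simp
qed

lemma crisis_cost_eq:
  assumes \<tau>: "0 \<le> \<tau>" "\<tau> \<le> T"
    and K: "\<And>t. t \<in> {0..\<tau>} \<Longrightarrow> x t \<in> K" "\<And>t. t \<in> {\<tau><..T} \<Longrightarrow> x t \<notin> K"
  shows "crisis_cost \<phi> K T x = \<phi> (x T) + (T - \<tau>)"
proof -
  have "(LINT t|lebesgue_on {0..T}. indicator (- K) (x t)) = (LINT t|lebesgue_on {0..T}. (indicator {\<tau><..T} t :: real))"
    using K by (intro Bochner_Integration.integral_cong) (auto simp: indicator_def)
  then show ?thesis unfolding crisis_cost_def integral_indicator_Ioc(1)[OF \<tau>] by simp
qed

text \<open>On \<delta>-active constraints the slack s \<kappa> absorbs the quadratic remainder; on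
  the others the distance \<delta> from zero absorbs the Lipschitz change. All constants are uniform
  in t, so one \<open>s0\<close> suffices.\<close>

lemma strictly_feasible_imp_feasible:
  fixes c :: "'b::euclidean_space \<Rightarrow> real^'l" and c' :: "'b \<Rightarrow> 'b \<Rightarrow>\<^sub>L (real^'l)"
  assumes c: "locally_quadratic_remainder c c'"
    and u: "\<And>t. t \<in> S \<Longrightarrow> norm (u t) \<le> B" "\<And>t i. t \<in> S \<Longrightarrow> c (u t) $ i \<le> 0"
    and v: "\<And>t. t \<in> S \<Longrightarrow> norm (v t) \<le> C"
    and "\<kappa> > 0" "\<delta> > 0"
    and strict: "\<And>t i. t \<in> S \<Longrightarrow> - \<delta> \<le> c (u t) $ i \<Longrightarrow> c (u t) $ i + c' (u t) (v t) $ i \<le> - \<kappa>"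
  shows "\<exists>s0>0. \<forall>s\<in>{0<..s0}. \<forall>t\<in>S. \<forall>i. c (u t + s *\<^sub>R v t) $ i \<le> 0"
proof -
  define C1 where "C1 = max C 1"
  have C1: "C1 > 0" by (simp add: C1_def)
  obtain L where "L > 0" and L: "\<And>x y. x \<in> cball 0 (B + C1) \<Longrightarrow> y \<in> cball 0 (B + C1) \<Longrightarrow>
        norm (c y - c x) \<le> L * norm (y - x) \<and> norm (c y - c x - c' x (y - x)) \<le> L * (norm (y - x))\<^sup>2"
    using c unfolding locally_quadratic_remainder_def by blast
  define s0 where "s0 = min 1 (min (\<kappa> / (L * C1\<^sup>2)) (\<delta> / (L * C1)))"
  show ?thesis
  proof (intro exI[of _ s0] conjI ballI allI)
    show "s0 > 0" using \<open>\<kappa> > 0\<close> \<open>\<delta> > 0\<close> \<open>L > 0\<close> C1 by (simp add: s0_def)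
    fix s t i assume s: "s \<in> {0<..s0}" and t: "t \<in> S"
    have s1: "0 < s" "s \<le> 1" using s by (auto simp: s0_def)
    have "s \<le> \<kappa> / (L * C1\<^sup>2)" using s by (simp add: s0_def)
    then have s2: "L * (s * C1)\<^sup>2 \<le> s * \<kappa>"
      using \<open>L > 0\<close> C1 s1 by (simp add: field_simps power2_eq_square)
    have "s \<le> \<delta> / (L * C1)" using s by (simp add: s0_def)
    then have s3: "L * (s * C1) \<le> \<delta>" using \<open>L > 0\<close> C1 s1 by (simp add: field_simps)
    have nv: "norm (s *\<^sub>R v t) \<le> s * C1" using v[OF t] s1 by (simp add: C1_def)
    also have "\<dots> \<le> C1" using s1 C1 by simp
    finally have b: "u t \<in> cball 0 (B + C1)" "u t + s *\<^sub>R v t \<in> cball 0 (B + C1)"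
      using u(1)[OF t] C1 norm_triangle_ineq[of "u t" "s *\<^sub>R v t"] by auto
    note LL = L[OF b]
    show "c (u t + s *\<^sub>R v t) $ i \<le> 0"
    proof (cases "- \<delta> \<le> c (u t) $ i")
      case True
      let ?e = "c (u t + s *\<^sub>R v t) - c (u t) - c' (u t) (s *\<^sub>R v t)"
      have "?e $ i \<le> norm ?e" using component_le_norm_cart[of ?e i] by simp
      also have "\<dots> \<le> L * (norm (s *\<^sub>R v t))\<^sup>2" using LL by simp
      also have "\<dots> \<le> L * (s * C1)\<^sup>2" using nv \<open>L > 0\<close> by (intro mult_left_mono power_mono) auto
      also have "\<dots> \<le> s * \<kappa>" by (rule s2)
      finally have "c (u t + s *\<^sub>R v t) $ i \<le> c (u t) $ i + s * (c' (u t) (v t) $ i) + s * \<kappa>"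
        by (simp add: blinfun.scaleR_right)
      \<comment> \<open>A convex combination of the present value, which is non-positive, and the
        linearized value, which has slack \<kappa>.\<close>
      also have "\<dots> = (1 - s) * c (u t) $ i + s * (c (u t) $ i + c' (u t) (v t) $ i + \<kappa>)"
        by (simp add: algebra_simps)
      also have "\<dots> \<le> 0"
      proof (intro add_nonpos_nonpos)
        show "(1 - s) * c (u t) $ i \<le> 0" using s1 u(2)[OF t, of i] by (intro mult_nonneg_nonpos) auto
        show "s * (c (u t) $ i + c' (u t) (v t) $ i + \<kappa>) \<le> 0"
          using s1 strict[OF t True] by (intro mult_nonneg_nonpos) auto
      qed
      finally show ?thesis .
    next
      case False
      let ?e = "c (u t + s *\<^sub>R v t) - c (u t)"
      have "?e $ i \<le> norm ?e" using component_le_norm_cart[of ?e i] by simp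
      also have "\<dots> \<le> L * norm (s *\<^sub>R v t)" using LL by simp
      also have "\<dots> \<le> L * (s * C1)" using nv \<open>L > 0\<close> by (intro mult_left_mono) auto
      also have "\<dots> \<le> \<delta>" by (rule s3)
      finally show ?thesis using False by simp
    qed
  qed
qed

text \<open>Perturbed states are known only up to a second-order error, so the decrease has to hold
  for every z that close to the line x + s y. Applied to \<phi> at the final time and to g at the
  crossing time.\<close>

lemma derivative_imp_descent:
  fixes F :: "'a::real_normed_vector \<Rightarrow> real"
  assumes F: "(F has_derivative F') (at x)" and "F' y < d" and "C \<ge> 0"
  shows "\<exists>s0>0. \<forall>s\<in>{0<..s0}. \<forall>z. norm (z - x - s *\<^sub>R y) \<le> C * s\<^sup>2 \<longrightarrow> F z < F x + s * d"
proof -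
  interpret F': bounded_linear F' using F by (rule has_derivative_bounded_linear)
  obtain K where K: "K > 0" "\<And>h. norm (F' h) \<le> norm h * K" using F'.pos_bounded by blast
  \<comment> \<open>One third of the gap pays for the remainder of the derivative, one for the
    second-order error of z, and the last keeps the inequality strict.\<close>
  define \<eta> where "\<eta> = (d - F' y) / 3"
  have "\<eta> > 0" using assms by (simp add: \<eta>_def)
  define M where "M = norm y + C + 1"
  have "M > 0" using assms by (auto simp: M_def intro: add_nonneg_pos)
  have "\<eta> / M > 0" using \<open>\<eta> > 0\<close> \<open>M > 0\<close> by simp
  then obtain r where "r > 0" and r: "\<And>z. norm (z - x) < r \<Longrightarrow> norm (F z - F x - F' (z - x)) \<le> \<eta> / M * norm (z - x)"
    using F unfolding has_derivative_at_alt by blast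
  define s0 where "s0 = min 1 (min (r / (2 * M)) (\<eta> / (K * (C + 1))))"
  show ?thesis
  proof (intro exI[of _ s0] conjI ballI allI impI)
    show "s0 > 0" using \<open>r > 0\<close> \<open>M > 0\<close> \<open>\<eta> > 0\<close> K \<open>C \<ge> 0\<close> by (simp add: s0_def)
    fix s z assume s: "s \<in> {0<..s0}" and z: "norm (z - x - s *\<^sub>R y) \<le> C * s\<^sup>2"
    have s1: "0 < s" "s \<le> 1" using s by (auto simp: s0_def)
    have "s \<le> r / (2 * M)" using s by (simp add: s0_def)
    then have s2: "s * M < r" using \<open>M > 0\<close> \<open>r > 0\<close> by (simp add: field_simps)
    have "s \<le> \<eta> / (K * (C + 1))" using s by (simp add: s0_def)
    moreover have "K * (C + 1) > 0" using K \<open>C \<ge> 0\<close> by simp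
    ultimately have s3: "s * (K * (C + 1)) \<le> \<eta>" by (simp only: pos_le_divide_eq)
    have ss: "C * s\<^sup>2 \<le> C * s" using s1 \<open>C \<ge> 0\<close> by (intro mult_left_mono) (auto simp: power2_eq_square)
    have "norm (z - x) \<le> norm (s *\<^sub>R y) + norm (z - x - s *\<^sub>R y)"
      by (rule norm_triangle_sub)
    also have "\<dots> \<le> s * norm y + C * s" using z ss s1 by simp
    also have "\<dots> \<le> s * M" using s1 by (simp add: M_def algebra_simps)
    finally have n: "norm (z - x) \<le> s * M" .
    then have "norm (F z - F x - F' (z - x)) \<le> \<eta> / M * norm (z - x)" using s2 by (intro r) simp
    also have "\<dots> \<le> \<eta> / M * (s * M)" using n \<open>\<eta> / M > 0\<close> by (intro mult_left_mono) auto
    also have "\<dots> = s * \<eta>" using \<open>M > 0\<close> by simp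
    finally have 1: "F z \<le> F x + F' (z - x) + s * \<eta>" by (simp add: abs_le_iff)
    have "F' (z - x) = s * F' y + F' (z - x - s *\<^sub>R y)"
      by (simp add: F'.diff F'.scaleR)
    also have "F' (z - x - s *\<^sub>R y) \<le> norm (z - x - s *\<^sub>R y) * K"
      using K(2)[of "z - x - s *\<^sub>R y"] by simp
    also have "\<dots> \<le> C * s\<^sup>2 * K" using z K by (intro mult_right_mono) auto
    also have "\<dots> \<le> s * (s * (K * (C + 1)))"
      using s1 K by (simp add: power2_eq_square algebra_simps)
    also have "\<dots> \<le> s * \<eta>" using s3 s1 by (intro mult_left_mono) auto
    finally have "F z \<le> F x + s * (F' y + 2 * \<eta>)" using 1 by (simp add: algebra_simps)
    also have "\<dots> < F x + s * d" 
    proof -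
      have "F' y + 2 * \<eta> < d" using \<open>F' y < d\<close> by (simp add: \<eta>_def field_simps)
      then show ?thesis using s1 by simp
    qed
    finally show "F z < F x + s * d" .
  qed
qed

text \<open>The mean value theorem reduces the claim to the sign of \<open>g'\<close> along the velocity, so no chain
  rule for the absolutely continuous function \<open>g \<circ> z\<close> is needed.\<close>

lemma transversal_imp_increasing:
  fixes f :: "'a::euclidean_space \<times> 'b::euclidean_space \<Rightarrow> 'a" and g :: "'a \<Rightarrow> real" and g' :: "'a \<Rightarrow> 'a \<Rightarrow>\<^sub>L real"
  assumes g: "\<And>x. (g has_derivative blinfun_apply (g' x)) (at x)" "continuous_on UNIV g'"
    and f: "continuous_on UNIV f" and pos: "g' x (f (x, u)) > 0"
  shows "\<exists>r>0. \<forall>(a::real) b z w N k. a \<le> b \<longrightarrow> negligible N \<longrightarrow> z a \<in> ball x r \<longrightarrow> z b \<in> ball x r \<longrightarrow>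
     (\<forall>t\<in>{a..b} - N. z t \<in> ball x r \<and> w t \<in> ball u r \<and> k t \<ge> 0) \<longrightarrow>
     ((\<lambda>t. k t *\<^sub>R f (z t, w t)) has_integral (z b - z a)) {a..b} \<longrightarrow> g (z a) \<le> g (z b)"
proof -
  \<comment> \<open>The gradient is taken at an intermediate point of the mean value theorem, the
    velocity at a point of the trajectory, so the two state arguments are kept independent. Joint
    continuity then gives a common radius; the divisor 3 below counts the arguments.\<close>
  define G where "G = (\<lambda>p. g' (fst p) (f (fst (snd p), snd (snd p))))"
  have "continuous_on UNIV G" unfolding G_def
    by (intro continuous_intros continuous_on_compose2[OF g(2)] continuous_on_compose2[OF f]) auto
  then have "open (G -` {0<..})" by (auto intro: continuous_open_vimage simp: continuous_on_open_vimage)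
  moreover have "(x, x, u) \<in> G -` {0<..}" using pos by (simp add: G_def)
  ultimately obtain e where "e > 0" and e: "ball (x, x, u) e \<subseteq> G -` {0<..}" by (metis openE)
  define r where "r = e / 3"
  have "r > 0" using \<open>e > 0\<close> by (simp add: r_def)
  have G_pos: "g' \<zeta> (f (y, w)) > 0" if "\<zeta> \<in> ball x r" "y \<in> ball x r" "w \<in> ball u r" for \<zeta> y w
  proof -
    have "dist (x, x, u) (\<zeta>, y, w) \<le> dist x \<zeta> + (dist x y + dist u w)"
      unfolding dist_Pair_Pair
      by (intro order_trans[OF sqrt_sum_squares_le_sum] add_left_mono) (auto intro: sqrt_sum_squares_le_sum)
    then have "(\<zeta>, y, w) \<in> ball (x, x, u) e" using that by (simp add: r_def)
    then show ?thesis using e by (auto simp: G_def)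
  qed
  show ?thesis
  proof (intro exI[of _ r] conjI allI impI)
    show "r > 0" by fact
    fix a b z w N k
    assume ab: "a \<le> b" and N: "negligible N" and zab: "z a \<in> ball x r" "z b \<in> ball x r"
      and near: "\<forall>t\<in>{a..b} - N. z t \<in> ball x r \<and> w t \<in> ball u r \<and> k t \<ge> (0::real)"
      and int: "((\<lambda>t. k t *\<^sub>R f (z t, w t)) has_integral (z b - z a)) {a..b::real}"
    have D: "((\<lambda>l. g (z a + l *\<^sub>R (z b - z a))) has_derivative (\<lambda>h. g' (z a + l *\<^sub>R (z b - z a)) (h *\<^sub>R (z b - z a)))) (at l)" for l
      by (rule has_derivative_compose[OF _ g(1)]) (auto intro!: derivative_eq_intros)
    have d: "((\<lambda>l. g (z a + l *\<^sub>R (z b - z a))) has_real_derivative g' (z a + l *\<^sub>R (z b - z a)) (z b - z a)) (at l)" for l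
    proof -
      have "(\<lambda>h. g' (z a + l *\<^sub>R (z b - z a)) (h *\<^sub>R (z b - z a))) = (*) (g' (z a + l *\<^sub>R (z b - z a)) (z b - z a))"
        by (simp add: fun_eq_iff blinfun.scaleR_right)
      then show ?thesis using D[of l] by (simp only: has_field_derivative_def)
    qed
    obtain l where l: "0 < l" "l < 1"
      "g (z a + 1 *\<^sub>R (z b - z a)) - g (z a + 0 *\<^sub>R (z b - z a)) = (1 - 0) * g' (z a + l *\<^sub>R (z b - z a)) (z b - z a)"
      using MVT2[of 0 1 "\<lambda>l. g (z a + l *\<^sub>R (z b - z a))" "\<lambda>l. g' (z a + l *\<^sub>R (z b - z a)) (z b - z a)"] d by auto
    define \<zeta> where "\<zeta> = z a + l *\<^sub>R (z b - z a)"
    have "\<zeta> = (1 - l) *\<^sub>R z a + l *\<^sub>R z b" by (simp add: \<zeta>_def algebra_simps)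
    then have \<zeta>: "\<zeta> \<in> ball x r" using convexD[OF convex_ball zab, of "1 - l" l] l by simp
    have "((blinfun_apply (g' \<zeta>) \<circ> (\<lambda>t. k t *\<^sub>R f (z t, w t))) has_integral g' \<zeta> (z b - z a)) {a..b}"
      by (rule has_integral_linear[OF int]) (rule blinfun.bounded_linear_right)
    \<comment> \<open>Truncation changes the integrand at most on N and makes it non-negative
      everywhere, as monotonicity of the integral demands.\<close>
    then have "((\<lambda>t. max 0 (g' \<zeta> (k t *\<^sub>R f (z t, w t)))) has_integral g' \<zeta> (z b - z a)) {a..b}"
    proof (rule has_integral_spike[OF N, rotated])
      fix t assume "t \<in> {a..b} - N"
      then have "0 \<le> k t * g' \<zeta> (f (z t, w t))" using near G_pos[OF \<zeta>, of "z t" "w t"] by auto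
      then show "max 0 (g' \<zeta> (k t *\<^sub>R f (z t, w t))) = (blinfun_apply (g' \<zeta>) \<circ> (\<lambda>t. k t *\<^sub>R f (z t, w t))) t"
        by (simp add: blinfun.scaleR_right)
    qed
    then have "g' \<zeta> (z b - z a) \<ge> 0" by (rule has_integral_nonneg) simp
    then show "g (z a) \<le> g (z b)" using l by (simp add: \<zeta>_def)
  qed
qed

section \<open>Adjoint states and descent directions\<close>

text \<open>For L the derivative of f at (x, u), the transposed partial derivative in x applied to
  p, that is, the gradient in x of the Hamiltonian. The companion \<open>adjoint_snd\<close> is the
  same for u.\<close>

definition adjoint_fst :: "(('a::euclidean_space \<times> 'b::euclidean_space) \<Rightarrow>\<^sub>L 'c::euclidean_space) \<Rightarrow> 'c \<Rightarrow> 'a" where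
  "adjoint_fst L p = (\<Sum>b\<in>Basis. (p \<bullet> L (b, 0)) *\<^sub>R b)"

definition adjoint_snd :: "(('a::euclidean_space \<times> 'b::euclidean_space) \<Rightarrow>\<^sub>L 'c::euclidean_space) \<Rightarrow> 'c \<Rightarrow> 'b" where
  "adjoint_snd L p = (\<Sum>b\<in>Basis. (p \<bullet> L (0, b)) *\<^sub>R b)"

lemma linear_eq_sum_Basis:
  fixes l :: "'a::euclidean_space \<Rightarrow> real"
  assumes "linear l"
  shows "(\<Sum>b\<in>Basis. l b *\<^sub>R b) \<bullet> h = l h"
proof -
  have "l h = l (\<Sum>b\<in>Basis. (h \<bullet> b) *\<^sub>R b)" by (simp add: euclidean_representation)
  also have "\<dots> = (\<Sum>b\<in>Basis. (h \<bullet> b) * l b)"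
    using assms by (simp add: linear_sum linear_scale)
  finally show ?thesis by (simp add: inner_sum_left mult.commute inner_commute[of h])
qed

lemma adjoint_fst_inner:
  fixes L :: "('a::euclidean_space \<times> 'b::euclidean_space) \<Rightarrow>\<^sub>L ('c::euclidean_space)"
  shows "adjoint_fst L p \<bullet> h = p \<bullet> L (h, 0)"
proof -
  have "linear (\<lambda>h. p \<bullet> L (h, 0))"
  proof (rule linearI)
    fix x y :: 'a and r :: real
    have "(x + y, 0) = (x, 0) + (y, 0 :: 'b)" "(r *\<^sub>R x, 0) = r *\<^sub>R (x, 0 :: 'b)" by simp_all
    then show "p \<bullet> L (x + y, 0) = p \<bullet> L (x, 0) + p \<bullet> L (y, 0)" "p \<bullet> L (r *\<^sub>R x, 0) = r *\<^sub>R (p \<bullet> L (x, 0))"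
      by (simp_all only: blinfun.add_right blinfun.scaleR_right inner_add_right inner_scaleR_right real_scaleR_def)
  qed
  then show ?thesis unfolding adjoint_fst_def by (rule linear_eq_sum_Basis)
qed

lemma adjoint_snd_inner:
  fixes L :: "('a::euclidean_space \<times> 'b::euclidean_space) \<Rightarrow>\<^sub>L ('c::euclidean_space)"
  shows "adjoint_snd L p \<bullet> h = p \<bullet> L (0, h)"
proof -
  have "linear (\<lambda>h. p \<bullet> L (0, h))"
  proof (rule linearI)
    fix x y :: 'b and r :: real
    have "(0, x + y) = (0, x) + (0 :: 'a, y)" "(0, r *\<^sub>R x) = r *\<^sub>R (0 :: 'a, x)" by simp_all
    then show "p \<bullet> L (0, x + y) = p \<bullet> L (0, x) + p \<bullet> L (0, y)" "p \<bullet> L (0, r *\<^sub>R x) = r *\<^sub>R (p \<bullet> L (0, x))"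
      by (simp_all only: blinfun.add_right blinfun.scaleR_right inner_add_right inner_scaleR_right real_scaleR_def)
  qed
  then show ?thesis unfolding adjoint_snd_def by (rule linear_eq_sum_Basis)
qed

lemma norm_le_of_inner_self:
  fixes a :: "'a::real_inner"
  assumes "a \<bullet> a \<le> M * norm a"
  shows "norm a \<le> M \<or> a = 0"
  using assms by (auto simp: power2_norm_eq_inner[symmetric] power2_eq_square)

lemma norm_adjoint_fst: "norm (adjoint_fst L p) \<le> norm L * norm p"
proof -
  let ?a = "adjoint_fst L p"
  have "?a \<bullet> ?a \<le> norm p * norm (L (?a, 0))" unfolding adjoint_fst_inner by (rule norm_cauchy_schwarz)
  also have "\<dots> \<le> norm p * (norm L * norm ?a)"
    using norm_blinfun[of L "(?a, 0)"] by (intro mult_left_mono) auto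
  finally show ?thesis using norm_le_of_inner_self[of ?a "norm L * norm p"] by (auto simp: mult_ac)
qed

lemma norm_adjoint_snd: "norm (adjoint_snd L p) \<le> norm L * norm p"
proof -
  let ?a = "adjoint_snd L p"
  have "?a \<bullet> ?a \<le> norm p * norm (L (0, ?a))" unfolding adjoint_snd_inner by (rule norm_cauchy_schwarz)
  also have "\<dots> \<le> norm p * (norm L * norm ?a)"
    using norm_blinfun[of L "(0, ?a)"] by (intro mult_left_mono) auto
  finally show ?thesis using norm_le_of_inner_self[of ?a "norm L * norm p"] by (auto simp: mult_ac)
qed

lemma adjoint_linear:
  "adjoint_fst L (p - q) = adjoint_fst L p - adjoint_fst L q"
  "adjoint_fst L (p + q) = adjoint_fst L p + adjoint_fst L q"
  "adjoint_fst L (k *\<^sub>R p) = k *\<^sub>R adjoint_fst L p"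
  "adjoint_snd L (p + q) = adjoint_snd L p + adjoint_snd L q"
  "adjoint_snd L (k *\<^sub>R p) = k *\<^sub>R adjoint_snd L p"
  by (auto simp: adjoint_fst_def adjoint_snd_def inner_diff_left inner_add_left scaleR_diff_left scaleR_add_left
      sum_subtractf sum.distrib scaleR_sum_right)

lemma continuous_on_adjoint:
  assumes "continuous_on UNIV F"
  shows "continuous_on UNIV (\<lambda>w. adjoint_fst (F (fst w)) (snd w))"
    "continuous_on UNIV (\<lambda>w. adjoint_snd (F (fst w)) (snd w))"
  unfolding adjoint_fst_def adjoint_snd_def
  by (intro continuous_intros continuous_on_compose2[OF assms]; simp)+

text \<open>In the derivative of P \<bullet> y the two terms with the state derivative cancel,
  leaving P \<bullet> h; since y starts at 0, integrating up to b leaves only the terminal product.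
  The end b is free because the functional at the final time and the one at the crossing time need
  adjoint states on different intervals.\<close>

lemma adjoint_state:
  fixes f' :: "'a::euclidean_space \<times> 'b::euclidean_space \<Rightarrow> ('a \<times> 'b) \<Rightarrow>\<^sub>L 'a"
    and T B :: real and p1 :: 'a
  assumes f': "continuous_on UNIV f'" and x: "continuous_on {0..T} x"
    and u: "u \<in> borel_measurable (lebesgue_on {0..T})" "\<And>t. t \<in> {0..T} \<Longrightarrow> norm (u t) \<le> B"
    and b: "0 \<le> b" "b \<le> T"
  shows "\<exists>P C N. P b = p1 \<and> C-lipschitz_on {0..b} P \<and> negligible N \<and>
    (\<forall>t\<in>{0<..<b} - N. (P has_vector_derivative - adjoint_fst (f' (x t, u t)) (P t)) (at t)) \<and>
    (\<forall>y h. linearized_solution (\<lambda>t. f' (x t, u t)) T h y \<longrightarrow> ((\<lambda>t. P t \<bullet> h t) has_integral (p1 \<bullet> y b)) {0..b})"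
proof -
  define A where "A t p = adjoint_fst (f' (x t, u t)) p" for t p
  obtain L where "L > 0" and L: "\<And>t. t \<in> {0..T} \<Longrightarrow> norm (f' (x t, u t)) \<le> L"
    using bounded_along_trajectory[where u = u, OF f' x u(2)] by blast
  have A_bd: "norm (A t p) \<le> L * norm p" if "t \<in> {0..T}" for t p
    unfolding A_def using norm_adjoint_fst[of "f' (x t, u t)" p] L[OF that]
    by (meson mult_right_mono norm_ge_zero order_trans)
  have xb: "continuous_on {0..b} x" and ub: "u \<in> borel_measurable (lebesgue_on {0..b})"
    using b by (auto intro: continuous_on_subset[OF x] measurable_restrict_mono[OF u(1)])
  have Am: "(\<lambda>t. A t (P t)) \<in> borel_measurable (lebesgue_on {0..b})" if P: "continuous_on {0..b} P" for P
    unfolding A_def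
    using borel_measurable_compose_Pair[OF continuous_on_adjoint(1)[OF f']
        borel_measurable_Pair[OF continuous_on_Icc_borel_measurable_lebesgue[OF xb] ub]
        continuous_on_Icc_borel_measurable_lebesgue[OF P]] by simp
  have A_bdP: "\<exists>M. \<forall>t\<in>{0..b}. norm (A t (P t)) \<le> M" if P: "continuous_on {0..b} P" for P
  proof -
    obtain M where M: "\<And>t. t \<in> {0..b} \<Longrightarrow> norm (P t) \<le> M"
      using continuous_on_Icc_bounded[OF P] by blast
    have "norm (A t (P t)) \<le> L * M" if "t \<in> {0..b}" for t
    proof -
      have "norm (A t (P t)) \<le> L * norm (P t)" using that b by (intro A_bd) auto
      also have "\<dots> \<le> L * M" using M[OF that] \<open>L > 0\<close> by simp
      finally show ?thesis .
    qed
    then show ?thesis by blast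
  qed
  have Aint: "(\<lambda>t. A t (P t)) integrable_on {0..b}" if P: "continuous_on {0..b} P" for P
    using A_bdP[OF P] bounded_measurable_integrable_on[OF Am[OF P]] by blast
  have Alip: "norm (A t p - A t q) \<le> L * norm (p - q)" if "t \<in> {0..b}" for t p q
    using A_bd[of t "p - q"] that b by (simp add: A_def adjoint_linear)
  obtain P where P: "continuous_on {0..b} P"
    "\<And>t. t \<in> {0..b} \<Longrightarrow> P t = p1 + integral {t..b} (\<lambda>s. A s (P s))"
    using caratheodory_exists_backward[OF b(1) \<open>L > 0\<close> Aint Alip, of p1] by blast
  obtain M0 where M0: "\<And>t. t \<in> {0..b} \<Longrightarrow> norm (A t (P t)) \<le> M0" using A_bdP[OF P(1)] by blast
  have "M0 \<ge> 0" using order_trans[OF norm_ge_zero M0[of 0]] b by simp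
  have nint: "(\<lambda>t. - A t (P t)) integrable_on {0..b}" using Aint[OF P(1)] by (simp add: integrable_neg)
  have Pf: "P t = P 0 + integral {0..t} (\<lambda>s. - A s (P s))" if t: "t \<in> {0..b}" for t
  proof -
    have I: "integral {0..t} (\<lambda>s. A s (P s)) + integral {t..b} (\<lambda>s. A s (P s)) = integral {0..b} (\<lambda>s. A s (P s))"
      using t by (intro Henstock_Kurzweil_Integration.integral_combine Aint P) auto
    have P0: "P 0 = p1 + integral {0..b} (\<lambda>s. A s (P s))" using P(2)[of 0] b by simp
    have "P t + integral {0..t} (\<lambda>s. A s (P s)) = P 0"
      unfolding P0 P(2)[OF t] I[symmetric] by (simp add: add_ac)
    then show ?thesis by (simp add: algebra_simps)
  qed
  have Pb: "P b = p1" using P(2)[of b] b by simp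
  have lip: "M0-lipschitz_on {0..b} P"
  proof -
    have l: "M0-lipschitz_on {0..b} (\<lambda>t. integral {0..t} (\<lambda>s. - A s (P s)))"
      by (rule lipschitz_on_indefinite_integral[OF nint _ \<open>M0 \<ge> 0\<close>]) (use M0 in auto)
    have "dist (P s) (P t) \<le> M0 * dist s t" if "s \<in> {0..b}" "t \<in> {0..b}" for s t
      unfolding Pf[OF that(1)] Pf[OF that(2)] dist_add_cancel by (rule lipschitz_onD[OF l that])
    then show ?thesis using \<open>M0 \<ge> 0\<close> by (intro lipschitz_onI)
  qed
  obtain N where N: "negligible N" "\<And>t. t \<in> {0<..<b} - N \<Longrightarrow> (P has_vector_derivative - A t (P t)) (at t)"
    using indefinite_integral_absolutely_continuous(2)[OF nint _ \<open>M0 \<ge> 0\<close> Pf] M0 by auto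
  have dual: "((\<lambda>t. P t \<bullet> h t) has_integral (p1 \<bullet> y b)) {0..b}"
    if lin: "linearized_solution (\<lambda>t. f' (x t, u t)) T h y" for y h
  proof -
    have i: "(\<lambda>t. f' (x t, u t) (y t, 0) + h t) integrable_on {0..T}"
      and y: "\<And>t. t \<in> {0..T} \<Longrightarrow> y t = integral {0..t} (\<lambda>t. f' (x t, u t) (y t, 0) + h t)"
      using lin unfolding linearized_solution_def by blast+
    from lin obtain M where M: "\<And>t. t \<in> {0..T} \<Longrightarrow> norm (f' (x t, u t) (y t, 0) + h t) \<le> M"
      unfolding linearized_solution_def by blast
    have y0: "y 0 = 0" using y[of 0] b by simp
    have "((\<lambda>t. - A t (P t) \<bullet> y t + P t \<bullet> (f' (x t, u t) (y t, 0) + h t)) has_integral (P b \<bullet> y b - P 0 \<bullet> y 0)) {0..b}"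
    proof (rule has_integral_inner_parts[OF b(1) nint, where B = "max M0 M"])
      show "(\<lambda>t. f' (x t, u t) (y t, 0) + h t) integrable_on {0..b}"
        using b by (intro integrable_on_subinterval[OF i]) auto
      show "norm (- A t (P t)) \<le> max M0 M" if "t \<in> {0..b}" for t using M0[OF that] by simp
      show "norm (f' (x t, u t) (y t, 0) + h t) \<le> max M0 M" if "t \<in> {0..b}" for t using M[of t] that b by auto
      show "y t = y 0 + integral {0..t} (\<lambda>t. f' (x t, u t) (y t, 0) + h t)" if "t \<in> {0..b}" for t
        unfolding y0 using y[of t] that b by simp
    qed (rule Pf)
    moreover have "- A t (P t) \<bullet> y t + P t \<bullet> (f' (x t, u t) (y t, 0) + h t) = P t \<bullet> h t" for t
      by (simp add: A_def adjoint_fst_inner inner_add_right)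
    ultimately show ?thesis by (simp add: y0 Pb)
  qed
  show ?thesis
  proof (intro exI[of _ P] exI[of _ M0] exI[of _ N] conjI ballI allI impI)
    show "(P has_vector_derivative - adjoint_fst (f' (x t, u t)) (P t)) (at t)" if "t \<in> {0<..<b} - N" for t
      using N(2)[OF that] unfolding A_def .
    show "((\<lambda>t. P t \<bullet> h t) has_integral (p1 \<bullet> y b)) {0..b}"
      if "linearized_solution (\<lambda>t. f' (x t, u t)) T h y" for y h by (rule dual[OF that])
  qed (fact Pb lip N(1))+
qed

lemma borel_measurable_rho: "rho T \<tau> \<in> borel_measurable (lebesgue_on S)"
proof -
  have "rho T \<tau> \<in> borel_measurable lebesgue"
    unfolding rho_def[abs_def] by (intro borel_measurable_const measurable_If) auto
  then show ?thesis by (rule measurable_restrict_space1)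
qed

lemma abs_rho_le:
  assumes "0 < \<tau>" "\<tau> < T"
  shows "\<bar>rho T \<tau> t\<bar> \<le> max (1 / \<tau>) (1 / (T - \<tau>))"
  using assms by (auto simp: rho_def)

text \<open>The time \<tau> is included for the state but excluded for the control, whose value
  there may differ from its left limit.\<close>

lemma left_neighbourhood:
  fixes x :: "real \<Rightarrow> 'a::metric_space" and w :: "real \<Rightarrow> 'b::metric_space"
  assumes x: "continuous_on {0..T} x" and \<tau>: "0 < \<tau>" "\<tau> < T" and w: "(w \<longlongrightarrow> l) (at_left \<tau>)" and "r > 0"
  shows "\<exists>a. 0 \<le> a \<and> a < \<tau> \<and> (\<forall>t\<in>{a..\<tau>}. dist (x t) (x \<tau>) < r) \<and> (\<forall>t\<in>{a..<\<tau>}. dist (w t) l < r)"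
proof -
  have "\<tau> \<in> {0..T}" using \<tau> by auto
  then obtain d1 where "d1 > 0" and d1: "\<And>t. t \<in> {0..T} \<Longrightarrow> dist t \<tau> < d1 \<Longrightarrow> dist (x t) (x \<tau>) < r"
    using x \<open>r > 0\<close> unfolding continuous_on_iff by blast
  have "\<forall>\<^sub>F t in at_left \<tau>. dist (w t) l < r"
    using w \<open>r > 0\<close> by (rule tendstoD)
  then obtain d2 where "d2 < \<tau>" and d2: "\<And>t. d2 < t \<Longrightarrow> t < \<tau> \<Longrightarrow> dist (w t) l < r"
    by (auto simp: eventually_at_left_field)
  define a where "a = max (\<tau> - d1 / 2) (max ((d2 + \<tau>) / 2) 0)"
  have a: "0 \<le> a" "a < \<tau>" using \<open>d1 > 0\<close> \<open>d2 < \<tau>\<close> \<tau> by (auto simp: a_def)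
  moreover have "dist (x t) (x \<tau>) < r" if "t \<in> {a..\<tau>}" for t
    using that a \<tau> \<open>d1 > 0\<close> by (intro d1) (auto simp: a_def dist_real_def)
  moreover have "dist (w t) l < r" if "t \<in> {a..<\<tau>}" for t
    using that a \<open>d2 < \<tau>\<close> by (intro d2) (auto simp: a_def)
  ultimately show ?thesis by blast
qed

text \<open>The perturbed process need not cross the boundary of \<open>K\<close> at the rescaled time: if
  \<open>g (z \<tau>) \<le> 0\<close>, transversality keeps \<open>z\<close> in \<open>K\<close> up to \<open>\<tau>\<close>, and the crisis lasts at most \<open>T - \<tau>'\<close>. The
  inequality \<open>g' (x \<tau>) (y \<tau>) < 0\<close> thus replaces an equality constraint.\<close>

lemma no_descent_direction:
  fixes f :: "(real^'n) \<times> (real^'m) \<Rightarrow> real^'n" and f' :: "(real^'n) \<times> (real^'m) \<Rightarrow> ((real^'n) \<times> (real^'m)) \<Rightarrow>\<^sub>L (real^'n)"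
    and g' :: "real^'n \<Rightarrow> (real^'n) \<Rightarrow>\<^sub>L real" and T \<tau> \<sigma> B :: real
  assumes \<tau>: "0 < \<tau>" "\<tau> < T"
    and contf: "continuous_on UNIV f"
    and f: "locally_quadratic_remainder f f'"
    and growth: "\<And>x u. u \<in> U \<Longrightarrow> norm (f (x, u)) \<le> c1 * norm x + c2" and "0 < c1"
    and K: "closed K" "K = {x. g x \<le> 0}"
    and \<phi>: "(\<phi> has_derivative \<phi>') (at (x T))"
    and g: "\<And>x. (g has_derivative blinfun_apply (g' x)) (at x)" "continuous_on UNIV g'" "C1_function g"
    and min: "\<And>u z. u \<in> admissible_controls U T \<Longrightarrow> state_of f x0 T u z \<Longrightarrow> crisis_cost \<phi> K T x \<le> crisis_cost \<phi> K T z"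
    and x: "continuous_on {0..T} x" "\<And>t. t \<in> {0..T} \<Longrightarrow> x t = x0 + integral {0..t} (\<lambda>t. f (x t, u t))"
    and u: "u \<in> borel_measurable (lebesgue_on {0..T})" "\<And>t. t \<in> {0..T} \<Longrightarrow> norm (u t) \<le> B"
    and N: "negligible N" "\<And>t. t \<in> {0..T} - N \<Longrightarrow> u t = ubar t"
    and u_minus: "(ubar \<longlongrightarrow> u_minus) (at_left \<tau>)" and pos: "g' (x \<tau>) (f (x \<tau>, u_minus)) > 0"
    and gx: "\<And>t. t \<in> {0..<\<tau>} \<Longrightarrow> g (x t) < 0" "g (x \<tau>) = 0" "\<And>t. t \<in> {\<tau><..T} \<Longrightarrow> g (x t) > 0"
    and v: "v \<in> borel_measurable (lebesgue_on {0..T})" "\<And>t. t \<in> {0..T} \<Longrightarrow> norm (v t) \<le> B"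
    and feas: "\<exists>s0>0. \<forall>s\<in>{0<..s0}. \<forall>t\<in>{0..T}. u t + s *\<^sub>R v t \<in> U"
    and y: "linearized_solution (\<lambda>t. f' (x t, u t)) T
      (\<lambda>t. f' (x t, u t) (0, v t) + (\<sigma> * rho T \<tau> t) *\<^sub>R f (x t, u t)) y"
    and descent: "\<phi>' (y T) < \<sigma>" "g' (x \<tau>) (y \<tau>) < 0"
  shows False
proof -
  have "0 < T" using \<tau> by simp
  have B0: "B \<ge> 0" using order_trans[OF norm_ge_zero u(2)[of 0]] \<open>0 < T\<close> by simp
  have rhom: "(\<lambda>t. \<sigma> * rho T \<tau> t) \<in> borel_measurable (lebesgue_on {0..T})"
    by (intro borel_measurable_times borel_measurable_const borel_measurable_rho)
  define B' where "B' = max B (\<bar>\<sigma>\<bar> * max (1 / \<tau>) (1 / (T - \<tau>)))"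
  have rhob: "\<bar>\<sigma> * rho T \<tau> t\<bar> \<le> B'" for t
  proof -
    have "\<bar>\<sigma>\<bar> * \<bar>rho T \<tau> t\<bar> \<le> \<bar>\<sigma>\<bar> * max (1 / \<tau>) (1 / (T - \<tau>))"
      by (intro mult_left_mono abs_rho_le \<tau>) simp
    then show ?thesis unfolding B'_def abs_mult by simp
  qed
  have ub: "norm (u t) \<le> B'" and vb: "norm (v t) \<le> B'" if "t \<in> {0..T}" for t
    using u(2)[OF that] v(2)[OF that] by (auto simp: B'_def)
  obtain C s0 where "0 < s0" "0 < C" and ex: "\<And>s. s \<in> {0<..s0} \<Longrightarrow> \<exists>z. continuous_on {0..T} z \<and>
    (\<lambda>t. (1 + s * (\<sigma> * rho T \<tau> t)) *\<^sub>R f (z t, u t + s *\<^sub>R v t)) integrable_on {0..T} \<and>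
    (\<forall>t\<in>{0..T}. z t = x0 + integral {0..t} (\<lambda>t. (1 + s * (\<sigma> * rho T \<tau> t)) *\<^sub>R f (z t, u t + s *\<^sub>R v t))) \<and>
    (\<forall>t\<in>{0..T}. norm (z t - x t) \<le> C * s \<and> norm (z t - x t - s *\<^sub>R y t) \<le> C * s\<^sup>2)"
    by (rule perturbed_state[OF contf f x u(1) ub v(1) vb rhom rhob y \<open>0 < T\<close>]) (assumption+, (rule that; assumption))
  obtain s1 where "s1 > 0" and s1: "\<And>s t. s \<in> {0<..s1} \<Longrightarrow> t \<in> {0..T} \<Longrightarrow> u t + s *\<^sub>R v t \<in> U"
    using feas by blast
  obtain s2 where "s2 > 0" and s2: "\<And>s z. s \<in> {0<..s2} \<Longrightarrow> norm (z - x T - s *\<^sub>R y T) \<le> C * s\<^sup>2 \<Longrightarrow> \<phi> z < \<phi> (x T) + s * \<sigma>"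
    using derivative_imp_descent[OF \<phi> descent(1) less_imp_le[OF \<open>0 < C\<close>]] by blast
  obtain s3 where "s3 > 0" and s3: "\<And>s z. s \<in> {0<..s3} \<Longrightarrow> norm (z - x \<tau> - s *\<^sub>R y \<tau>) \<le> C * s\<^sup>2 \<Longrightarrow> g z < g (x \<tau>) + s * 0"
    using derivative_imp_descent[OF g(1) descent(2) less_imp_le[OF \<open>0 < C\<close>]] by blast
  obtain r where "r > 0" and r: "\<forall>(a::real) b z w N k. a \<le> b \<longrightarrow> negligible N \<longrightarrow> z a \<in> ball (x \<tau>) r \<longrightarrow> z b \<in> ball (x \<tau>) r \<longrightarrow>
     (\<forall>t\<in>{a..b} - N. z t \<in> ball (x \<tau>) r \<and> w t \<in> ball u_minus r \<and> k t \<ge> 0) \<longrightarrow>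
     ((\<lambda>t. k t *\<^sub>R f (z t, w t)) has_integral (z b - z a)) {a..b} \<longrightarrow> g (z a) \<le> g (z b)"
    using transversal_imp_increasing[where f = f and g = g and g' = g' and x = "x \<tau>" and u = u_minus, OF g(1,2) contf pos]
    by (elim exE conjE) (rule that; assumption)
  have "r / 2 > 0" using \<open>r > 0\<close> by simp
  from left_neighbourhood[OF x(1) \<tau> u_minus this]
  obtain a where a: "0 \<le> a" "a < \<tau>" and near_x: "\<And>t. t \<in> {a..\<tau>} \<Longrightarrow> dist (x t) (x \<tau>) < r / 2"
    and near_u: "\<And>t. t \<in> {a..<\<tau>} \<Longrightarrow> dist (ubar t) u_minus < r / 2" by blast
  have contg: "continuous_on UNIV g"
    by (rule has_derivative_imp_continuous_on_UNIV[OF g(1)])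
  have "continuous_on {0..a} (\<lambda>t. g (x t))"
    using a \<tau> by (intro continuous_on_compose2[OF contg] continuous_on_subset[OF x(1)]) auto
  then obtain m where m: "m \<in> {0..a}" "\<And>t. t \<in> {0..a} \<Longrightarrow> g (x t) \<le> g (x m)"
    using continuous_attains_sup[of "{0..a}" "\<lambda>t. g (x t)"] a by auto
  \<comment> \<open>On [0, a] the unperturbed trajectory stays at depth \<mu> inside
    \<open>K\<close> by compactness, so a small uniform perturbation cannot leave \<open>K\<close>
    there; only [a, \<tau>] requires transversality.\<close>
  define \<mu> where "\<mu> = - g (x m)"
  have "\<mu> > 0" using gx(1)[of m] m(1) a by (simp add: \<mu>_def)
  obtain R where R: "\<And>t. t \<in> {0..T} \<Longrightarrow> norm (x t) \<le> R"
    using continuous_on_Icc_bounded[OF x(1)] by blast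
  obtain Lg where "Lg > 0" and Lg: "\<And>z w. z \<in> cball 0 (R + 1) \<Longrightarrow> w \<in> cball 0 (R + 1) \<Longrightarrow> norm (g w - g z) \<le> Lg * norm (w - z)"
    using C1_function_lipschitz_on_cball[OF g(3), of "R + 1"] by blast
  define \<rho>0 where "\<rho>0 = min \<tau> (T - \<tau>)"
  have "\<rho>0 > 0" using \<tau> by (simp add: \<rho>0_def)
  \<comment> \<open>The bounds \<open>s0\<close> to \<open>s3\<close> give the perturbed state,
    feasibility, and descent of \<phi> and g. The others bound C s by 1 (staying in the ball where
    \<open>Lg\<close> is valid), \<open>Lg * (C * s)\<close> by \<mu>, both C s and s B by r / 2
    (the other half of r is taken by the unperturbed process), and |s \<sigma>| by \<rho>0, so that
    \<tau>' lies in (0, T).\<close>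
  define s where "s = min (min (min s0 s1) (min s2 s3))
    (min (min (1 / C) (\<mu> / (Lg * C))) (min (min (r / (3 * C)) (r / (3 * (B + 1)))) (\<rho>0 / (2 * (\<bar>\<sigma>\<bar> + 1)))))"
  have s_pos: "s > 0"
    using \<open>0 < s0\<close> \<open>0 < s1\<close> \<open>0 < s2\<close> \<open>0 < s3\<close> \<open>0 < C\<close> \<open>0 < \<mu>\<close> \<open>0 < Lg\<close> \<open>0 < r\<close> B0 \<open>0 < \<rho>0\<close>
    by (simp add: s_def)
  have s_le: "s \<le> s0" "s \<le> s1" "s \<le> s2" "s \<le> s3" "s \<le> 1 / C" "s \<le> \<mu> / (Lg * C)" "s \<le> r / (3 * C)"
    "s \<le> r / (3 * (B + 1))" "s \<le> \<rho>0 / (2 * (\<bar>\<sigma>\<bar> + 1))"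
    unfolding s_def by (simp_all only: min_le_iff_disj order_refl simp_thms)
  have s_in: "s \<in> {0<..s0}" "s \<in> {0<..s1}" "s \<in> {0<..s2}" "s \<in> {0<..s3}"
    using s_pos s_le by auto
  have sC1: "C * s \<le> 1"
  proof -
    have "s \<le> 1 / C" by (fact s_le)
    then show ?thesis using \<open>0 < C\<close> by (simp add: field_simps)
  qed
  have sC\<mu>: "Lg * (C * s) \<le> \<mu>"
  proof -
    have "s \<le> \<mu> / (Lg * C)" by (fact s_le)
    then show ?thesis using \<open>0 < C\<close> \<open>0 < Lg\<close> by (simp add: field_simps)
  qed
  have sCr: "C * s < r / 2"
  proof -
    have "s \<le> r / (3 * C)" by (fact s_le)
    then have "3 * (C * s) \<le> r" using \<open>0 < C\<close> by (simp add: field_simps)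
    then show ?thesis using \<open>0 < r\<close> by simp
  qed
  have sBr: "s * B < r / 2"
  proof -
    have "s \<le> r / (3 * (B + 1))" by (fact s_le)
    then have "3 * (s * B) + 3 * s \<le> r" using B0 by (simp add: field_simps)
    then show ?thesis using \<open>0 < r\<close> s_pos by simp
  qed
  have s\<sigma>: "\<bar>s * \<sigma>\<bar> < \<rho>0"
  proof -
    have "s \<le> \<rho>0 / (2 * (\<bar>\<sigma>\<bar> + 1))" by (fact s_le)
    then have "s * (2 * (\<bar>\<sigma>\<bar> + 1)) \<le> \<rho>0" by (subst (asm) pos_le_divide_eq) auto
    then have "2 * (s * \<bar>\<sigma>\<bar>) + 2 * s \<le> \<rho>0" by (simp add: algebra_simps)
    moreover have "s * \<bar>\<sigma>\<bar> \<ge> 0" using s_pos by simp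
    ultimately have "s * \<bar>\<sigma>\<bar> < \<rho>0" using s_pos by linarith
    then show ?thesis using s_pos by (simp add: abs_mult)
  qed
  define \<tau>' where "\<tau>' = \<tau> + s * \<sigma>"
  have \<tau>': "0 < \<tau>'" "\<tau>' < T" using s\<sigma> by (auto simp: \<tau>'_def \<rho>0_def abs_less_iff)
  define k where "k t = (if t < \<tau> then \<tau>' / \<tau> else (T - \<tau>') / (T - \<tau>))" for t
  \<comment> \<open>This identity explains the values of \<open>rho\<close>: they are the
    first-order changes of the two speeds when \<tau> moves to \<tau> + s \<sigma> and the end
    points stay.\<close>
  have k_eq: "1 + s * (\<sigma> * rho T \<tau> t) = k t" for t
    using \<tau> by (simp add: k_def rho_def \<tau>'_def field_simps)
  have k0: "k t \<ge> 0" for t using \<tau> \<tau>' by (auto simp: k_def)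
  define w where "w t = u t + s *\<^sub>R v t" for t
  obtain z where z: "continuous_on {0..T} z"
    and zi: "(\<lambda>t. k t *\<^sub>R f (z t, w t)) integrable_on {0..T}"
    and ze: "\<And>t. t \<in> {0..T} \<Longrightarrow> z t = x0 + integral {0..t} (\<lambda>t. k t *\<^sub>R f (z t, w t))"
    and zc: "\<And>t. t \<in> {0..T} \<Longrightarrow> norm (z t - x t) \<le> C * s" "\<And>t. t \<in> {0..T} \<Longrightarrow> norm (z t - x t - s *\<^sub>R y t) \<le> C * s\<^sup>2"
    using ex[OF s_in(1), unfolded k_eq, folded w_def] by blast
  have w: "w \<in> admissible_controls U T"
    unfolding admissible_controls_def
  proof (intro CollectI conjI ballI)
    show "w \<in> borel_measurable (lebesgue_on {0..T})"
      unfolding w_def[abs_def] by (intro borel_measurable_add borel_measurable_scaleR borel_measurable_const u v)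
    show "w t \<in> U" if "t \<in> {0..T}" for t unfolding w_def by (rule s1[OF s_in(2) that])
  qed
  have gz\<tau>: "g (z \<tau>) < 0" using s3[OF s_in(4) zc(2)[of \<tau>]] \<tau> gx(2) by simp
  \<comment> \<open>Up to a, closeness to the unperturbed trajectory suffices; from a to \<tau>, g
    does not exceed its value at the end \<tau>, which is negative.\<close>
  have zK: "g (z t) \<le> 0" if t: "t \<in> {0..\<tau>}" for t
  proof (cases "t \<le> a")
    case True
    have tT: "t \<in> {0..T}" using t \<tau> by auto
    have "norm (z t) \<le> norm (x t) + norm (z t - x t)" by (rule norm_triangle_sub)
    then have "norm (g (z t) - g (x t)) \<le> Lg * norm (z t - x t)"
      using R[OF tT] zc(1)[OF tT] sC1 by (intro Lg) auto
    also have "\<dots> \<le> Lg * (C * s)" using zc(1)[OF tT] \<open>0 < Lg\<close> by (intro mult_left_mono) auto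
    finally have "g (z t) - g (x t) \<le> \<mu>" using sC\<mu> by simp
    then show ?thesis using m(2)[of t] t True by (simp add: \<mu>_def)
  next
    case False
    have near_z: "z t' \<in> ball (x \<tau>) r" if t': "t' \<in> {a..\<tau>}" for t'
    proof -
      have "dist (x \<tau>) (z t') \<le> dist (x \<tau>) (x t') + dist (x t') (z t')" by (rule dist_triangle)
      moreover have "dist (x t') (z t') \<le> C * s" using zc(1)[of t'] t' a \<tau> by (auto simp: dist_norm norm_minus_commute)
      moreover have "dist (x \<tau>) (x t') < r / 2" using near_x[OF t'] by (simp add: dist_commute)
      ultimately show ?thesis using sCr by simp
    qed
    have near_w: "w t' \<in> ball u_minus r" if t': "t' \<in> {a..<\<tau>} - N" for t'
    proof -
      have tT: "t' \<in> {0..T}" using t' a \<tau> by auto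
      have "dist u_minus (w t') \<le> dist u_minus (u t') + dist (u t') (w t')" by (rule dist_triangle)
      moreover have "dist (u t') (w t') \<le> s * B" using v(2)[OF tT] s_pos by (simp add: dist_norm w_def)
      moreover have "dist u_minus (u t') < r / 2" using near_u[of t'] N(2)[of t'] t' tT by (simp add: dist_commute)
      ultimately show ?thesis using sBr by simp
    qed
    have "g (z t) \<le> g (z \<tau>)"
    proof (rule r[rule_format, of t \<tau> "insert \<tau> N" z w k])
      show "z t' \<in> ball (x \<tau>) r \<and> w t' \<in> ball u_minus r \<and> 0 \<le> k t'" if "t' \<in> {t..\<tau>} - insert \<tau> N" for t'
        using near_z[of t'] near_w[of t'] k0 False that by auto
      show "((\<lambda>t. k t *\<^sub>R f (z t, w t)) has_integral (z \<tau> - z t)) {t..\<tau>}" 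
        by (rule indefinite_integral_increment[OF zi ze]) (use t \<tau> in auto)
      show "z t \<in> ball (x \<tau>) r" "z \<tau> \<in> ball (x \<tau>) r" using False t a by (intro near_z; simp)+
    qed (use t N in auto)
    then show ?thesis using gz\<tau> by simp
  qed
  obtain u' x' where x': "u' \<in> admissible_controls U T" "state_of f x0 T u' x'" "x' T = z T" "continuous_on {0..T} x'"
    "\<And>t. t \<in> {0..\<tau>'} \<Longrightarrow> \<exists>r\<in>{0..\<tau>}. x' t = z r"
    by (rule time_change[OF \<tau> \<tau>' w growth \<open>0 < c1\<close> z zi[unfolded k_def] ze[unfolded k_def]]) (assumption+, (rule that; assumption))
  have "crisis_cost \<phi> K T x' \<le> \<phi> (x' T) + (T - \<tau>')"
  proof (rule crisis_cost_le[OF K(1) x'(4)])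
    fix t assume "t \<in> {0..\<tau>'}"
    from x'(5)[OF this] show "x' t \<in> K" using zK by (auto simp: K(2))
  qed (use \<tau>' in auto)
  \<comment> \<open>The shift changes the crisis time by - s \<sigma>, which exactly offsets the
    change allowed for \<phi>.\<close>
  also have "\<phi> (x' T) < \<phi> (x T) + s * \<sigma>"
    unfolding x'(3) using zc(2)[of T] \<open>0 < T\<close> by (intro s2[OF s_in(3)]) auto
  also have "\<phi> (x T) + s * \<sigma> + (T - \<tau>') = \<phi> (x T) + (T - \<tau>)" by (simp add: \<tau>'_def)
  also have "\<dots> = crisis_cost \<phi> K T x"
  proof (rule crisis_cost_eq[symmetric])
    show "x t \<in> K" if "t \<in> {0..\<tau>}" for t using gx(1)[of t] gx(2) that by (cases "t = \<tau>") (auto simp: K(2) intro: less_imp_le)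
    show "x t \<notin> K" if "t \<in> {\<tau><..T}" for t using gx(3)[OF that] by (simp add: K(2))
  qed (use \<tau> in auto)
  finally show False using min[OF x'(1,2)] by simp
qed

section \<open>Necessary conditions along the trajectory\<close>

lemma gradient_eq_sum_Basis:
  fixes F :: "'a::euclidean_space \<Rightarrow> real"
  assumes F: "(F has_derivative F') (at x)"
  shows "gradient F x = (\<Sum>b\<in>Basis. F' b *\<^sub>R b)"
proof (rule gradient_eqI)
  have "linear F'" using has_derivative_bounded_linear[OF F] by (rule bounded_linear.linear)
  then have "h \<bullet> (\<Sum>b\<in>Basis. F' b *\<^sub>R b) = F' h" for h
    using linear_eq_sum_Basis[of F' h] by (simp only: inner_commute)
  then show "GDERIV F x :> (\<Sum>b\<in>Basis. F' b *\<^sub>R b)" unfolding gderiv_def using F by simp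
qed

lemma gradient_inner:
  fixes F :: "'a::euclidean_space \<Rightarrow> real"
  assumes F: "(F has_derivative F') (at x)"
  shows "gradient F x \<bullet> h = F' h"
  unfolding gradient_eq_sum_Basis[OF F]
  using has_derivative_bounded_linear[OF F] by (intro linear_eq_sum_Basis bounded_linear.linear)

lemma gradient_hamiltonian:
  fixes f :: "(real^'n) \<times> (real^'m) \<Rightarrow> real^'n"
  assumes "(f has_derivative blinfun_apply L) (at (x, u))"
  shows "gradient (\<lambda>x. hamiltonian f x p u) x = adjoint_fst L p"
proof -
  have "((\<lambda>x. f (x, u)) has_derivative (\<lambda>h. L (h, 0))) (at x)"
    by (rule has_derivative_compose[where f = "\<lambda>x. (x, u)", OF _ assms]) (auto intro!: derivative_eq_intros)
  then have "((\<lambda>x. hamiltonian f x p u) has_derivative (\<lambda>h. p \<bullet> L (h, 0))) (at x)"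
    unfolding hamiltonian_def by (rule has_derivative_inner_right)
  from gradient_eq_sum_Basis[OF this] show ?thesis by (simp add: adjoint_fst_def)
qed

lemma gradient_augmented_hamiltonian:
  fixes f :: "(real^'n) \<times> (real^'m) \<Rightarrow> real^'n" and c :: "real^'m \<Rightarrow> real^'l"
  assumes f: "(f has_derivative blinfun_apply L) (at (x, u))" and c: "(c has_derivative c') (at u)"
  shows "gradient (\<lambda>u. augmented_hamiltonian f c x p u \<nu>) u
    = adjoint_snd L p + (\<Sum>i\<in>UNIV. \<nu> $ i *\<^sub>R gradient (\<lambda>u. c u $ i) u)"
proof -
  have "((\<lambda>u. f (x, u)) has_derivative (\<lambda>h. L (0, h))) (at u)"
    by (rule has_derivative_compose[where f = "\<lambda>u. (x, u)", OF _ f]) (auto intro!: derivative_eq_intros)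
  then have "((\<lambda>u. augmented_hamiltonian f c x p u \<nu>) has_derivative (\<lambda>h. p \<bullet> L (0, h) + \<nu> \<bullet> c' h)) (at u)"
    unfolding augmented_hamiltonian_def by (intro has_derivative_add has_derivative_inner_right c)
  note g = gradient_inner[OF this]
  have gi: "gradient (\<lambda>u. c u $ i) u \<bullet> h = c' h $ i" for i h
    by (rule gradient_inner) (rule bounded_linear.has_derivative[OF bounded_linear_vec_nth c])
  have "gradient (\<lambda>u. augmented_hamiltonian f c x p u \<nu>) u \<bullet> h
    = (adjoint_snd L p + (\<Sum>i\<in>UNIV. \<nu> $ i *\<^sub>R gradient (\<lambda>u. c u $ i) u)) \<bullet> h" for h
    by (simp add: g inner_add_left adjoint_snd_inner inner_sum_left gi) (simp add: inner_vec_def)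
  then have "\<forall>h. gradient (\<lambda>u. augmented_hamiltonian f c x p u \<nu>) u \<bullet> h
    = (adjoint_snd L p + (\<Sum>i\<in>UNIV. \<nu> $ i *\<^sub>R gradient (\<lambda>u. c u $ i) u)) \<bullet> h" by (rule allI)
  then show ?thesis by (rule vector_eq_rdot[THEN iffD1])
qed

text \<open>Since the quadrant is unbounded in both directions, both coefficients of a separating
  functional are non-negative; since its vertex is the origin, the functional is non-negative on
  S.\<close>

lemma convex_avoids_negative_quadrant:
  fixes S :: "(real \<times> real) set"
  assumes "convex S" "S \<noteq> {}" and avoid: "\<And>a b. (a, b) \<in> S \<Longrightarrow> \<not> (a < 0 \<and> b < 0)"
  shows "\<exists>\<alpha> \<gamma>. 0 \<le> \<alpha> \<and> 0 \<le> \<gamma> \<and> (\<alpha>, \<gamma>) \<noteq> (0, 0) \<and> (\<forall>(a, b)\<in>S. 0 \<le> \<alpha> * a + \<gamma> * b)"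
proof -
  define Q where "Q = {..<0::real} \<times> {..<0::real}"
  have "convex Q" unfolding Q_def by (intro convex_Times) auto
  moreover have "(-1, -1) \<in> Q" by (simp add: Q_def)
  then have "Q \<noteq> {}" by blast
  moreover have "Q \<inter> S = {}" using avoid by (auto simp: Q_def)
  ultimately obtain w \<beta> where "w \<noteq> 0" and wQ: "\<forall>x\<in>Q. w \<bullet> x \<le> \<beta>" and wS: "\<forall>x\<in>S. \<beta> \<le> w \<bullet> x"
    using separating_hyperplane_sets[of Q S] assms(1,2) by blast
  obtain \<alpha> \<gamma> where w: "w = (\<alpha>, \<gamma>)" by (cases w)
  have Q: "\<alpha> * a + \<gamma> * b \<le> \<beta>" if "a < 0" "b < 0" for a b
    using wQ that by (auto simp: Q_def w)
  have nn: "0 \<le> k" if k: "\<And>a b. a < 0 \<Longrightarrow> b < 0 \<Longrightarrow> k * a + l * b \<le> \<beta>" for k l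
  proof (rule ccontr)
    assume "\<not> 0 \<le> k"
    then have "k < 0" by simp
    \<comment> \<open>Multiplied by k, this point gives |\<beta>| + |l| + 1, too much for the bound
      \<beta> even after adding - l.\<close>
    have "(\<bar>\<beta>\<bar> + \<bar>l\<bar> + 1) / k < 0" using \<open>k < 0\<close> by (intro divide_pos_neg) auto
    from k[OF this, of "-1"] show False using \<open>k < 0\<close> by simp
  qed
  have \<alpha>: "0 \<le> \<alpha>" using nn[of \<alpha> \<gamma>] Q by blast
  have \<gamma>: "0 \<le> \<gamma>" using nn[of \<gamma> \<alpha>] Q by (simp add: add.commute)
  have "\<beta> \<ge> 0"
  proof (rule ccontr)
    assume "\<not> \<beta> \<ge> 0"
    \<comment> \<open>Near the vertex: at (-e, -e) the functional has the value \<beta> + e.\<close>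
    define e where "e = - \<beta> / (\<alpha> + \<gamma> + 1)"
    have "e > 0" unfolding e_def using \<open>\<not> \<beta> \<ge> 0\<close> \<alpha> \<gamma> by (intro divide_pos_pos) auto
    then have "- (e * (\<alpha> + \<gamma>)) \<le> \<beta>" using Q[of "- e" "- e"] by (simp add: algebra_simps)
    moreover have "e * (\<alpha> + \<gamma> + 1) = - \<beta>" using \<alpha> \<gamma> by (simp add: e_def)
    then have "e * (\<alpha> + \<gamma>) + e = - \<beta>" by (simp add: algebra_simps)
    ultimately show False using \<open>e > 0\<close> by linarith
  qed
  have "0 \<le> \<alpha> * a + \<gamma> * b" if "(a, b) \<in> S" for a b
  proof -
    have "\<beta> \<le> w \<bullet> (a, b)" using wS that by blast
    then show ?thesis using \<open>\<beta> \<ge> 0\<close> by (simp add: w)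
  qed
  moreover have "(\<alpha>, \<gamma>) \<noteq> (0, 0)" using \<open>w \<noteq> 0\<close> by (simp add: w zero_prod_def)
  ultimately show ?thesis using \<alpha> \<gamma> by blast
qed

text \<open>The adjoint states P and R depend on the trajectory alone and are fixed before the
  separation; \<alpha> and \<gamma>, known only afterwards, combine them. The control u satisfies
  its hypotheses at every t, and \<open>ubar\<close> enters only through its left limit at
  \<tau>.\<close>

lemma multipliers_along_trajectory:
  fixes f :: "(real^'n) \<times> (real^'m) \<Rightarrow> real^'n" and f' :: "(real^'n) \<times> (real^'m) \<Rightarrow> ((real^'n) \<times> (real^'m)) \<Rightarrow>\<^sub>L (real^'n)"
    and g' :: "real^'n \<Rightarrow> (real^'n) \<Rightarrow>\<^sub>L real" and c :: "real^'m \<Rightarrow> real^'l" and c' :: "real^'m \<Rightarrow> (real^'m) \<Rightarrow>\<^sub>L (real^'l)"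
    and T \<tau> B \<delta> \<epsilon> :: real
  assumes \<tau>: "0 < \<tau>" "\<tau> < T"
    and contf: "continuous_on UNIV f" and f': "continuous_on UNIV f'"
    and f: "locally_quadratic_remainder f f'"
    and growth: "\<And>x u. u \<in> U \<Longrightarrow> norm (f (x, u)) \<le> c1 * norm x + c2" and "0 < c1"
    and K: "closed K" "K = {x. g x \<le> 0}"
    and \<phi>: "(\<phi> has_derivative \<phi>') (at (x T))"
    and g: "\<And>x. (g has_derivative blinfun_apply (g' x)) (at x)" "continuous_on UNIV g'" "C1_function g"
    and min: "\<And>u z. u \<in> admissible_controls U T \<Longrightarrow> state_of f x0 T u z \<Longrightarrow> crisis_cost \<phi> K T x \<le> crisis_cost \<phi> K T z"
    and x: "continuous_on {0..T} x" "\<And>t. t \<in> {0..T} \<Longrightarrow> x t = x0 + integral {0..t} (\<lambda>t. f (x t, u t))"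
    and u: "u \<in> borel_measurable (lebesgue_on {0..T})" "\<And>t. t \<in> {0..T} \<Longrightarrow> norm (u t) \<le> B"
    and uU: "\<And>t. t \<in> {0..T} \<Longrightarrow> u t \<in> U"
    and N: "negligible N" "\<And>t. t \<in> {0..T} - N \<Longrightarrow> u t = ubar t"
    and u_minus: "(ubar \<longlongrightarrow> u_minus) (at_left \<tau>)" and pos: "g' (x \<tau>) (f (x \<tau>, u_minus)) > 0"
    and gx: "\<And>t. t \<in> {0..<\<tau>} \<Longrightarrow> g (x t) < 0" "g (x \<tau>) = 0" "\<And>t. t \<in> {\<tau><..T} \<Longrightarrow> g (x t) > 0"
    and U: "U = {u. \<forall>i. c u $ i \<le> 0}"
    and c: "\<And>u. (c has_derivative blinfun_apply (c' u)) (at u)" "continuous_on UNIV c'"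
      "locally_quadratic_remainder c c'"
    and qual: "\<epsilon> > 0" "\<delta> > 0" "\<And>t \<xi>. t \<in> {0..T} \<Longrightarrow> \<epsilon> * L2_set \<xi> {i. - \<delta> \<le> c (u t) $ i}
      \<le> norm (\<Sum>i\<in>{i. - \<delta> \<le> c (u t) $ i}. \<xi> i *\<^sub>R gradient (\<lambda>u. c u $ i) (u t))"
  shows "\<exists>\<alpha> \<gamma> P R \<nu> CP CR CN N'. 0 \<le> \<alpha> \<and> (\<alpha>, \<gamma>) \<noteq> (0, 0) \<and> negligible N' \<and>
    P T = gradient \<phi> (x T) \<and> CP-lipschitz_on {0..T} P \<and>
    (\<forall>t\<in>{0<..<T} - N'. (P has_vector_derivative - adjoint_fst (f' (x t, u t)) (P t)) (at t)) \<and>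
    R \<tau> = gradient g (x \<tau>) \<and> CR-lipschitz_on {0..\<tau>} R \<and>
    (\<forall>t\<in>{0<..<\<tau>} - N'. (R has_vector_derivative - adjoint_fst (f' (x t, u t)) (R t)) (at t)) \<and>
    \<nu> \<in> borel_measurable (lebesgue_on {0..T}) \<and> (\<forall>t\<in>{0..T}. norm (\<nu> t) \<le> CN) \<and>
    (\<forall>t\<in>{0..T} - N'. (\<forall>i. 0 \<le> \<nu> t $ i) \<and> (\<forall>i. \<nu> t $ i * c (u t) $ i = 0) \<and>
       adjoint_snd (f' (x t, u t)) (\<alpha> *\<^sub>R P t + (if t < \<tau> then \<gamma> *\<^sub>R R t else 0))
         + (\<Sum>i\<in>UNIV. \<nu> t $ i *\<^sub>R gradient (\<lambda>u. c u $ i) (u t)) = 0) \<and>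
    integral {0..T} (\<lambda>t. rho T \<tau> t * ((\<alpha> *\<^sub>R P t + (if t < \<tau> then \<gamma> *\<^sub>R R t else 0)) \<bullet> f (x t, u t))) = \<alpha>"
proof -
  have "0 < T" using \<tau> by simp
  have B0: "B \<ge> 0" using order_trans[OF norm_ge_zero u(2)[of 0]] \<open>0 < T\<close> by simp
  let ?M = "lebesgue_on {0..T}"
  have xm: "x \<in> borel_measurable ?M" by (rule continuous_on_Icc_borel_measurable_lebesgue[OF x(1)])
  define F where "F t = f' (x t, u t)" for t
  define v0 where "v0 t = f (x t, u t)" for t
  obtain LF where "LF > 0" and LF: "\<And>t. t \<in> {0..T} \<Longrightarrow> norm (F t) \<le> LF"
    using bounded_along_trajectory[where u = u, OF f' x(1) u(2)] unfolding F_def by blast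
  obtain Lv where "Lv > 0" and Lv: "\<And>t. t \<in> {0..T} \<Longrightarrow> norm (v0 t) \<le> Lv"
    using bounded_along_trajectory[where u = u, OF contf x(1) u(2)] unfolding v0_def by blast
  have v0m: "v0 \<in> borel_measurable ?M"
    unfolding v0_def[abs_def] by (intro borel_measurable_compose_Pair contf xm u)
  note rhom = borel_measurable_rho[of T \<tau> "{0..T}"]
  define Br where "Br = max (1 / \<tau>) (1 / (T - \<tau>))"
  have rhob: "\<bar>rho T \<tau> t\<bar> \<le> Br" for t unfolding Br_def by (rule abs_rho_le[OF \<tau>])
  have Br0: "Br \<ge> 0" using order_trans[OF abs_ge_zero rhob] .

  define D where "D t i = gradient (\<lambda>u. c u $ i) (u t)" for t i
  have ci: "((\<lambda>u. c u $ i) has_derivative (\<lambda>h. c' w h $ i)) (at w)" for w i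
    by (rule bounded_linear.has_derivative[OF bounded_linear_vec_nth c(1)])
  have D_inner: "D t i \<bullet> h = c' (u t) h $ i" for t i h
    unfolding D_def by (rule gradient_inner[OF ci])
  have Dm: "(\<lambda>t. D t i) \<in> borel_measurable ?M" for i
  proof -
    have "continuous_on UNIV (\<lambda>w. \<Sum>b\<in>Basis. (c' w b $ i) *\<^sub>R b)"
      by (intro continuous_intros continuous_on_compose2[OF c(2)]) auto
    from borel_measurable_continuous_on[OF this u(1)] show ?thesis
      unfolding D_def gradient_eq_sum_Basis[OF ci] .
  qed
  obtain Lc where Lc: "\<And>w. w \<in> cball 0 B \<Longrightarrow> norm (c w) \<le> Lc \<and> norm (c' w) \<le> Lc"
    using c(3) unfolding locally_quadratic_remainder_def by blast
  have uB: "u t \<in> cball 0 B" if "t \<in> {0..T}" for t using u(2)[OF that] by simp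
  have Db: "norm (D t i) \<le> Lc" if t: "t \<in> {0..T}" for t i
  proof -
    have "D t i \<bullet> D t i \<le> norm (c' (u t) (D t i))"
      unfolding D_inner using component_le_norm_cart[of "c' (u t) (D t i)" i] by simp
    also have "\<dots> \<le> Lc * norm (D t i)"
      using norm_blinfun[of "c' (u t)" "D t i"] Lc[OF uB[OF t]] by (meson mult_right_mono norm_ge_zero order_trans)
    finally show ?thesis
      using norm_le_of_inner_self[of "D t i" Lc] order_trans[OF norm_ge_zero conjunct1[OF Lc[OF uB[OF t]]]] by auto
  qed
  define cc where "cc t = c (u t)" for t
  have contc: "continuous_on UNIV c"
    by (rule has_derivative_imp_continuous_on_UNIV[OF c(1)])
  have ccm: "cc \<in> borel_measurable ?M"
    unfolding cc_def[abs_def] by (rule borel_measurable_continuous_on[OF contc u(1)])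
  have ccb: "norm (cc t) \<le> Lc" if "t \<in> {0..T}" for t unfolding cc_def using Lc[OF uB[OF that]] by blast
  have cc0: "cc t $ i \<le> 0" if "t \<in> {0..T}" for t i using uU[OF that] by (simp add: cc_def U)
  have indep: "\<epsilon> * L2_set \<xi> {i. - \<delta> \<le> cc t $ i} \<le> norm (\<Sum>i\<in>{i. - \<delta> \<le> cc t $ i}. \<xi> i *\<^sub>R D t i)"
    if "t \<in> {0..T}" for t \<xi>
    unfolding cc_def D_def by (rule qual(3)[OF that])
  let ?sf = "strictly_feasible_direction D cc T \<delta>"

  have "0 \<le> T" "0 \<le> \<tau>" "\<tau> \<le> T" using \<tau> by auto
  obtain P CP N1 where PT: "P T = gradient \<phi> (x T)" and Plip: "CP-lipschitz_on {0..T} P" and N1: "negligible N1"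
    and Pder: "\<forall>t\<in>{0<..<T} - N1. (P has_vector_derivative - adjoint_fst (f' (x t, u t)) (P t)) (at t)"
    and Pdual: "\<forall>y h. linearized_solution (\<lambda>t. f' (x t, u t)) T h y \<longrightarrow>
      ((\<lambda>t. P t \<bullet> h t) has_integral (gradient \<phi> (x T) \<bullet> y T)) {0..T}"
    by (rule exE[OF adjoint_state[where u = u and ?p1.0 = "gradient \<phi> (x T)", OF f' x(1) u \<open>0 \<le> T\<close> order_refl]])
      (assumption, elim exE conjE, (rule that; assumption))
  obtain R CR N2 where R\<tau>: "R \<tau> = gradient g (x \<tau>)" and Rlip: "CR-lipschitz_on {0..\<tau>} R" and N2: "negligible N2"
    and Rder: "\<forall>t\<in>{0<..<\<tau>} - N2. (R has_vector_derivative - adjoint_fst (f' (x t, u t)) (R t)) (at t)"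
    and Rdual: "\<forall>y h. linearized_solution (\<lambda>t. f' (x t, u t)) T h y \<longrightarrow>
      ((\<lambda>t. R t \<bullet> h t) has_integral (gradient g (x \<tau>) \<bullet> y \<tau>)) {0..\<tau>}"
    by (rule exE[OF adjoint_state[where u = u and ?p1.0 = "gradient g (x \<tau>)", OF f' x(1) u \<open>0 \<le> \<tau>\<close> \<open>\<tau> \<le> T\<close>]])
      (assumption, elim exE conjE, (rule that; assumption))
  \<comment> \<open>The state at \<tau> does not feel perturbations after \<tau>, so the adjoint
    state of that functional is continued by zero. This produces the jump of the costate.\<close>
  define R0 where "R0 t = (if t < \<tau> then R t else 0)" for t

  have Pc: "continuous_on {0..T} P" by (rule lipschitz_on_continuous_on[OF Plip])
  \<comment> \<open>A continuous continuation past \<tau>, which lends its measurability and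
    boundedness to \<open>R0\<close>.\<close>
  have Rc: "continuous_on {0..T} (\<lambda>t. R (min t \<tau>))"
    by (rule continuous_on_compose2[OF lipschitz_on_continuous_on[OF Rlip]]) (use \<tau> in \<open>auto intro!: continuous_intros\<close>)
  have Pm: "P \<in> borel_measurable ?M" by (rule continuous_on_Icc_borel_measurable_lebesgue[OF Pc])
  have R0m: "R0 \<in> borel_measurable ?M"
  proof -
    have "{t. t < \<tau>} \<inter> space ?M \<in> sets ?M"
      by (subst sets_restrict_space_iff) auto
    then have "(\<lambda>t. if t \<in> {t. t < \<tau>} then R (min t \<tau>) else 0) \<in> borel_measurable ?M"
      by (intro measurable_If_set continuous_on_Icc_borel_measurable_lebesgue[OF Rc] borel_measurable_const)
    also have "(\<lambda>t. if t \<in> {t. t < \<tau>} then R (min t \<tau>) else 0) = R0" by (auto simp: R0_def)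
    finally show ?thesis .
  qed
  obtain bP bR where bP: "\<And>t. t \<in> {0..T} \<Longrightarrow> norm (P t) \<le> bP" and bR: "\<And>t. t \<in> {0..T} \<Longrightarrow> norm (R (min t \<tau>)) \<le> bR"
    using continuous_on_Icc_bounded[OF Pc] continuous_on_Icc_bounded[OF Rc] by blast
  have bR0: "norm (R0 t) \<le> bR" if "t \<in> {0..T}" for t
    using bR[OF that] order_trans[OF norm_ge_zero bR[OF that]] by (auto simp: R0_def min_def split: if_splits)

  \<comment> \<open>The coefficient of the control perturbation v; \<kappa>, defined next, is the
    coefficient of the time shift \<sigma>.\<close>
  define q where "q Q t = adjoint_snd (F t) (Q t)" for Q t
  define \<kappa> where "\<kappa> Q = integral {0..T} (\<lambda>t. rho T \<tau> t * (Q t \<bullet> v0 t))" for Q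
  have qm: "q Q \<in> borel_measurable ?M" if "Q \<in> borel_measurable ?M" for Q
    unfolding q_def[abs_def] F_def
    using borel_measurable_compose_Pair[OF continuous_on_adjoint(2)[OF f'] borel_measurable_Pair[OF xm u(1)] that] by simp
  have qb: "norm (q Q t) \<le> LF * b" if "\<And>t. t \<in> {0..T} \<Longrightarrow> norm (Q t) \<le> b" "t \<in> {0..T}" for Q b t
  proof -
    have "norm (q Q t) \<le> norm (F t) * norm (Q t)" unfolding q_def by (rule norm_adjoint_snd)
    also have "\<dots> \<le> LF * b" using LF[OF that(2)] that(1)[OF that(2)] \<open>LF > 0\<close> by (intro mult_mono) auto
    finally show ?thesis .
  qed
  have qint: "(\<lambda>t. q Q t \<bullet> v t) integrable_on {0..T}"
    if a: "Q \<in> borel_measurable ?M" "\<And>t. t \<in> {0..T} \<Longrightarrow> norm (Q t) \<le> b"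
      "v \<in> borel_measurable ?M" "\<And>t. t \<in> {0..T} \<Longrightarrow> norm (v t) \<le> bv" for Q v b bv
  proof (rule bounded_measurable_integrable_on)
    show "(\<lambda>t. q Q t \<bullet> v t) \<in> borel_measurable ?M" by (intro borel_measurable_inner qm a)
    show "norm (q Q t \<bullet> v t) \<le> LF * b * bv" if t: "t \<in> {0..T}" for t
    proof -
      have "norm (q Q t) \<le> LF * b" by (rule qb[OF a(2) t])
      then show ?thesis using abs_inner_le_mult[OF _ a(4)[OF t]] by simp
    qed
  qed
  have kint: "(\<lambda>t. rho T \<tau> t * (Q t \<bullet> v0 t)) integrable_on {0..T}"
    if a: "Q \<in> borel_measurable ?M" "\<And>t. t \<in> {0..T} \<Longrightarrow> norm (Q t) \<le> b" for Q b
  proof (rule bounded_measurable_integrable_on)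
    show "(\<lambda>t. rho T \<tau> t * (Q t \<bullet> v0 t)) \<in> borel_measurable ?M"
      by (intro borel_measurable_times rhom borel_measurable_inner v0m a)
    show "norm (rho T \<tau> t * (Q t \<bullet> v0 t)) \<le> Br * (b * Lv)" if t: "t \<in> {0..T}" for t
    proof -
      have "\<bar>Q t \<bullet> v0 t\<bar> \<le> b * Lv" by (rule abs_inner_le_mult[OF a(2)[OF t] Lv[OF t]])
      then have "\<bar>rho T \<tau> t\<bar> * \<bar>Q t \<bullet> v0 t\<bar> \<le> Br * (b * Lv)"
        using rhob[of t] Br0 by (intro mult_mono) auto
      then show ?thesis by (simp add: abs_mult)
    qed
  qed
  have split: "integral {0..T} (\<lambda>t. Q t \<bullet> (F t (0, v t) + (\<sigma> * rho T \<tau> t) *\<^sub>R v0 t)) = integral {0..T} (\<lambda>t. q Q t \<bullet> v t) + \<sigma> * \<kappa> Q"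
    if "Q \<in> borel_measurable ?M" "\<And>t. t \<in> {0..T} \<Longrightarrow> norm (Q t) \<le> b"
      "v \<in> borel_measurable ?M" "\<And>t. t \<in> {0..T} \<Longrightarrow> norm (v t) \<le> bv" for Q v b bv \<sigma>
  proof -
    have "Q t \<bullet> (F t (0, v t) + (\<sigma> * rho T \<tau> t) *\<^sub>R v0 t) = q Q t \<bullet> v t + \<sigma> * (rho T \<tau> t * (Q t \<bullet> v0 t))" for t
      by (simp add: q_def adjoint_snd_inner inner_add_right)
    then show ?thesis
      using Henstock_Kurzweil_Integration.integral_add[OF qint[OF that] integrable_on_mult_right[OF kint[OF that(1,2)], of \<sigma>]]
      by (simp add: \<kappa>_def)
  qed

  \<comment> \<open>By duality, \<open>a1\<close> is the first-order change of the cost, with -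
    \<sigma> from the crisis time, and \<open>a2\<close> that of g at the crossing. Written through
    the adjoint states, both are visibly affine in (v, \<sigma>).\<close>
  define a1 where "a1 v \<sigma> = integral {0..T} (\<lambda>t. q P t \<bullet> v t) + \<sigma> * \<kappa> P - \<sigma>" for v \<sigma>
  define a2 where "a2 v \<sigma> = integral {0..T} (\<lambda>t. q R0 t \<bullet> v t) + \<sigma> * \<kappa> R0" for v \<sigma>
  have no_descent: "\<not> (a1 v \<sigma> < 0 \<and> a2 v \<sigma> < 0)" if sf: "?sf v" for v \<sigma>
  proof
    assume neg: "a1 v \<sigma> < 0 \<and> a2 v \<sigma> < 0"
    have vm: "v \<in> borel_measurable ?M" using sf by (simp add: strictly_feasible_direction_def)
    obtain bv where bv: "\<And>t. t \<in> {0..T} \<Longrightarrow> norm (v t) \<le> bv"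
      using sf unfolding strictly_feasible_direction_def by blast
    obtain k where "k > 0" and k: "\<And>t i. t \<in> {0..T} \<Longrightarrow> - \<delta> \<le> cc t $ i \<Longrightarrow> cc t $ i + D t i \<bullet> v t \<le> - k"
      using sf unfolding strictly_feasible_direction_def by blast
    define h where "h t = f' (x t, u t) (0, v t) + (\<sigma> * rho T \<tau> t) *\<^sub>R f (x t, u t)" for t
    have hm: "h \<in> borel_measurable ?M"
    proof -
      have "continuous_on UNIV (\<lambda>w. f' (fst w) (0, snd w))"
        by (intro continuous_intros continuous_on_compose2[OF f']) auto
      from borel_measurable_compose_Pair[OF this borel_measurable_Pair[OF xm u(1)] vm]
      have "(\<lambda>t. f' (x t, u t) (0, v t)) \<in> borel_measurable ?M" by simp
      then show ?thesis unfolding h_def[abs_def]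
        by (intro borel_measurable_add borel_measurable_scaleR borel_measurable_times borel_measurable_const rhom v0m[unfolded v0_def[abs_def]])
    qed
    have hb: "norm (h t) \<le> LF * bv + \<bar>\<sigma>\<bar> * Br * Lv" if t: "t \<in> {0..T}" for t
    proof -
      have "norm (h t) \<le> norm (F t (0, v t)) + \<bar>\<sigma> * rho T \<tau> t\<bar> * norm (v0 t)"
        unfolding h_def F_def v0_def by (rule order_trans[OF norm_triangle_ineq]) simp
      moreover have "norm (F t (0, v t)) \<le> LF * bv"
      proof -
        have "norm (F t (0, v t)) \<le> norm (F t) * norm (v t)" using norm_blinfun[of "F t" "(0, v t)"] by simp
        also have "\<dots> \<le> LF * bv" using LF[OF t] bv[OF t] \<open>LF > 0\<close> by (intro mult_mono) auto
        finally show ?thesis .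
      qed
      moreover have "\<bar>\<sigma> * rho T \<tau> t\<bar> * norm (v0 t) \<le> \<bar>\<sigma>\<bar> * Br * Lv"
        unfolding abs_mult using rhob[of t] Lv[OF t] Br0 by (intro mult_mono mult_left_mono) auto
      ultimately show ?thesis by linarith
    qed
    define B1 where "B1 = max (max B bv) (LF * bv + \<bar>\<sigma>\<bar> * Br * Lv)"
    have B1: "norm (u t) \<le> B1" "norm (v t) \<le> B1" "norm (h t) \<le> B1" if "t \<in> {0..T}" for t
      using u(2)[OF that] bv[OF that] hb[OF that] by (auto simp: B1_def)
    have "\<exists>y. linearized_solution (\<lambda>t. f' (x t, u t)) T h y"
      by (rule linearized_state[OF f' x(1) u(1) B1(1) hm B1(3) \<open>0 \<le> T\<close>])
    then obtain y where y: "linearized_solution (\<lambda>t. f' (x t, u t)) T h y" by blast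
    have hv: "h t = F t (0, v t) + (\<sigma> * rho T \<tau> t) *\<^sub>R v0 t" for t by (simp add: h_def F_def v0_def)
    have yT: "\<phi>' (y T) - \<sigma> = a1 v \<sigma>"
    proof -
      have "((\<lambda>t. P t \<bullet> h t) has_integral (gradient \<phi> (x T) \<bullet> y T)) {0..T}"
        by (rule Pdual[rule_format, OF y])
      then have "gradient \<phi> (x T) \<bullet> y T = integral {0..T} (\<lambda>t. P t \<bullet> h t)" by (rule integral_unique[symmetric])
      also have "\<dots> = integral {0..T} (\<lambda>t. q P t \<bullet> v t) + \<sigma> * \<kappa> P"
        unfolding hv by (rule split[OF Pm bP vm bv])
      finally show ?thesis unfolding gradient_inner[OF \<phi>] a1_def by simp
    qed
    have y\<tau>: "g' (x \<tau>) (y \<tau>) = a2 v \<sigma>"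
    proof -
      have "((\<lambda>t. R t \<bullet> h t) has_integral (gradient g (x \<tau>) \<bullet> y \<tau>)) {0..\<tau>}"
        by (rule Rdual[rule_format, OF y])
      then have "((\<lambda>t. R0 t \<bullet> h t) has_integral (gradient g (x \<tau>) \<bullet> y \<tau>)) {0..\<tau>}"
        by (rule has_integral_spike[of "{\<tau>}", rotated 2]) (auto simp: R0_def)
      moreover have "((\<lambda>t. R0 t \<bullet> h t) has_integral 0) {\<tau>..T}"
        by (rule has_integral_is_0) (auto simp: R0_def)
      ultimately have "((\<lambda>t. R0 t \<bullet> h t) has_integral (gradient g (x \<tau>) \<bullet> y \<tau> + 0)) {0..T}"
        using \<tau> by (intro has_integral_combine[of 0 \<tau> T]) auto
      then have "gradient g (x \<tau>) \<bullet> y \<tau> + 0 = integral {0..T} (\<lambda>t. R0 t \<bullet> h t)"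
        by (rule integral_unique[symmetric])
      also have "\<dots> = integral {0..T} (\<lambda>t. q R0 t \<bullet> v t) + \<sigma> * \<kappa> R0"
        unfolding hv by (rule split[OF R0m bR0 vm bv])
      finally show ?thesis unfolding gradient_inner[OF g(1)] a2_def by simp
    qed
    have feas: "\<exists>s0>0. \<forall>s\<in>{0<..s0}. \<forall>t\<in>{0..T}. u t + s *\<^sub>R v t \<in> U"
      unfolding U mem_Collect_eq
      by (rule strictly_feasible_imp_feasible[OF c(3) u(2) _ bv \<open>k > 0\<close> \<open>\<delta> > 0\<close>])
        (assumption | rule cc0[unfolded cc_def] k[unfolded cc_def D_inner])+
    show False
      by (rule no_descent_direction[OF \<tau> contf f growth \<open>0 < c1\<close> K \<phi> g min x u(1) B1(1) N u_minus pos gx vm B1(2) feas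
        y[unfolded h_def[abs_def]]]) (use neg yT y\<tau> in auto)
  qed

  define S where "S = {(a1 v \<sigma>, a2 v \<sigma>) | v \<sigma>. ?sf v}"
  note ctx = Dm Db ccm ccb cc0 \<open>0 < T\<close> qual(1) indep
  obtain v1 where v1: "?sf v1" using strictly_feasible_direction_exists[OF ctx] by blast
  have sfb: "v \<in> borel_measurable ?M" "\<exists>C. \<forall>t\<in>{0..T}. norm (v t) \<le> C" if "?sf v" for v
    using that by (auto simp: strictly_feasible_direction_def)
  have lin: "integral {0..T} (\<lambda>t. q Q t \<bullet> ((1 - \<theta>) *\<^sub>R v t + \<theta> *\<^sub>R w t))
      = (1 - \<theta>) * integral {0..T} (\<lambda>t. q Q t \<bullet> v t) + \<theta> * integral {0..T} (\<lambda>t. q Q t \<bullet> w t)"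
    if Q: "Q \<in> borel_measurable ?M" "\<And>t. t \<in> {0..T} \<Longrightarrow> norm (Q t) \<le> b" and vw: "?sf v" "?sf w" for Q b v w \<theta>
  proof -
    obtain bv bw where bv: "\<And>t. t \<in> {0..T} \<Longrightarrow> norm (v t) \<le> bv" and bw: "\<And>t. t \<in> {0..T} \<Longrightarrow> norm (w t) \<le> bw"
      using sfb(2)[OF vw(1)] sfb(2)[OF vw(2)] by blast
    show ?thesis
      using Henstock_Kurzweil_Integration.integral_add[OF integrable_on_mult_right[OF qint[OF Q sfb(1)[OF vw(1)] bv], of "1 - \<theta>"]
          integrable_on_mult_right[OF qint[OF Q sfb(1)[OF vw(2)] bw], of \<theta>]]
      by (simp add: inner_add_right)
  qed
  have "convex S"
    unfolding convex_alt
  proof (intro ballI allI impI)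
    fix p p' and \<theta> :: real assume "p \<in> S" "p' \<in> S" and \<theta>: "0 \<le> \<theta> \<and> \<theta> \<le> 1"
    then obtain v \<sigma> w \<sigma>' where p: "p = (a1 v \<sigma>, a2 v \<sigma>)" "?sf v" "p' = (a1 w \<sigma>', a2 w \<sigma>')" "?sf w"
      unfolding S_def by blast
    let ?v = "\<lambda>t. (1 - \<theta>) *\<^sub>R v t + \<theta> *\<^sub>R w t" and ?\<sigma> = "(1 - \<theta>) * \<sigma> + \<theta> * \<sigma>'"
    have "?sf ?v" using strictly_feasible_direction_convex[OF ctx p(2,4)] \<theta> by blast
    moreover have "integral {0..T} (\<lambda>t. q P t \<bullet> ?v t)
        = (1 - \<theta>) * integral {0..T} (\<lambda>t. q P t \<bullet> v t) + \<theta> * integral {0..T} (\<lambda>t. q P t \<bullet> w t)"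
      by (rule lin[OF Pm bP p(2,4)])
    then have "(1 - \<theta>) * a1 v \<sigma> + \<theta> * a1 w \<sigma>' = a1 ?v ?\<sigma>" unfolding a1_def by (simp only:) (simp add: algebra_simps)
    moreover have "integral {0..T} (\<lambda>t. q R0 t \<bullet> ?v t)
        = (1 - \<theta>) * integral {0..T} (\<lambda>t. q R0 t \<bullet> v t) + \<theta> * integral {0..T} (\<lambda>t. q R0 t \<bullet> w t)"
      by (rule lin[OF R0m bR0 p(2,4)])
    then have "(1 - \<theta>) * a2 v \<sigma> + \<theta> * a2 w \<sigma>' = a2 ?v ?\<sigma>" unfolding a2_def by (simp only:) (simp add: algebra_simps)
    ultimately have "?sf ?v" "(1 - \<theta>) *\<^sub>R p + \<theta> *\<^sub>R p' = (a1 ?v ?\<sigma>, a2 ?v ?\<sigma>)"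
      by (auto simp: p)
    then show "(1 - \<theta>) *\<^sub>R p + \<theta> *\<^sub>R p' \<in> S" unfolding S_def by blast
  qed
  moreover have "S \<noteq> {}" using v1 unfolding S_def by blast
  moreover have "\<not> (a < 0 \<and> b < 0)" if "(a, b) \<in> S" for a b using that no_descent unfolding S_def by blast
  ultimately obtain \<alpha> \<gamma> where \<alpha>: "0 \<le> \<alpha>" and nz: "(\<alpha>, \<gamma>) \<noteq> (0, 0)" and sep: "\<forall>(a, b)\<in>S. 0 \<le> \<alpha> * a + \<gamma> * b"
    using convex_avoids_negative_quadrant[of S] by blast
  define p where "p t = \<alpha> *\<^sub>R P t + (if t < \<tau> then \<gamma> *\<^sub>R R t else 0)" for t
  have p_eq: "p t = \<alpha> *\<^sub>R P t + \<gamma> *\<^sub>R R0 t" for t by (simp add: p_def R0_def)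
  have pm: "p \<in> borel_measurable ?M"
    unfolding p_eq[abs_def] by (intro borel_measurable_add borel_measurable_scaleR borel_measurable_const Pm R0m)
  have bp: "norm (p t) \<le> \<alpha> * bP + \<bar>\<gamma>\<bar> * bR" if "t \<in> {0..T}" for t
    unfolding p_eq using bP[OF that] bR0[OF that] \<alpha>
    by (intro order_trans[OF norm_triangle_ineq] add_mono) (auto intro!: mult_left_mono)
  have qp: "integral {0..T} (\<lambda>t. q p t \<bullet> v t) = \<alpha> * integral {0..T} (\<lambda>t. q P t \<bullet> v t) + \<gamma> * integral {0..T} (\<lambda>t. q R0 t \<bullet> v t)"
    if v: "?sf v" for v
  proof -
    obtain bv where bv: "\<And>t. t \<in> {0..T} \<Longrightarrow> norm (v t) \<le> bv" using sfb(2)[OF v] by blast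
    have "q p t \<bullet> v t = \<alpha> * (q P t \<bullet> v t) + \<gamma> * (q R0 t \<bullet> v t)" for t
      by (simp add: q_def p_eq adjoint_linear inner_add_left)
    then show ?thesis
      using Henstock_Kurzweil_Integration.integral_add[OF integrable_on_mult_right[OF qint[OF Pm bP sfb(1)[OF v] bv], of \<alpha>]
          integrable_on_mult_right[OF qint[OF R0m bR0 sfb(1)[OF v] bv], of \<gamma>]] by simp
  qed
  have \<kappa>p: "\<kappa> p = \<alpha> * \<kappa> P + \<gamma> * \<kappa> R0"
  proof -
    have "rho T \<tau> t * (p t \<bullet> v0 t) = \<alpha> * (rho T \<tau> t * (P t \<bullet> v0 t)) + \<gamma> * (rho T \<tau> t * (R0 t \<bullet> v0 t))" for t
      by (simp add: p_eq inner_add_left algebra_simps)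
    then show ?thesis unfolding \<kappa>_def
      using Henstock_Kurzweil_Integration.integral_add[OF integrable_on_mult_right[OF kint[OF Pm bP], of \<alpha>]
          integrable_on_mult_right[OF kint[OF R0m bR0], of \<gamma>]] by simp
  qed
  have nonneg: "0 \<le> integral {0..T} (\<lambda>t. q p t \<bullet> v t) + \<sigma> * (\<kappa> p - \<alpha>)" if v: "?sf v" for v \<sigma>
  proof -
    have "(a1 v \<sigma>, a2 v \<sigma>) \<in> S" using v unfolding S_def by blast
    with sep have "0 \<le> \<alpha> * a1 v \<sigma> + \<gamma> * a2 v \<sigma>" by blast
    also have "\<dots> = integral {0..T} (\<lambda>t. q p t \<bullet> v t) + \<sigma> * (\<kappa> p - \<alpha>)"
      unfolding qp[OF v] \<kappa>p a1_def a2_def by (simp add: algebra_simps)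
    finally show ?thesis .
  qed
  \<comment> \<open>The shift \<sigma> runs through all reals, so its coefficient must vanish;
    otherwise the shift chosen below makes the functional equal to -1.\<close>
  have \<kappa>\<alpha>: "\<kappa> p = \<alpha>"
  proof (rule ccontr)
    assume ne: "\<kappa> p \<noteq> \<alpha>"
    let ?I = "integral {0..T} (\<lambda>t. q p t \<bullet> v1 t)"
    have "0 \<le> ?I + (- (?I + 1) / (\<kappa> p - \<alpha>)) * (\<kappa> p - \<alpha>)" by (rule nonneg[OF v1])
    also have "\<dots> = - 1" using ne by simp
    finally show False by simp
  qed
  have qnn: "0 \<le> integral {0..T} (\<lambda>t. q p t \<bullet> v t)" if "?sf v" for v
    using nonneg[OF that, of 0] by simp
  obtain \<nu> N3 CN where \<nu>: "\<nu> \<in> borel_measurable ?M" "\<And>t. t \<in> {0..T} \<Longrightarrow> norm (\<nu> t) \<le> CN" and N3: "negligible N3"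
    and \<nu>1: "\<And>t i. t \<in> {0..T} - N3 \<Longrightarrow> 0 \<le> \<nu> t $ i" and \<nu>2: "\<And>t i. t \<in> {0..T} - N3 \<Longrightarrow> \<nu> t $ i * cc t $ i = 0"
    and \<nu>3: "\<And>t. t \<in> {0..T} - N3 \<Longrightarrow> q p t + (\<Sum>i\<in>UNIV. \<nu> t $ i *\<^sub>R D t i) = 0"
    by (rule multiplier_exists[OF ctx qm[OF pm] qb[OF bp] qnn]) (assumption+, (rule that; assumption))
  show ?thesis
  proof (intro exI conjI)
    show "0 \<le> \<alpha>" "(\<alpha>, \<gamma>) \<noteq> (0, 0)" by fact+
    show "negligible (N1 \<union> N2 \<union> N3)" using N1 N2 N3 by simp
    show "P T = gradient \<phi> (x T)" "CP-lipschitz_on {0..T} P" "R \<tau> = gradient g (x \<tau>)" "CR-lipschitz_on {0..\<tau>} R" by fact+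
    show "\<forall>t\<in>{0<..<T} - (N1 \<union> N2 \<union> N3). (P has_vector_derivative - adjoint_fst (f' (x t, u t)) (P t)) (at t)" using Pder by blast
    show "\<forall>t\<in>{0<..<\<tau>} - (N1 \<union> N2 \<union> N3). (R has_vector_derivative - adjoint_fst (f' (x t, u t)) (R t)) (at t)" using Rder by blast
    show "\<nu> \<in> borel_measurable ?M" by fact
    show "\<forall>t\<in>{0..T}. norm (\<nu> t) \<le> CN" using \<nu>(2) by blast
    show "\<forall>t\<in>{0..T} - (N1 \<union> N2 \<union> N3). (\<forall>i. 0 \<le> \<nu> t $ i) \<and> (\<forall>i. \<nu> t $ i * c (u t) $ i = 0) \<and>
       adjoint_snd (f' (x t, u t)) (\<alpha> *\<^sub>R P t + (if t < \<tau> then \<gamma> *\<^sub>R R t else 0))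
         + (\<Sum>i\<in>UNIV. \<nu> t $ i *\<^sub>R gradient (\<lambda>u. c u $ i) (u t)) = 0"
      using \<nu>1 \<nu>2 \<nu>3 unfolding q_def F_def p_def D_def cc_def by blast
    show "integral {0..T} (\<lambda>t. rho T \<tau> t * ((\<alpha> *\<^sub>R P t + (if t < \<tau> then \<gamma> *\<^sub>R R t else 0)) \<bullet> f (x t, u t))) = \<alpha>"
      using \<kappa>\<alpha> unfolding \<kappa>_def p_def v0_def .
  qed
qed

lemma integrable_on_Ioo_of_bounded_measurable:
  fixes h :: "real \<Rightarrow> real"
  assumes "h \<in> borel_measurable (lebesgue_on {a..b})" "\<And>t. t \<in> {a..b} \<Longrightarrow> \<bar>h t\<bar> \<le> B"
  shows "integrable (lebesgue_on {a<..<b}) h" "(LINT t|lebesgue_on {a<..<b}. h t) = integral {a..b} h"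
proof -
  have "h \<in> borel_measurable (lebesgue_on {a<..<b})"
    by (rule measurable_restrict_mono[OF assms(1)]) auto
  moreover have "finite_measure (lebesgue_on {a<..<b})" by (intro finite_measure_lebesgue_on) simp
  ultimately show i: "integrable (lebesgue_on {a<..<b}) h"
    using assms(2) by (intro finite_measure.integrable_const_bound[where B = B] AE_I2) auto
  then have "(LINT t|lebesgue_on {a<..<b}. h t) = integral {a<..<b} h"
    by (intro lebesgue_integral_eq_integral) auto
  then show "(LINT t|lebesgue_on {a<..<b}. h t) = integral {a..b} h"
    by (simp add: integral_open_interval_real)
qed

theorem lemma4p2:
  fixes f :: "(real^'n) \<times> (real^'m) \<Rightarrow> real^'n"
    and U :: "(real^'m) set"
    and K :: "(real^'n) set"
    and \<phi> g :: "real^'n \<Rightarrow> real"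
    and c :: "real^'m \<Rightarrow> real^'l"
    and x0 :: "real^'n"
    and T \<tau> c1 c2 :: real
    and ubar :: "real \<Rightarrow> real^'m"
    and xbar :: "real \<Rightarrow> real^'n"
    and u_minus u_plus :: "real^'m"
  assumes "0 < T"
    and "U \<noteq> {}" and "closed U"
    and "C2_function f"
    and "0 < c1" and "0 < c2"
    and "\<And>x u. u \<in> U \<Longrightarrow> norm (f (x, u)) \<le> c1 * norm x + c2"
    and "\<And>x. (\<lambda>u. f (x, u)) ` U \<noteq> {} \<and> compact ((\<lambda>u. f (x, u)) ` U) \<and> convex ((\<lambda>u. f (x, u)) ` U)"
    and "C2_function \<phi>"
    and "closed K" and "interior K \<noteq> {}"
    and "global_minimizer f U \<phi> K x0 T ubar xbar"
    and ubar_bounded: "\<exists>B. AE t in lebesgue_on {0<..<T}. norm (ubar t) \<le> B"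
    and "C2_function c" and "U = {u. \<forall>i. c u $ i \<le> 0}"
    and qualification: "\<exists>\<epsilon>>0. \<exists>\<delta>>0. AE t in lebesgue_on {0<..<T}.
          let I = {i. - \<delta> \<le> c (ubar t) $ i} in
          \<forall>\<xi> :: 'l \<Rightarrow> real.
            \<epsilon> * L2_set \<xi> I \<le> norm (\<Sum>i\<in>I. \<xi> i *\<^sub>R gradient (\<lambda>u. c u $ i) (ubar t))"
    and "C1_function g" and "K = {x. g x \<le> 0}"
    and "\<tau> \<in> {0<..<T}" and "crossing_out K T xbar \<tau>"
    and "\<And>t. t \<in> {0<..<T} \<Longrightarrow> crossing_time K T xbar t \<Longrightarrow> t = \<tau>"
    and "(ubar \<longlongrightarrow> u_minus) (at_left \<tau>)" and "(ubar \<longlongrightarrow> u_plus) (at_right \<tau>)"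
    and "f (xbar \<tau>, u_minus) \<bullet> gradient g (xbar \<tau>) \<noteq> 0"
    and "f (xbar \<tau>, u_plus) \<bullet> gradient g (xbar \<tau>) \<noteq> 0"
    and "\<And>t. t \<in> {0..T} - {\<tau>} \<Longrightarrow> g (xbar t) \<noteq> 0"
  shows "lagrange_multipliers f \<phi> c g T ubar xbar \<tau> \<noteq> {}"
proof -
  note growth = assms(7) and K = \<open>closed K\<close> \<open>K = {x. g x \<le> 0}\<close>
  note U = \<open>U = {u. \<forall>i. c u $ i \<le> 0}\<close> and u_minus = \<open>(ubar \<longlongrightarrow> u_minus) (at_left \<tau>)\<close>
  have \<tau>: "0 < \<tau>" "\<tau> < T" using \<open>\<tau> \<in> {0<..<T}\<close> by auto
  have adm: "ubar \<in> admissible_controls U T" and st: "state_of f x0 T ubar xbar"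
    and min: "\<And>u x. u \<in> admissible_controls U T \<Longrightarrow> state_of f x0 T u x \<Longrightarrow> crisis_cost \<phi> K T xbar \<le> crisis_cost \<phi> K T x"
    using \<open>global_minimizer f U \<phi> K x0 T ubar xbar\<close> by (auto simp: global_minimizer_def)
  let ?M = "lebesgue_on {0..T}"
  have ubarm: "ubar \<in> borel_measurable ?M" and ubarU: "\<And>t. t \<in> {0..T} \<Longrightarrow> ubar t \<in> U"
    using adm by (auto simp: admissible_controls_def)

  obtain f' :: "(real^'n) \<times> (real^'m) \<Rightarrow> ((real^'n) \<times> (real^'m)) \<Rightarrow>\<^sub>L (real^'n)"
    where f': "\<And>w. (f has_derivative blinfun_apply (f' w)) (at w)" "continuous_on UNIV f'"
    and fq: "locally_quadratic_remainder f f'"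
    by (rule C2_functionE[OF \<open>C2_function f\<close>]) (rule that; assumption)
  have contf: "continuous_on UNIV f"
    by (rule has_derivative_imp_continuous_on_UNIV[OF f'(1)])
  obtain c' :: "real^'m \<Rightarrow> (real^'m) \<Rightarrow>\<^sub>L (real^'l)"
    where c': "\<And>w. (c has_derivative blinfun_apply (c' w)) (at w)" "continuous_on UNIV c'"
      "locally_quadratic_remainder c c'"
    by (rule C2_functionE[OF \<open>C2_function c\<close>]) (rule that; assumption)
  obtain \<phi>' where \<phi>': "(\<phi> has_derivative \<phi>') (at (xbar T))"
    using \<open>C2_function \<phi>\<close> unfolding C2_function_def by blast
  obtain g' :: "real^'n \<Rightarrow> (real^'n) \<Rightarrow>\<^sub>L real"
    where g': "\<And>w. (g has_derivative blinfun_apply (g' w)) (at w)" "continuous_on UNIV g'"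
    using \<open>C1_function g\<close> unfolding C1_function_def by blast
  have contg: "continuous_on UNIV g"
    by (rule has_derivative_imp_continuous_on_UNIV[OF g'(1)])

  have open_interval: "{0<..<T} \<in> sets lebesgue" by simp
  obtain B where "AE t in lebesgue_on {0<..<T}. norm (ubar t) \<le> B" using ubar_bounded by blast
  then obtain N1 where N1: "negligible N1" "\<And>t. t \<in> {0<..<T} - N1 \<Longrightarrow> norm (ubar t) \<le> B"
    unfolding AE_lebesgue_on_iff_negligible[OF open_interval] by blast
  obtain \<epsilon> \<delta> N2 where \<epsilon>: "\<epsilon> > 0" and \<delta>: "\<delta> > 0" and N2: "negligible N2"
    "\<And>t \<xi>. t \<in> {0<..<T} - N2 \<Longrightarrow> \<epsilon> * L2_set \<xi> {i. - \<delta> \<le> c (ubar t) $ i}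
      \<le> norm (\<Sum>i\<in>{i. - \<delta> \<le> c (ubar t) $ i}. \<xi> i *\<^sub>R gradient (\<lambda>u. c u $ i) (ubar t))"
    using qualification unfolding AE_lebesgue_on_iff_negligible[OF open_interval] Let_def by blast
  \<comment> \<open>The end points are added because the bound and the qualification are given on
    the open interval.\<close>
  define N where "N = N1 \<union> N2 \<union> {0, T}"
  have N: "negligible N" using N1 N2 by (simp add: N_def)
  have good: "t \<in> {0<..<T} - N1" "t \<in> {0<..<T} - N2" if "t \<in> {0..T} - N" for t
    using that by (auto simp: N_def)
  have "\<not> {0..T} \<subseteq> N"
  proof
    assume "{0..T} \<subseteq> N"
    then have "negligible (cbox 0 T)" using negligible_subset[OF N] by simp
    then show False using \<open>0 < T\<close> unfolding negligible_interval by simp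
  qed
  then obtain t0 where t0: "t0 \<in> {0..T} - N" by blast
  \<comment> \<open>\<open>u\<close> satisfies everywhere what \<open>ubar\<close> satisfies almost everywhere.\<close>
  define u where "u t = (if t \<in> N then ubar t0 else ubar t)" for t
  have u_eq: "u t = ubar t" if "t \<in> {0..T} - N" for t using that by (simp add: u_def)
  have u_ex: "\<exists>s\<in>{0..T} - N. u t = ubar s" if "t \<in> {0..T}" for t
    using that t0 by (auto simp: u_def)
  have um: "u \<in> borel_measurable ?M"
  proof -
    have "N \<inter> space ?M \<in> sets ?M"
      using negligible_imp_sets[OF N] by (subst sets_restrict_space_iff) auto
    then show ?thesis unfolding u_def[abs_def]
      by (intro measurable_If_set borel_measurable_const ubarm)
  qed
  have ub: "norm (u t) \<le> B" if "t \<in> {0..T}" for t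
    using u_ex[OF that] N1(2) good(1) by metis
  have uU: "u t \<in> U" if "t \<in> {0..T}" for t
    using u_ex[OF that] ubarU by auto
  have qual: "\<epsilon> * L2_set \<xi> {i. - \<delta> \<le> c (u t) $ i}
      \<le> norm (\<Sum>i\<in>{i. - \<delta> \<le> c (u t) $ i}. \<xi> i *\<^sub>R gradient (\<lambda>u. c u $ i) (u t))" if "t \<in> {0..T}" for t \<xi>
  proof -
    from u_ex[OF that] obtain s where "s \<in> {0..T} - N" "u t = ubar s" by blast
    then show ?thesis using N2(2)[OF good(2)] by simp
  qed

  note xc = state_ofD(1)[OF st]
  have xi: "((\<lambda>t. f (xbar t, u t)) has_integral (xbar t - x0)) {0..t}" if "t \<in> {0..T}" for t
    by (rule has_integral_spike[OF N _ state_ofD(2)[OF st that]]) (use that u_eq in auto)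
  have xe: "xbar t = x0 + integral {0..t} (\<lambda>t. f (xbar t, u t))" if "t \<in> {0..T}" for t
    using integral_unique[OF xi[OF that]] by simp

  have gc: "continuous_on {a..b} (\<lambda>t. g (xbar t))" if "0 \<le> a" "b \<le> T" for a b
    by (rule continuous_on_compose2[OF contg continuous_on_subset[OF xc]]) (use that in auto)
  obtain \<eta> where \<eta>: "\<eta> > 0" "{\<tau> - \<eta><..<\<tau> + \<eta>} \<subseteq> {0..T}"
    and inK: "\<And>t. t \<in> {\<tau> - \<eta><..\<tau>} \<Longrightarrow> g (xbar t) \<le> 0" and outK: "\<And>t. t \<in> {\<tau><..<\<tau> + \<eta>} \<Longrightarrow> g (xbar t) > 0"
    using \<open>crossing_out K T xbar \<tau>\<close> unfolding crossing_out_def K(2) by (auto simp: not_le)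
  \<comment> \<open>By the intermediate value theorem, a non-positive value after \<tau> would force
    a further zero of g along the trajectory.\<close>
  have g_pos: "g (xbar t) > 0" if t: "t \<in> {\<tau><..T}" for t
  proof (rule ccontr)
    assume "\<not> g (xbar t) > 0"
    define t1 where "t1 = min t (\<tau> + \<eta> / 2)"
    have t1: "t1 \<in> {\<tau><..<\<tau> + \<eta>}" "t1 \<le> t" using t \<eta>(1) by (auto simp: t1_def)
    have "\<exists>s\<ge>t1. s \<le> t \<and> g (xbar s) = 0"
      using outK[OF t1(1)] \<open>\<not> g (xbar t) > 0\<close> t1 t \<tau> by (intro IVT2' gc) auto
    then obtain s where "s \<ge> t1" "s \<le> t" "g (xbar s) = 0" by blast
    then show False using assms(26)[of s] t1 t \<tau> by auto
  qed
  have g_neg: "g (xbar t) < 0" if t: "t \<in> {0..<\<tau>}" for t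
  proof (rule ccontr)
    assume "\<not> g (xbar t) < 0"
    define t1 where "t1 = max t (\<tau> - \<eta> / 2)"
    have t1: "t1 \<in> {\<tau> - \<eta><..\<tau>}" "t \<le> t1" "t1 < \<tau>" using t \<eta>(1) by (auto simp: t1_def)
    have "\<exists>s\<ge>t. s \<le> t1 \<and> g (xbar s) = 0"
      using inK[OF t1(1)] \<open>\<not> g (xbar t) < 0\<close> t1 t \<tau> by (intro IVT2' gc) auto
    then obtain s where "s \<ge> t" "s \<le> t1" "g (xbar s) = 0" by blast
    then show False using assms(26)[of s] t1 t \<tau> by auto
  qed
  have g0: "g (xbar \<tau>) = 0"
  proof (rule antisym)
    show "g (xbar \<tau>) \<le> 0" using inK[of \<tau>] \<eta>(1) by auto
    have "((\<lambda>t. g (xbar t)) \<longlongrightarrow> g (xbar \<tau>)) (at_right \<tau>)"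
      using gc[of \<tau> T] \<tau> by (intro continuous_on_Icc_at_rightD[of \<tau> T]) auto
    moreover have "\<forall>\<^sub>F t in at_right \<tau>. 0 \<le> g (xbar t)"
      using g_pos \<tau> by (auto simp: eventually_at_right_field intro!: exI[of _ T] less_imp_le)
    ultimately show "0 \<le> g (xbar \<tau>)" by (rule tendsto_lowerbound) simp
  qed
  \<comment> \<open>Transversality provides only a non-zero value. If it were negative, -g would be
    non-decreasing along the trajectory just before \<tau>, which contradicts a negative value of g
    there and the value zero at \<tau>.\<close>
  have pos: "g' (xbar \<tau>) (f (xbar \<tau>, u_minus)) > 0"
  proof (rule ccontr)
    assume "\<not> ?thesis"
    moreover have "g' (xbar \<tau>) (f (xbar \<tau>, u_minus)) \<noteq> 0"
      using \<open>f (xbar \<tau>, u_minus) \<bullet> gradient g (xbar \<tau>) \<noteq> 0\<close> gradient_inner[OF g'(1)] by (metis inner_commute)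
    ultimately have neg: "(- g' (xbar \<tau>)) (f (xbar \<tau>, u_minus)) > 0" by (simp add: blinfun.minus_left)
    have mg: "((\<lambda>x. - g x) has_derivative blinfun_apply (- g' w)) (at w)" for w
    proof -
      have "blinfun_apply (- g' w) = (\<lambda>h. - g' w h)" by (simp add: fun_eq_iff blinfun.minus_left)
      then show ?thesis using has_derivative_minus[OF g'(1)[of w]] by simp
    qed
    have mgc: "continuous_on UNIV (\<lambda>w. - g' w)" by (intro continuous_intros g')
    \<comment> \<open>In this formula the bound names have swapped roles: \<open>N\<close> is the
      control and \<open>w\<close> the exceptional null set.\<close>
    obtain r where "r > 0" and r: "\<forall>(a::real) b z N w k. a \<le> b \<longrightarrow> negligible w \<longrightarrow> z a \<in> ball (xbar \<tau>) r \<longrightarrow> z b \<in> ball (xbar \<tau>) r \<longrightarrow>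
     (\<forall>t\<in>{a..b} - w. z t \<in> ball (xbar \<tau>) r \<and> N t \<in> ball u_minus r \<and> k t \<ge> 0) \<longrightarrow>
     ((\<lambda>t. k t *\<^sub>R f (z t, N t)) has_integral (z b - z a)) {a..b} \<longrightarrow> - g (z a) \<le> - g (z b)"
      using transversal_imp_increasing[where f = f and g = "\<lambda>x. - g x" and g' = "\<lambda>w. - g' w" and x = "xbar \<tau>" and u = u_minus, OF mg mgc contf neg]
      by (elim exE conjE) (rule that; assumption)
    obtain a where a: "0 \<le> a" "a < \<tau>" and near_x: "\<And>t. t \<in> {a..\<tau>} \<Longrightarrow> dist (xbar t) (xbar \<tau>) < r"
      and near_u: "\<And>t. t \<in> {a..<\<tau>} \<Longrightarrow> dist (ubar t) u_minus < r"
      using left_neighbourhood[OF xc \<tau> u_minus \<open>r > 0\<close>] by blast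
    have "- g (xbar a) \<le> - g (xbar \<tau>)"
    proof (rule r[rule_format, of a \<tau> "insert \<tau> N" xbar u "\<lambda>_. 1"])
      have "((\<lambda>t. f (xbar t, u t)) has_integral (xbar \<tau> - xbar a)) {a..\<tau>}"
        by (rule indefinite_integral_increment[OF has_integral_integrable[OF xi[of T]] xe]) (use a \<tau> in auto)
      then show "((\<lambda>t. 1 *\<^sub>R f (xbar t, u t)) has_integral (xbar \<tau> - xbar a)) {a..\<tau>}" by simp
      show "xbar t \<in> ball (xbar \<tau>) r \<and> u t \<in> ball u_minus r \<and> (0::real) \<le> 1" if "t \<in> {a..\<tau>} - insert \<tau> N" for t
        using near_x[of t] near_u[of t] u_eq[of t] that a \<tau> by (auto simp: dist_commute)
      show "xbar a \<in> ball (xbar \<tau>) r" "xbar \<tau> \<in> ball (xbar \<tau>) r"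
        using near_x[of a] a \<open>r > 0\<close> by (auto simp: dist_commute)
    qed (use a N in auto)
    then show False using g_neg[of a] a g0 by simp
  qed

  obtain \<alpha> \<gamma> P R \<nu> CP CR CN N' where \<alpha>: "0 \<le> \<alpha>" and nz: "(\<alpha>, \<gamma>) \<noteq> (0, 0)" and N': "negligible N'"
    and PT: "P T = gradient \<phi> (xbar T)" and Plip: "CP-lipschitz_on {0..T} P"
    and Pder: "\<forall>t\<in>{0<..<T} - N'. (P has_vector_derivative - adjoint_fst (f' (xbar t, u t)) (P t)) (at t)"
    and R\<tau>: "R \<tau> = gradient g (xbar \<tau>)" and Rlip: "CR-lipschitz_on {0..\<tau>} R"
    and Rder: "\<forall>t\<in>{0<..<\<tau>} - N'. (R has_vector_derivative - adjoint_fst (f' (xbar t, u t)) (R t)) (at t)"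
    and \<nu>: "\<nu> \<in> borel_measurable ?M" "\<forall>t\<in>{0..T}. norm (\<nu> t) \<le> CN"
    and kkt: "\<forall>t\<in>{0..T} - N'. (\<forall>i. 0 \<le> \<nu> t $ i) \<and> (\<forall>i. \<nu> t $ i * c (u t) $ i = 0) \<and>
       adjoint_snd (f' (xbar t, u t)) (\<alpha> *\<^sub>R P t + (if t < \<tau> then \<gamma> *\<^sub>R R t else 0))
         + (\<Sum>i\<in>UNIV. \<nu> t $ i *\<^sub>R gradient (\<lambda>u. c u $ i) (u t)) = 0"
    and ham: "integral {0..T} (\<lambda>t. rho T \<tau> t * ((\<alpha> *\<^sub>R P t + (if t < \<tau> then \<gamma> *\<^sub>R R t else 0)) \<bullet> f (xbar t, u t))) = \<alpha>"
    by (rule exE[OF multipliers_along_trajectory[where x = xbar and u = u and ubar = ubar and N = N and c = c and c' = c' and f = f and f' = f',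
      OF \<tau> contf f'(2) fq growth \<open>0 < c1\<close> K \<phi>' g' \<open>C1_function g\<close> min xc xe um ub uU N u_eq u_minus pos g_neg g0 g_pos U c' \<epsilon> \<delta> qual]])
      (assumption+, elim exE conjE, (rule that; assumption))

  define p where "p t = \<alpha> *\<^sub>R P t + (if t < \<tau> then \<gamma> *\<^sub>R R t else 0)" for t
  \<comment> \<open>The crossing time is added because the costate jumps there.\<close>
  define Z where "Z = N \<union> N' \<union> {\<tau>}"
  have Z: "negligible Z" using N N' by (simp add: Z_def)
  have ae: "AE t in lebesgue_on {0<..<T}. Q t" if "\<And>t. t \<in> {0<..<T} - Z \<Longrightarrow> Q t" for Q
    using that Z by (subst AE_lebesgue_on_iff_negligible) auto
  have ut: "u t = ubar t" if "t \<in> {0<..<T} - Z" for t using that by (intro u_eq) (auto simp: Z_def)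
  have Pc: "continuous_on {0..T} P" and Rc: "continuous_on {0..\<tau>} R"
    using lipschitz_on_continuous_on[OF Plip] lipschitz_on_continuous_on[OF Rlip] by auto

  \<comment> \<open>The sign of the second multiplier changes: the part \<gamma> R is present before
    \<tau> and absent after it, so the jump from left to right is - \<gamma> times the gradient of
    g.\<close>
  have costate: "costate f \<phi> g T ubar xbar \<tau> \<alpha> (- \<gamma>) p"
    unfolding costate_def
  proof (intro conjI exI)
    have "(\<bar>\<alpha>\<bar> * CP + \<bar>\<gamma>\<bar> * CR)-lipschitz_on {0..<\<tau>} (\<lambda>t. \<alpha> *\<^sub>R P t + \<gamma> *\<^sub>R R t)"
      using \<tau> by (intro lipschitz_on_add lipschitz_on_cmult lipschitz_on_subset[OF Plip] lipschitz_on_subset[OF Rlip]) auto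
    then have "(\<bar>\<alpha>\<bar> * CP + \<bar>\<gamma>\<bar> * CR)-lipschitz_on {0..<\<tau>} p"
      by (rule lipschitz_on_transform) (simp add: p_def)
    then show "absolutely_continuous_on {0..<\<tau>} p" by (rule lipschitz_on_imp_absolutely_continuous_on)
    have "(\<bar>\<alpha>\<bar> * CP)-lipschitz_on {\<tau><..T} (\<lambda>t. \<alpha> *\<^sub>R P t)"
      using \<tau> by (intro lipschitz_on_cmult lipschitz_on_subset[OF Plip]) auto
    then have "(\<bar>\<alpha>\<bar> * CP)-lipschitz_on {\<tau><..T} p"
      by (rule lipschitz_on_transform) (simp add: p_def)
    then show "absolutely_continuous_on {\<tau><..T} p" by (rule lipschitz_on_imp_absolutely_continuous_on)
    show "AE t in lebesgue_on {0<..<T}.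
        (p has_vector_derivative - gradient (\<lambda>x. hamiltonian f x (p t) (ubar t)) (xbar t)) (at t)"
    proof (rule ae)
      fix t assume t: "t \<in> {0<..<T} - Z"
      have eq: "gradient (\<lambda>x. hamiltonian f x (p t) (ubar t)) (xbar t) = adjoint_fst (f' (xbar t, u t)) (p t)"
        unfolding ut[OF t, symmetric] by (rule gradient_hamiltonian[OF f'(1)])
      have dP: "(P has_vector_derivative - adjoint_fst (f' (xbar t, u t)) (P t)) (at t)"
        using Pder t by (auto simp: Z_def)
      show "(p has_vector_derivative - gradient (\<lambda>x. hamiltonian f x (p t) (ubar t)) (xbar t)) (at t)"
        unfolding eq
      proof (cases "t < \<tau>")
        case True
        have dR: "(R has_vector_derivative - adjoint_fst (f' (xbar t, u t)) (R t)) (at t)"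
          using Rder t True by (auto simp: Z_def)
        have "((\<lambda>t. \<alpha> *\<^sub>R P t + \<gamma> *\<^sub>R R t) has_vector_derivative
          \<alpha> *\<^sub>R - adjoint_fst (f' (xbar t, u t)) (P t) + \<gamma> *\<^sub>R - adjoint_fst (f' (xbar t, u t)) (R t)) (at t)"
          by (intro has_vector_derivative_add bounded_linear.has_vector_derivative[OF bounded_linear_scaleR_right] dP dR)
        then have "((\<lambda>t. \<alpha> *\<^sub>R P t + \<gamma> *\<^sub>R R t) has_vector_derivative - adjoint_fst (f' (xbar t, u t)) (p t)) (at t)"
          using True by (simp add: p_def adjoint_linear)
        then show "(p has_vector_derivative - adjoint_fst (f' (xbar t, u t)) (p t)) (at t)"
          by (rule has_vector_derivative_transform_within_open[where S = "{..<\<tau>}"]) (use True in \<open>auto simp: p_def\<close>)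
      next
        case False
        then have "\<tau> < t" using t by (auto simp: Z_def)
        have "((\<lambda>t. \<alpha> *\<^sub>R P t) has_vector_derivative \<alpha> *\<^sub>R - adjoint_fst (f' (xbar t, u t)) (P t)) (at t)"
          by (intro bounded_linear.has_vector_derivative[OF bounded_linear_scaleR_right] dP)
        then have "((\<lambda>t. \<alpha> *\<^sub>R P t) has_vector_derivative - adjoint_fst (f' (xbar t, u t)) (p t)) (at t)"
          using \<open>\<tau> < t\<close> by (simp add: p_def adjoint_linear)
        then show "(p has_vector_derivative - adjoint_fst (f' (xbar t, u t)) (p t)) (at t)"
          by (rule has_vector_derivative_transform_within_open[where S = "{\<tau><..}"]) (use \<open>\<tau> < t\<close> in \<open>auto simp: p_def\<close>)
      qed
    qed
    show "p T = \<alpha> *\<^sub>R gradient \<phi> (xbar T)" using \<tau> by (simp add: p_def PT)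
    have "((\<lambda>t. \<alpha> *\<^sub>R P t + \<gamma> *\<^sub>R R t) \<longlongrightarrow> \<alpha> *\<^sub>R P \<tau> + \<gamma> *\<^sub>R R \<tau>) (at_left \<tau>)"
      using \<tau> by (intro tendsto_intros continuous_on_Icc_at_leftD[of 0 \<tau>] Rc continuous_on_subset[OF Pc]) auto
    then show "(p \<longlongrightarrow> \<alpha> *\<^sub>R P \<tau> + \<gamma> *\<^sub>R R \<tau>) (at_left \<tau>)"
      by (rule Lim_transform_eventually) (auto simp: p_def eventually_at_left_field intro!: exI[of _ 0] \<tau>)
    have "((\<lambda>t. \<alpha> *\<^sub>R P t) \<longlongrightarrow> \<alpha> *\<^sub>R P \<tau>) (at_right \<tau>)"
      using \<tau> by (intro tendsto_intros continuous_on_Icc_at_rightD[of \<tau> T] continuous_on_subset[OF Pc]) auto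
    then show "(p \<longlongrightarrow> \<alpha> *\<^sub>R P \<tau>) (at_right \<tau>)"
      by (rule Lim_transform_eventually) (auto simp: p_def eventually_at_right_field intro!: exI[of _ T] \<tau>)
    show "\<alpha> *\<^sub>R P \<tau> - (\<alpha> *\<^sub>R P \<tau> + \<gamma> *\<^sub>R R \<tau>) = - \<gamma> *\<^sub>R gradient g (xbar \<tau>)"
      by (simp add: R\<tau>)
  qed

  have pm: "p \<in> borel_measurable ?M"
  proof -
    have "continuous_on {0..T} (\<lambda>t. R (min t \<tau>))"
      by (rule continuous_on_compose2[OF Rc]) (use \<tau> in \<open>auto intro!: continuous_intros\<close>)
    moreover have "{t. t < \<tau>} \<inter> space ?M \<in> sets ?M"
      by (subst sets_restrict_space_iff) auto
    ultimately have "(\<lambda>t. \<alpha> *\<^sub>R P t + (if t \<in> {t. t < \<tau>} then \<gamma> *\<^sub>R R (min t \<tau>) else 0)) \<in> borel_measurable ?M"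
      by (intro borel_measurable_add borel_measurable_scaleR borel_measurable_const measurable_If_set
          continuous_on_Icc_borel_measurable_lebesgue Pc)
    also have "(\<lambda>t. \<alpha> *\<^sub>R P t + (if t \<in> {t. t < \<tau>} then \<gamma> *\<^sub>R R (min t \<tau>) else 0)) = p"
      by (auto simp: p_def)
    finally show ?thesis .
  qed
  obtain bP bR where bP: "\<And>t. t \<in> {0..T} \<Longrightarrow> norm (P t) \<le> bP" and bR: "\<And>t. t \<in> {0..\<tau>} \<Longrightarrow> norm (R t) \<le> bR"
    using continuous_on_Icc_bounded[OF Pc] continuous_on_Icc_bounded[OF Rc] by blast
  have pb: "norm (p t) \<le> \<bar>\<alpha>\<bar> * bP + \<bar>\<gamma>\<bar> * bR" if t: "t \<in> {0..T}" for t
  proof -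
    have "0 \<le> bR" using order_trans[OF norm_ge_zero bR[of \<tau>]] \<tau> by simp
    then have "norm (if t < \<tau> then \<gamma> *\<^sub>R R t else 0) \<le> \<bar>\<gamma>\<bar> * bR"
      using bR[of t] t by (auto intro!: mult_left_mono)
    moreover have "norm (\<alpha> *\<^sub>R P t) \<le> \<bar>\<alpha>\<bar> * bP" using bP[OF t] by (auto intro!: mult_left_mono)
    ultimately show ?thesis unfolding p_def by (intro order_trans[OF norm_triangle_ineq] add_mono)
  qed
  obtain Lv where Lv: "\<And>t. t \<in> {0..T} \<Longrightarrow> norm (f (xbar t, u t)) \<le> Lv"
    using bounded_along_trajectory[where u = u, OF contf xc ub] by blast
  have fm: "(\<lambda>t. f (xbar t, w t)) \<in> borel_measurable ?M" if "w \<in> borel_measurable ?M" for w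
    by (intro borel_measurable_compose_Pair contf continuous_on_Icc_borel_measurable_lebesgue xc that)
  have "(LINT t|lebesgue_on {0<..<T}. rho T \<tau> t * hamiltonian f (xbar t) (p t) (ubar t))
      = (LINT t|lebesgue_on {0<..<T}. rho T \<tau> t * (p t \<bullet> f (xbar t, u t)))"
  proof (rule integral_cong_AE)
    show "(\<lambda>t. rho T \<tau> t * hamiltonian f (xbar t) (p t) (ubar t)) \<in> borel_measurable (lebesgue_on {0<..<T})"
      unfolding hamiltonian_def
      by (rule measurable_restrict_mono[where A = "{0..T}"])
        (auto intro!: borel_measurable_times borel_measurable_inner borel_measurable_rho pm fm ubarm)
    show "(\<lambda>t. rho T \<tau> t * (p t \<bullet> f (xbar t, u t))) \<in> borel_measurable (lebesgue_on {0<..<T})"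
      by (rule measurable_restrict_mono[where A = "{0..T}"])
        (auto intro!: borel_measurable_times borel_measurable_inner borel_measurable_rho pm fm um)
    show "AE t in lebesgue_on {0<..<T}. rho T \<tau> t * hamiltonian f (xbar t) (p t) (ubar t) = rho T \<tau> t * (p t \<bullet> f (xbar t, u t))"
      by (rule ae) (simp add: hamiltonian_def ut)
  qed
  also have "\<dots> = integral {0..T} (\<lambda>t. rho T \<tau> t * (p t \<bullet> f (xbar t, u t)))"
  proof (rule integrable_on_Ioo_of_bounded_measurable(2))
    show "(\<lambda>t. rho T \<tau> t * (p t \<bullet> f (xbar t, u t))) \<in> borel_measurable ?M"
      by (intro borel_measurable_times borel_measurable_inner borel_measurable_rho pm fm um)
    show "\<bar>rho T \<tau> t * (p t \<bullet> f (xbar t, u t))\<bar> \<le> max (1 / \<tau>) (1 / (T - \<tau>)) * ((\<bar>\<alpha>\<bar> * bP + \<bar>\<gamma>\<bar> * bR) * Lv)"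
      if t: "t \<in> {0..T}" for t
    proof -
      have "\<bar>p t \<bullet> f (xbar t, u t)\<bar> \<le> (\<bar>\<alpha>\<bar> * bP + \<bar>\<gamma>\<bar> * bR) * Lv"
        by (rule abs_inner_le_mult[OF pb[OF t] Lv[OF t]])
      then show ?thesis
        unfolding abs_mult using \<tau> by (intro mult_mono abs_rho_le) (auto simp: le_max_iff_disj)
    qed
  qed
  also have "\<dots> = \<alpha>" using ham unfolding p_def .
  finally have ham': "(LINT t|lebesgue_on {0<..<T}. rho T \<tau> t * hamiltonian f (xbar t) (p t) (ubar t)) = \<alpha>" .

  have "\<nu> \<in> borel_measurable (lebesgue_on {0<..<T})"
    by (rule measurable_restrict_mono[OF \<nu>(1)]) auto
  then have \<nu>L: "\<nu> \<in> L_infinity T"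
    using \<nu>(2) by (auto simp: L_infinity_def intro!: exI[of _ CN] ae)
  have sign: "AE t in lebesgue_on {0<..<T}. (\<forall>i. 0 \<le> \<nu> t $ i) \<and> \<nu> t \<bullet> c (ubar t) = 0"
  proof (rule ae)
    fix t assume t: "t \<in> {0<..<T} - Z"
    then have "(\<forall>i. 0 \<le> \<nu> t $ i) \<and> (\<forall>i. \<nu> t $ i * c (u t) $ i = 0)" using kkt by (auto simp: Z_def)
    then show "(\<forall>i. 0 \<le> \<nu> t $ i) \<and> \<nu> t \<bullet> c (ubar t) = 0"
      unfolding ut[OF t] inner_vec_def by (auto intro!: sum.neutral)
  qed
  have stat: "AE t in lebesgue_on {0<..<T}.
      gradient (\<lambda>u. augmented_hamiltonian f c (xbar t) (p t) u (\<nu> t)) (ubar t) = 0"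
  proof (rule ae)
    fix t assume t: "t \<in> {0<..<T} - Z"
    then have "adjoint_snd (f' (xbar t, u t)) (p t) + (\<Sum>i\<in>UNIV. \<nu> t $ i *\<^sub>R gradient (\<lambda>u. c u $ i) (u t)) = 0"
      using kkt by (auto simp: Z_def p_def)
    then show "gradient (\<lambda>u. augmented_hamiltonian f c (xbar t) (p t) u (\<nu> t)) (ubar t) = 0"
      unfolding ut[OF t, symmetric] gradient_augmented_hamiltonian[OF f'(1) c'(1)] .
  qed
  have "(\<alpha>, - \<gamma>, \<nu>) \<in> lagrange_multipliers f \<phi> c g T ubar xbar \<tau>"
    unfolding lagrange_multipliers_def
    using \<alpha> nz \<nu>L sign costate stat ham' by auto
  then show ?thesis by blast
qed

end
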